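(* For the one-dimensional Helmholtz problem of the context, the $k$-dependence of the sufficient condition for holomorphy of $y\mapsto\mathcal A^{-1}(k,y):\mathcal H^*\to\mathcal H$ given by $$\|\mathcal A_0^{-1}(k)\|_{\mathcal H^*\to\mathcal H}\,|y|\le\tfrac12$$ is sharp through a sequence of wavenumbers, in the following sense: there exist $m_0\in\mathbb Z^+$ and $C>0$ such that, for every integer $m\ge m_0$ and $k=2\pi m\sqrt2$, the map $y\mapsto\mathcal A^{-1}(k,y):\mathcal H^*\to\mathcal H$ is holomorphic on $\{y\in\mathbb C:\|\mathcal A_0^{-1}(k)\|_{\mathcal H^*\to\mathcal H}|y|<\tfrac12\}$, but has a pole at some $y\in\mathbb C$ with $\|\mathcal A_0^{-1}(k)\|_{\mathcal H^*\to\mathcal H}|y|\le C$.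
   Context: For $k>0$ and $y\in\mathbb C$ consider the one-dimensional Helmholtz operator on $(0,\infty)$ $$P:=k^{-2}\partial_x^2+\Big(1-\big(\tfrac12+y\big)\mathbf 1_{[0,1]}(x)\Big),$$ with zero Dirichlet condition at $x=0$ and outgoing condition $(k^{-1}\partial_x-\mathrm i)u|_{x=2}=0$. Let $\mathcal H:=\{v\in H^1(0,2):v(0)=0\}$ with norm $\|v\|^2_{\mathcal H}=k^{-2}\|v'\|^2_{L^2(0,2)}+\|v\|^2_{L^2(0,2)}$, let $\mathcal H^*$ be its space of bounded antilinear functionals with the dual norm, and define $\mathcal A(k,y):\mathcal H\to\mathcal H^*$ by $$\langle\mathcal A(k,y)u,v\rangle:=\int_0^2\Big(k^{-2}u'\overline{v'}-\big(1-(\tfrac12+y)\mathbf 1_{[0,1]}\big)u\overline v\Big)\,dx-\mathrm i k^{-1}u(2)\overline{v(2)},\qquad \mathcal A_0(k):=\mathcal A(k,0).$$ The family $y\mapsto\mathcal A^{-1}(k,y)$ is meromorphic on $\mathbb C$. *)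

theory Defs
  imports "HOL-Analysis.Analysis"
begin

type_synonym fn = "real \<Rightarrow> complex"
type_synonym functional = "fn \<Rightarrow> complex"

definition square_integrable :: "fn \<Rightarrow> bool" where
  "square_integrable f \<longleftrightarrow>
     set_borel_measurable lborel {0<..<2} f \<and>
     set_integrable lborel {0<..<2} (\<lambda>x. (cmod (f x))\<^sup>2)"

text \<open>Test functions are the compactly supported \<open>C\<^sup>1\<close> functions on \<open>(0,2)\<close>, as in Brezis'
  textbook; \<open>C\<^sup>1\<close> and \<open>C\<^sup>\<infinity>\<close> test functions define the same weak derivative. The second
  argument is the derivative of the first.\<close>

definition test_function :: "(real \<Rightarrow> real) \<Rightarrow> (real \<Rightarrow> real) \<Rightarrow> bool" where
  "test_function \<phi> \<phi>' \<longleftrightarrow>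
     (\<forall>x. (\<phi> has_real_derivative \<phi>' x) (at x)) \<and> continuous_on UNIV \<phi>' \<and>
     (\<exists>a b. 0 < a \<and> a \<le> b \<and> b < 2 \<and> (\<forall>x. x \<notin> {a..b} \<longrightarrow> \<phi> x = 0))"

definition has_weak_deriv :: "fn \<Rightarrow> fn \<Rightarrow> bool" where
  "has_weak_deriv v g \<longleftrightarrow>
     square_integrable v \<and> square_integrable g \<and>
     (\<forall>\<phi> \<phi>'. test_function \<phi> \<phi>' \<longrightarrow>
        (LINT x:{0<..<2}|lborel. v x * complex_of_real (\<phi>' x))
        = - (LINT x:{0<..<2}|lborel. g x * complex_of_real (\<phi> x)))"

text \<open>Weak derivatives are unique up to null sets only; \<open>weak_deriv v\<close> is some representative
  and is used under integrals only.\<close>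

definition weak_deriv :: "fn \<Rightarrow> fn" where
  "weak_deriv v = (SOME g. has_weak_deriv v g)"

text \<open>A class in \<open>H\<^sup>1(0,2)\<close> is represented by its unique representative that is continuous on
  \<open>[0,2]\<close>, extended by \<open>0\<close> off \<open>[0,2]\<close>. Equality in \<open>H\<^sup>1(0,2)\<close> is then equality of functions, and
  the traces at \<open>0\<close> and \<open>2\<close> are point values.\<close>

definition H_space :: "fn set" where
  "H_space = {v. continuous_on {0..2} v \<and> (\<forall>x. x \<notin> {0..2} \<longrightarrow> v x = 0) \<and>
                 (\<exists>g. has_weak_deriv v g) \<and> v 0 = 0}"

definition H_norm :: "real \<Rightarrow> fn \<Rightarrow> real" where
  "H_norm k v = sqrt ((LINT x:{0<..<2}|lborel. (cmod (weak_deriv v x))\<^sup>2) / k\<^sup>2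
                      + (LINT x:{0<..<2}|lborel. (cmod (v x))\<^sup>2))"

text \<open>Functionals are set to \<open>0\<close> off \<open>H_space\<close>, so that equality on \<open>H_space\<close> is equality.\<close>

definition H_dual :: "real \<Rightarrow> functional set" where
  "H_dual k = {F. (\<forall>u\<in>H_space. \<forall>v\<in>H_space. F (\<lambda>x. u x + v x) = F u + F v) \<and>
                  (\<forall>c. \<forall>v\<in>H_space. F (\<lambda>x. c * v x) = cnj c * F v) \<and>
                  (\<exists>B. \<forall>v\<in>H_space. cmod (F v) \<le> B * H_norm k v) \<and>
                  (\<forall>v. v \<notin> H_space \<longrightarrow> F v = 0)}"

definition dual_norm :: "real \<Rightarrow> functional \<Rightarrow> real" where
  "dual_norm k F = (SUP v\<in>{v\<in>H_space. H_norm k v \<le> 1}. cmod (F v))"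

definition bounded_ops :: "real \<Rightarrow> (functional \<Rightarrow> fn) set" where
  "bounded_ops k = {T. (\<forall>F\<in>H_dual k. T F \<in> H_space) \<and>
     (\<forall>F\<in>H_dual k. \<forall>G\<in>H_dual k. T (\<lambda>v. F v + G v) = (\<lambda>x. T F x + T G x)) \<and>
     (\<forall>c. \<forall>F\<in>H_dual k. T (\<lambda>v. c * F v) = (\<lambda>x. c * T F x)) \<and>
     (\<exists>B. \<forall>F\<in>H_dual k. H_norm k (T F) \<le> B * dual_norm k F)}"

definition op_norm :: "real \<Rightarrow> (functional \<Rightarrow> fn) \<Rightarrow> real" where
  "op_norm k T = (SUP F\<in>{F\<in>H_dual k. dual_norm k F \<le> 1}. H_norm k (T F))"

text \<open>Complex differentiability in the operator norm at every point; meant for open \<open>S\<close>.\<close>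

definition op_holomorphic_on :: "real \<Rightarrow> (complex \<Rightarrow> functional \<Rightarrow> fn) \<Rightarrow> complex set \<Rightarrow> bool" where
  "op_holomorphic_on k T S \<longleftrightarrow>
     (\<forall>y\<in>S. T y \<in> bounded_ops k \<and>
        (\<exists>D\<in>bounded_ops k.
           ((\<lambda>z. op_norm k (\<lambda>F x. (T z F x - T y F x) / (z - y) - D F x)) \<longlongrightarrow> 0)
             (at y within S)))"

text \<open>A pole of order \<open>n\<close> at \<open>y0\<close>: near \<open>y0\<close>, \<open>T y = (y - y0)\<^sup>-\<^sup>n G y\<close> with \<open>G\<close> holomorphic and
  \<open>G y0 \<noteq> 0\<close>. The value of \<open>T\<close> at \<open>y0\<close> is irrelevant.\<close>

definition op_has_pole :: "real \<Rightarrow> (complex \<Rightarrow> functional \<Rightarrow> fn) \<Rightarrow> complex \<Rightarrow> bool" where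
  "op_has_pole k T y0 \<longleftrightarrow>
     (\<exists>n::nat. \<exists>r G. 0 < n \<and> 0 < r \<and> op_holomorphic_on k G (ball y0 r) \<and>
        (\<exists>F\<in>H_dual k. G y0 F \<noteq> (\<lambda>x. 0)) \<and>
        (\<forall>y\<in>ball y0 r - {y0}. \<forall>F\<in>H_dual k. T y F = (\<lambda>x. G y F x / (y - y0) ^ n)))"

definition helmholtz :: "real \<Rightarrow> complex \<Rightarrow> fn \<Rightarrow> functional" where
  "helmholtz k y u = (\<lambda>v. if v \<in> H_space then
      (LINT x:{0<..<2}|lborel.
          weak_deriv u x * cnj (weak_deriv v x) / (complex_of_real k)\<^sup>2
          - (1 - (1/2 + y) * indicator {0..1} x) * u x * cnj (v x))
      - \<i> / complex_of_real k * u 2 * cnj (v 2)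
    else 0)"

text \<open>Only meaningful where \<open>helmholtz_invertible\<close> holds.\<close>

definition helmholtz_inv :: "real \<Rightarrow> complex \<Rightarrow> functional \<Rightarrow> fn" where
  "helmholtz_inv k y = inv_into H_space (helmholtz k y)"

definition helmholtz_invertible :: "real \<Rightarrow> complex \<Rightarrow> bool" where
  "helmholtz_invertible k y \<longleftrightarrow>
     bij_betw (helmholtz k y) H_space (H_dual k) \<and> helmholtz_inv k y \<in> bounded_ops k"

end

theory Submission
  imports Defs
begin

text \<open>Identifying \<open>v \<in> H\<close> with \<open>v'\<close> makes \<open>H\<close> a complete inner product space, so a functional \<open>F\<close> has
  a Riesz representative \<open>z\<close>. Writing a solution as \<open>W + z\<close> turns the Helmholtz problem into an ordinary
  differential equation for \<open>W\<close> with continuous data \<open>z\<close>, solved by variation of constants up to a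
  residual in the outgoing condition, and the residual is removed with the homogeneous solution. At
  \<open>y = 0\<close> and \<open>k = 2 \<pi> m sqrt 2\<close> the explicit solution bounds the inverse by a multiple of \<open>k\<close>.

  With \<open>\<kappa>\<^sup>2 = 1/2 - y\<close> the homogeneous solution is outgoing iff \<open>exp (2 \<i> k \<kappa>) = (1 + \<kappa>) / (1 - \<kappa>)\<close>.
  For \<open>\<kappa> = 1 / sqrt 2 + w / k\<close> this is a fixed-point equation for \<open>w\<close>, solved in a ball of fixed radius
  by Brouwer's theorem, so there is a resonance \<open>y\<close> of size \<open>1/k\<close>. Its mode \<open>e\<close> satisfies
  \<open>\<integral>\<^sub>0\<^sup>1 e\<^sup>2 \<noteq> 0\<close>, whence a simple pole; holomorphy in the ball is the Neumann series.\<close>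

section \<open>Square-integrable functions and primitives on (0,2)\<close>

text \<open>The claim follows from an O(k) bound on the inverse at \<open>y = 0\<close> together
  with a resonance of size O(1/k). For these \<open>k\<close> the inner layer holds exactly
  \<open>m\<close> wavelengths, so sin K = 0 for the inner wave number K: the homogeneous solutions
  stay bounded by 1, and the one vanishing at 0 misses the outgoing condition by exactly
  \<open>1 / (sqrt 2 * k)\<close>. Triangle inequalities then give the bound \<open>80 * k\<close>.

  The sesquilinear form is not Hermitian but complex symmetric: exchanging \<open>u\<close> with the
  conjugate of \<open>v\<close> leaves it unchanged. This takes the place of Fredholm theory. Away
  from resonances it turns surjectivity into injectivity, and at a resonance it yields the
  solvability condition. The natural pairing with the mode is therefore bilinear, which is why the
  integral of \<open>e^2\<close> and not that of its modulus decides on the simple pole.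

  The resonance is not explicit. Brouwer's theorem asks only that a ball be mapped into itself,
  which crude bounds on the logarithm provide. They give modulus at most \<open>8 / k\<close> for
  the resonance, and \<open>C = 640\<close> is \<open>80 * 8\<close>.\<close>

abbreviation M2 :: "real measure" where "M2 \<equiv> restrict_space lborel {0<..<2}"

lemma LINT_M2:
  fixes f :: "real \<Rightarrow> 'a::{banach, second_countable_topology}"
  shows "set_lebesgue_integral lborel {0<..<2} f = integral\<^sup>L M2 f"
  by (subst integral_restrict_space) (simp_all add: set_lebesgue_integral_def)

lemma space_M2 [simp]: "space M2 = {0<..<2}"
  by (simp add: space_restrict_space)

lemma finite_measure_M2: "finite_measure M2"
  by (rule finite_measureI) (simp add: emeasure_restrict_space)

lemma square_integrable_iff:
  "square_integrable f \<longleftrightarrow> f \<in> borel_measurable M2 \<and> integrable M2 (\<lambda>x. (cmod (f x))\<^sup>2)"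
  by (simp add: square_integrable_def set_borel_measurable_def set_integrable_def
      borel_measurable_restrict_space_iff integrable_restrict_space)

lemma square_integrable_bounded:
  assumes [measurable]: "f \<in> borel_measurable M2" and "\<And>x. 0 < x \<Longrightarrow> x < 2 \<Longrightarrow> cmod (f x) \<le> B"
  shows "square_integrable f"
proof -
  interpret finite_measure M2 by (rule finite_measure_M2)
  have "integrable M2 (\<lambda>x. (cmod (f x))\<^sup>2)"
    by (rule integrable_const_bound[where B="B\<^sup>2"]) (auto simp: AE_restrict_space_iff intro!: AE_I2 power_mono assms)
  then show ?thesis by (simp add: square_integrable_iff)
qed

lemma square_integrable_prod:
  assumes "square_integrable f" "square_integrable g"
  shows "integrable M2 (\<lambda>x. f x * g x)"
proof (rule Bochner_Integration.integrable_bound)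
  have [measurable]: "f \<in> borel_measurable M2" "g \<in> borel_measurable M2"
    using assms by (auto simp: square_integrable_iff)
  show "integrable M2 (\<lambda>x. (cmod (f x))\<^sup>2 + (cmod (g x))\<^sup>2)"
    using assms by (auto simp: square_integrable_iff)
  show "(\<lambda>x. f x * g x) \<in> borel_measurable M2" by measurable
  show "AE x in M2. norm (f x * g x) \<le> norm ((cmod (f x))\<^sup>2 + (cmod (g x))\<^sup>2)"
  proof (rule AE_I2)
    fix x
    have "2 * (cmod (f x) * cmod (g x)) \<le> (cmod (f x))\<^sup>2 + (cmod (g x))\<^sup>2"
      using sum_squares_bound[of "cmod (f x)" "cmod (g x)"] by simp
    then show "norm (f x * g x) \<le> norm ((cmod (f x))\<^sup>2 + (cmod (g x))\<^sup>2)"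
      by (simp add: norm_mult) (smt (verit) norm_ge_zero mult_nonneg_nonneg)
  qed
qed

lemma square_integrable_cnj [intro]: "square_integrable f \<Longrightarrow> square_integrable (\<lambda>x. cnj (f x))"
  by (auto simp: square_integrable_iff intro: measurable_compose[OF _ borel_measurable_continuous_onI[OF continuous_on_cnj[OF continuous_on_id]]])

lemma square_integrable_scale [intro]: "square_integrable f \<Longrightarrow> square_integrable (\<lambda>x. c * f x)"
  by (auto simp: square_integrable_iff norm_mult power_mult_distrib)

lemma square_integrable_add [intro]:
  assumes "square_integrable f" "square_integrable g"
  shows "square_integrable (\<lambda>x. f x + g x)"
proof -
  have [measurable]: "f \<in> borel_measurable M2" "g \<in> borel_measurable M2"
    using assms by (auto simp: square_integrable_iff)
  have "integrable M2 (\<lambda>x. (cmod (f x + g x))\<^sup>2)"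
  proof (rule Bochner_Integration.integrable_bound)
    show "integrable M2 (\<lambda>x. 2 * ((cmod (f x))\<^sup>2 + (cmod (g x))\<^sup>2))"
      using assms by (auto simp: square_integrable_iff)
    have "(cmod (a + b))\<^sup>2 \<le> 2 * ((cmod a)\<^sup>2 + (cmod b)\<^sup>2)" for a b
    proof -
      have "(cmod (a + b))\<^sup>2 \<le> (cmod a + cmod b)\<^sup>2" by (intro power_mono norm_triangle_ineq) auto
      also have "\<dots> \<le> 2 * ((cmod a)\<^sup>2 + (cmod b)\<^sup>2)"
        using sum_squares_bound[of "cmod a" "cmod b"] by (simp add: power2_sum)
      finally show ?thesis .
    qed
    then show "AE x in M2. norm ((cmod (f x + g x))\<^sup>2) \<le> norm (2 * ((cmod (f x))\<^sup>2 + (cmod (g x))\<^sup>2))"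
      by (intro AE_I2) simp
  qed measurable
  then show ?thesis by (simp add: square_integrable_iff)
qed

lemma square_integrable_diff [intro]:
  assumes "square_integrable f" "square_integrable g"
  shows "square_integrable (\<lambda>x. f x - g x)"
  using square_integrable_add[OF assms(1) square_integrable_scale[OF assms(2), of "-1"]] by simp

lemma square_integrable_1: "square_integrable (\<lambda>x. 1)"
  by (rule square_integrable_bounded[of _ 1]) auto

lemma square_integrable_integrable: "square_integrable f \<Longrightarrow> integrable M2 f"
  using square_integrable_prod[OF _ square_integrable_1] by simp

lemma continuous_on_measurable_M2:
  fixes f :: "real \<Rightarrow> complex"
  assumes "continuous_on {0..2} f" shows "f \<in> borel_measurable M2"
proof -
  have "f \<in> borel_measurable (restrict_space borel {0<..<2})"
    by (rule borel_measurable_continuous_on_restrict) (rule continuous_on_subset[OF assms], auto)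
  moreover have "sets (restrict_space borel {0<..<2}) = sets M2" by (simp cong: sets_restrict_space_cong)
  ultimately show ?thesis
    by (simp cong: measurable_cong_sets)
qed

lemma square_integrable_continuous:
  assumes "continuous_on {0..2} f" shows "square_integrable f"
proof -
  have "compact (f ` {0..2})" by (intro compact_continuous_image assms) auto
  then obtain B where "\<And>x. x \<in> {0..2} \<Longrightarrow> cmod (f x) \<le> B"
    by (meson bounded_iff compact_imp_bounded image_eqI)
  then show ?thesis
    by (intro square_integrable_bounded[of _ B] continuous_on_measurable_M2 assms) auto
qed

text \<open>Cut off outside \<open>[0,2]\<close> to agree with the convention in
  \<open>H_space\<close>, so that \<open>primitive (weak_deriv v) = v\<close> can hold as an
  equation of functions.\<close>

definition primitive :: "fn \<Rightarrow> fn" where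
  "primitive g x = (if x \<in> {0..2} then \<integral>t. indicator {..x} t * g t \<partial>M2 else 0)"

lemma integrable_indicator_M2 [intro]:
  fixes g :: fn
  assumes "integrable M2 g" shows "integrable M2 (\<lambda>t. indicator {..x} t * g t)"
  using integrable_mult_indicator[of "{..x} \<inter> {0<..<2}" M2 g] assms
  apply (simp add: sets_restrict_space_iff)
  apply (erule Bochner_Integration.integrable_cong[THEN iffD1, rotated 2])
   apply (auto simp: indicator_def)
  done

text \<open>Both sides integrate \<open>g t * p s\<close> over the triangle
  \<open>t \<le> s\<close>. In \<open>integral_by_parts\<close> this stands in for the product rule,
  since \<open>primitive g\<close> need not be differentiable at a given point.\<close>

lemma Fubini_M2:
  fixes p g :: fn
  assumes p: "integrable M2 p" and g: "integrable M2 g"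
  shows "(\<integral>t. g t * (\<integral>s. indicator {t..} s * p s \<partial>M2) \<partial>M2) = (\<integral>s. p s * primitive g s \<partial>M2)"
proof -
  interpret finite_measure M2 by (rule finite_measure_M2)
  interpret pair_sigma_finite M2 M2 ..
  have [measurable]: "p \<in> borel_measurable M2" "g \<in> borel_measurable M2" using p g by auto
  have id[measurable]: "(\<lambda>x. x) \<in> borel_measurable M2"
    by (auto intro: measurable_restrict_space1)
  have [measurable]: "Measurable.pred (M2 \<Otimes>\<^sub>M M2) (\<lambda>x. fst x \<le> snd x)"
    by measurable
  have int: "integrable (M2 \<Otimes>\<^sub>M M2) (\<lambda>(t,s). if t \<le> s then g t * p s else 0)"
  proof (rule Bochner_Integration.integrable_bound)
    show "integrable (M2 \<Otimes>\<^sub>M M2) (\<lambda>x. g (fst x) * p (snd x))"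
    proof (rule Fubini_integrable)
      show "integrable M2 (\<lambda>x. LINT y|M2. norm (g (fst (x, y)) * p (snd (x, y))))"
        using g by (simp add: norm_mult)
    qed (use p in auto)
    show "AE x in M2 \<Otimes>\<^sub>M M2. norm (case x of (t, s) \<Rightarrow> if t \<le> s then g t * p s else 0)
        \<le> norm (g (fst x) * p (snd x))"
      by (rule AE_I2) (auto simp: norm_mult)
  qed measurable
  have "(\<integral>t. g t * (\<integral>s. indicator {t..} s * p s \<partial>M2) \<partial>M2)
      = (\<integral>t. (\<integral>s. (if t \<le> s then g t * p s else 0) \<partial>M2) \<partial>M2)"
    by (auto simp: indicator_def simp flip: integral_mult_right_zero intro!: Bochner_Integration.integral_cong)
  also have "\<dots> = (\<integral>s. (\<integral>t. (if t \<le> s then g t * p s else 0) \<partial>M2) \<partial>M2)"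
    by (rule Fubini_integral[symmetric]) (use int in \<open>simp add: case_prod_beta'\<close>)
  also have "\<dots> = (\<integral>s. p s * primitive g s \<partial>M2)"
    by (auto simp: primitive_def indicator_def simp flip: integral_mult_right_zero intro!: Bochner_Integration.integral_cong)
  finally show ?thesis .
qed


lemma primitive_add:
  "integrable M2 f \<Longrightarrow> integrable M2 g \<Longrightarrow> primitive (\<lambda>x. f x + g x) = (\<lambda>x. primitive f x + primitive g x)"
  by (auto simp: primitive_def fun_eq_iff distrib_left integrable_indicator_M2)

lemma primitive_scale: "primitive (\<lambda>x. c * g x) = (\<lambda>x. c * primitive g x)"
  by (auto simp: primitive_def fun_eq_iff mult.left_commute[of _ c])

lemma primitive_cnj: "primitive (\<lambda>x. cnj (g x)) = (\<lambda>x. cnj (primitive g x))"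
proof
  fix x
  have "(\<integral>t. indicator {..x} t * cnj (g t) \<partial>M2) = (\<integral>t. cnj (indicator {..x} t * g t) \<partial>M2)"
    by (intro Bochner_Integration.integral_cong) (auto simp: indicator_def)
  then show "primitive (\<lambda>x. cnj (g x)) x = cnj (primitive g x)"
    by (simp add: primitive_def del: complex_cnj_mult)
qed

lemma primitive_0 [simp]: "primitive g 0 = 0"
proof -
  have "(\<integral>t. indicator {..0} t * g t \<partial>M2) = (\<integral>t. 0 \<partial>M2)"
    by (intro Bochner_Integration.integral_cong) (auto simp: indicator_def)
  then show ?thesis by (simp add: primitive_def)
qed

lemma primitive_2: "primitive g 2 = (\<integral>t. g t \<partial>M2)"
  unfolding primitive_def
  by (auto intro!: Bochner_Integration.integral_cong simp: indicator_def)

text \<open>Bridge to the gauge integral, from which continuity, the fundamental theorem and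
  pointwise differentiability of primitives are taken.\<close>

lemma primitive_HK:
  assumes "integrable M2 g"
  shows "(\<lambda>t. indicator {0<..<2} t * g t) integrable_on {0..2}"
    and "x \<in> {0..2} \<Longrightarrow> primitive g x = integral {0..x} (\<lambda>t. indicator {0<..<2} t * g t)"
proof -
  let ?g = "\<lambda>t. indicator {0<..<2} t * g t"
  have "integrable lborel (\<lambda>t. indicator {0<..<2} t *\<^sub>R g t)"
    using assms by (simp add: integrable_restrict_space)
  then have "integrable lborel ?g"
    by (erule_tac Bochner_Integration.integrable_cong[THEN iffD1, rotated 2]) (auto simp: indicator_def)
  then have i: "set_integrable lborel {0..x} ?g" for x
    unfolding set_integrable_def by (intro integrable_mult_indicator) auto
  show "?g integrable_on {0..2}"
    by (rule set_borel_integral_eq_integral(1)[OF i])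
  assume x: "x \<in> {0..2}"
  have "primitive g x = (\<integral>t. indicator {0<..<2} t *\<^sub>R (indicator {..x} t * g t) \<partial>lborel)"
    using x by (simp add: primitive_def integral_restrict_space)
  also have "\<dots> = set_lebesgue_integral lborel {0..x} ?g"
    unfolding set_lebesgue_integral_def
    by (intro Bochner_Integration.integral_cong) (auto simp: indicator_def)
  also have "\<dots> = integral {0..x} ?g"
    by (rule set_borel_integral_eq_integral(2)[OF i])
  finally show "primitive g x = integral {0..x} ?g" .
qed

lemma primitive_continuous:
  assumes "integrable M2 g" shows "continuous_on {0..2} (primitive g)"
  using indefinite_integral_continuous_1[OF primitive_HK(1)[OF assms]]
  by (rule continuous_on_eq) (use primitive_HK(2)[OF assms] in auto)

text \<open>The finite exceptional set is there for the interface \<open>x = 1\<close>, where the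
  second derivative of a solution jumps.\<close>

lemma primitive_FTC:
  fixes f f' :: fn
  assumes "continuous_on {0..2} f" and "finite S"
    and d: "\<And>x. x \<in> {0<..<2} - S \<Longrightarrow> (f has_vector_derivative f' x) (at x)"
    and i: "integrable M2 f'" and x: "x \<in> {0..2}"
  shows "primitive f' x = f x - f 0"
proof -
  have "(f' has_integral (f x - f 0)) {0..x}"
    using x by (intro fundamental_theorem_of_calculus_interior_strong[OF \<open>finite S\<close>] d
        continuous_on_subset[OF assms(1)]) auto
  then have "((\<lambda>t. indicator {0<..<2} t * f' t) has_integral (f x - f 0)) {0..x}"
    using x by (elim has_integral_spike_finite[of "{0,2}", rotated 2]) (auto simp: indicator_def)
  then show ?thesis using primitive_HK(2)[OF i x] by (simp add: integral_unique)
qed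

lemma integral_tail:
  assumes p: "integrable M2 p" and t: "t \<in> {0..2}"
  shows "(\<integral>s. indicator {t..} s * p s \<partial>M2) = primitive p 2 - primitive p t"
proof -
  have i: "integrable M2 (\<lambda>s. indicator {..t} s * p s)" by (rule integrable_indicator_M2[OF p])
  have "(\<integral>s. indicator {t..} s * p s \<partial>M2) = (\<integral>s. p s - indicator {..t} s * p s \<partial>M2)"
  proof (rule integral_cong_AE)
    have [measurable]: "p \<in> borel_measurable M2" using p by auto
    have id[measurable]: "(\<lambda>x. x) \<in> borel_measurable M2"
      by (auto intro: measurable_restrict_space1)
    show "(\<lambda>s. p s - indicator {..t} s * p s) \<in> borel_measurable M2"
      using i p by auto
    have "(\<lambda>s. if t \<le> s then p s else 0) \<in> borel_measurable M2" by measurable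
    then show "(\<lambda>s. indicator {t..} s * p s) \<in> borel_measurable M2"
      by (simp add: indicator_def if_distrib[where f="\<lambda>c. c * _"] cong: if_cong)
    \<comment> \<open>The intervals \<open>{t..}\<close> and \<open>{..t}\<close> share the point
      \<open>t\<close>, so the integrands agree only almost everywhere.\<close>
    have "AE s in lborel. s \<noteq> t" by (rule AE_lborel_singleton)
    then show "AE s in M2. indicator {t..} s * p s = p s - indicator {..t} s * p s"
      by (subst AE_restrict_space_iff) (auto simp: indicator_def elim: eventually_mono)
  qed
  also have "\<dots> = primitive p 2 - primitive p t"
    unfolding primitive_2 using t by (simp add: Bochner_Integration.integral_diff[OF p i] primitive_def)
  finally show ?thesis .
qed

text \<open>The integral of \<open>f'\<close> over \<open>{t..}\<close> is \<open>f 2 - f t\<close>;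
  inserting this after exchanging the order of integration gives the formula for any square
  integrable \<open>g\<close>.\<close>

lemma integral_by_parts:
  fixes f f' g :: fn
  assumes "continuous_on {0..2} f" and "finite S"
    and "\<And>x. x \<in> {0<..<2} - S \<Longrightarrow> (f has_vector_derivative f' x) (at x)"
    and i: "integrable M2 f'" and g: "square_integrable g"
  shows "(\<integral>x. f' x * primitive g x \<partial>M2) = f 2 * primitive g 2 - (\<integral>x. g x * f x \<partial>M2)"
proof -
  have FTC: "primitive f' t = f t - f 0" if "t \<in> {0..2}" for t
    by (rule primitive_FTC[OF assms(1-4) that])
  have "(\<integral>x. f' x * primitive g x \<partial>M2) = (\<integral>t. g t * (\<integral>s. indicator {t..} s * f' s \<partial>M2) \<partial>M2)"
    by (rule Fubini_M2[OF i square_integrable_integrable[OF g], symmetric])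
  also have "\<dots> = (\<integral>t. g t * f 2 - g t * f t \<partial>M2)"
    by (intro Bochner_Integration.integral_cong) (auto simp: integral_tail[OF i] FTC right_diff_distrib)
  also have "\<dots> = f 2 * primitive g 2 - (\<integral>x. g x * f x \<partial>M2)"
    using square_integrable_prod[OF g square_integrable_continuous[OF assms(1)]]
      square_integrable_integrable[OF g]
    by (simp add: Bochner_Integration.integral_diff primitive_2)
  finally show ?thesis .
qed

lemma has_weak_deriv_primitive:
  assumes g: "square_integrable g"
  shows "has_weak_deriv (primitive g) g"
  unfolding has_weak_deriv_def
proof (intro conjI allI impI)
  show "square_integrable (primitive g)"
    by (intro square_integrable_continuous primitive_continuous square_integrable_integrable g)
  fix \<phi> \<phi>' assume t: "test_function \<phi> \<phi>'"
  \<comment> \<open>Compact support removes the only boundary term, the one at 2; at 0 the primitive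
    itself vanishes.\<close>
  have 2: "\<phi> 2 = 0" using t by (force simp: test_function_def)
  have "(\<integral>x. of_real (\<phi>' x) * primitive g x \<partial>M2)
      = of_real (\<phi> 2) * primitive g 2 - (\<integral>x. g x * of_real (\<phi> x) \<partial>M2)"
  proof (rule integral_by_parts[OF _ finite.emptyI _ _ g])
    show "continuous_on {0..2} (\<lambda>x. complex_of_real (\<phi> x))"
      using t by (intro continuous_intros continuous_at_imp_continuous_on)
        (auto simp: test_function_def intro: DERIV_isCont)
    show "((\<lambda>x. complex_of_real (\<phi> x)) has_vector_derivative complex_of_real (\<phi>' x)) (at x)" for x
      using t by (intro has_vector_derivative_of_real)
        (auto simp: test_function_def has_real_derivative_iff_has_vector_derivative)
    show "integrable M2 (\<lambda>x. complex_of_real (\<phi>' x))"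
      using t by (intro square_integrable_integrable square_integrable_continuous continuous_intros)
        (auto simp: test_function_def intro: continuous_on_subset)
  qed
  then show "(LINT x:{0<..<2}|lborel. primitive g x * complex_of_real (\<phi>' x))
      = - (LINT x:{0<..<2}|lborel. g x * complex_of_real (\<phi> x))"
    by (simp add: LINT_M2 2 mult.commute)
qed (rule g)

text \<open>Serves three times: for Cauchy-Schwarz in L2, for Cauchy-Schwarz in
  \<open>H_inner\<close>, and for the first variation in \<open>Riesz_representation\<close>, where
  \<open>A = 0\<close> forces \<open>B = 0\<close>.\<close>

lemma quadratic_nonneg_imp_discriminant:
  fixes A B C :: real
  assumes q: "\<And>t. 0 \<le> A + 2 * t * B + t\<^sup>2 * C"
  shows "B\<^sup>2 \<le> A * C"
proof (cases "C = 0")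
  case True
  have "B = 0"
  proof (rule ccontr)
    assume "B \<noteq> 0"
    \<comment> \<open>At this \<open>t\<close> the affine function takes the value -1.\<close>
    then show False using q[of "- (A + 1) / (2 * B)"] True by (simp add: field_simps)
  qed
  then show ?thesis using q[of 0] True by simp
next
  case False
  have "C \<ge> 0"
  proof (rule ccontr)
    assume "\<not> C \<ge> 0"
    \<comment> \<open>Large enough that \<open>t * C \<le> - \<bar>A\<bar> - 1\<close>; averaging
      the inequalities at \<open>t\<close> and \<open>-t\<close> cancels the linear term and leaves
      a negative value.\<close>
    define t where "t = (\<bar>A\<bar> + 1) / (-C) + 1"
    have t: "t \<ge> 1" "t * C \<le> - \<bar>A\<bar> - 1"
      using \<open>\<not> C \<ge> 0\<close> by (auto simp: t_def field_simps)
    have "0 \<le> A + t * (t * C)" using q[of t] q[of "-t"] by (simp add: power2_eq_square)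
    also have "t * (t * C) \<le> t * (- \<bar>A\<bar> - 1)" using t by (intro mult_left_mono) auto
    also have "t * (- \<bar>A\<bar> - 1) \<le> 1 * (- \<bar>A\<bar> - 1)" using t by (intro mult_right_mono_neg) auto
    finally show False by simp
  qed
  then have C: "C > 0" using False by simp
  have "0 \<le> A + 2 * (- B / C) * B + (- B / C)\<^sup>2 * C" by (rule q)
  also have "\<dots> = A - B\<^sup>2 / C" using C by (simp add: field_simps power2_eq_square)
  finally show ?thesis using C by (simp add: field_simps)
qed

lemma Cauchy_Schwarz_M2:
  assumes f: "square_integrable f" and g: "square_integrable g"
  shows "(\<integral>x. cmod (f x) * cmod (g x) \<partial>M2)\<^sup>2 \<le> (\<integral>x. (cmod (f x))\<^sup>2 \<partial>M2) * (\<integral>x. (cmod (g x))\<^sup>2 \<partial>M2)"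
proof (rule quadratic_nonneg_imp_discriminant)
  fix t :: real
  have 1: "integrable M2 (\<lambda>x. (cmod (f x))\<^sup>2)" "integrable M2 (\<lambda>x. (cmod (g x))\<^sup>2)"
    using f g by (auto simp: square_integrable_iff)
  have 2: "integrable M2 (\<lambda>x. cmod (f x) * cmod (g x))"
    using integrable_norm[OF square_integrable_prod[OF f g]] by (simp add: norm_mult)
  have "0 \<le> (\<integral>x. (cmod (f x) + t * cmod (g x))\<^sup>2 \<partial>M2)" by simp
  also have "\<dots> = (\<integral>x. (cmod (f x))\<^sup>2 + (2 * t * (cmod (f x) * cmod (g x)) + t\<^sup>2 * (cmod (g x))\<^sup>2) \<partial>M2)"
    by (intro Bochner_Integration.integral_cong) (auto simp: power2_sum power_mult_distrib)
  also have "\<dots> = (\<integral>x. (cmod (f x))\<^sup>2 \<partial>M2) + 2 * t * (\<integral>x. cmod (f x) * cmod (g x) \<partial>M2)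
      + t\<^sup>2 * (\<integral>x. (cmod (g x))\<^sup>2 \<partial>M2)"
    using 1 2 by simp
  finally show "0 \<le> (\<integral>x. (cmod (f x))\<^sup>2 \<partial>M2) + 2 * t * (\<integral>x. cmod (f x) * cmod (g x) \<partial>M2)
      + t\<^sup>2 * (\<integral>x. (cmod (g x))\<^sup>2 \<partial>M2)" .
qed

text \<open>Cauchy-Schwarz against the constant 1; the 2 under the root is the length of the
  interval.\<close>

lemma integral_norm_le_L2:
  assumes f: "square_integrable f"
  shows "(\<integral>x. cmod (f x) \<partial>M2) \<le> sqrt (2 * (\<integral>x. (cmod (f x))\<^sup>2 \<partial>M2))"
proof -
  have m: "measure M2 {0<..<2} = 2" by (simp add: measure_restrict_space)
  have "(\<integral>x. (cmod 1)\<^sup>2 \<partial>M2) = 2" by (simp add: m)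
  then have "(\<integral>x. cmod (f x) \<partial>M2)\<^sup>2 \<le> 2 * (\<integral>x. (cmod (f x))\<^sup>2 \<partial>M2)"
    using Cauchy_Schwarz_M2[OF f square_integrable_1] by (simp add: mult.commute)
  then show ?thesis by (rule real_le_rsqrt)
qed

lemma norm_primitive_le:
  assumes g: "square_integrable g"
  shows "cmod (primitive g x) \<le> sqrt (2 * (\<integral>x. (cmod (g x))\<^sup>2 \<partial>M2))"
proof -
  note i = square_integrable_integrable[OF g]
  have "cmod (\<integral>t. indicator {..x} t * g t \<partial>M2) \<le> (\<integral>t. cmod (g t) \<partial>M2)"
    by (rule order_trans[OF integral_norm_bound], rule integral_mono)
      (use i integrable_indicator_M2[OF i] in \<open>auto simp: indicator_def\<close>)
  then show ?thesis using integral_norm_le_L2[OF g] by (auto simp: primitive_def)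
qed

text \<open>The Borel sets over which \<open>h\<close> integrates to zero contain the half-lines and
  are closed under complements and countable disjoint unions. Half-lines are stable under
  intersection, so these are all Borel sets, and a density that integrates to zero over every set is
  null.\<close>

lemma primitive_eq_0_imp_AE:
  assumes h: "integrable M2 h" and z: "primitive h = (\<lambda>x. 0)"
  shows "AE x in M2. h x = 0"
proof -
  interpret finite_measure M2 by (rule finite_measure_M2)
  have "set_lebesgue_integral M2 A h = 0" if "A \<in> sets M2" for A
  proof -
    from that obtain B where B: "B \<in> sets borel" "A = {0<..<2} \<inter> B"
      by (auto simp: sets_restrict_space)
    define P where "P B \<longleftrightarrow> set_lebesgue_integral M2 ({0<..<2} \<inter> B) h = 0" for B
    have tot: "integral\<^sup>L M2 h = 0" using primitive_2[of h] z by simp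
    have BM: "{0<..<2} \<inter> B \<in> sets M2" if "B \<in> sets borel" for B
      using that by (auto simp: sets_restrict_space)
    have si: "set_integrable M2 ({0<..<2} \<inter> B) h" if "B \<in> sets borel" for B
      unfolding set_integrable_def by (intro integrable_mult_indicator BM that h)
    have "P B"
    proof -
      have "Int_stable (range (\<lambda>a::real. {..a}))" by (auto simp: Int_stable_def Int_atMost)
      moreover have "range (\<lambda>a::real. {..a}) \<subseteq> Pow UNIV" by simp
      moreover have "B \<in> sigma_sets UNIV (range (\<lambda>a::real. {..a}))"
        using B(1) by (simp add: borel_eq_atMost[where 'a=real])
      ultimately show "P B"
      proof (induction rule: sigma_sets_induct_disjoint)
        case (basic A)
        then obtain a where A: "A = {..a}" by auto
        have eq: "(\<integral>x. indicator ({0<..<2} \<inter> A) x *\<^sub>R h x \<partial>M2) = (\<integral>x. indicator {..a} x * h x \<partial>M2)"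
          unfolding A by (intro Bochner_Integration.integral_cong) (auto simp: indicator_def)
        consider "a < 0" | "a \<in> {0..2}" | "a > 2" by fastforce
        then show ?case
        proof cases
          case 1
          then have "(\<integral>x. indicator {..a} x * h x \<partial>M2) = (\<integral>x. 0 \<partial>M2)"
            by (intro Bochner_Integration.integral_cong) (auto simp: indicator_def)
          then show ?thesis by (simp add: P_def set_lebesgue_integral_def eq)
        next
          case 2
          then show ?thesis using fun_cong[OF z, of a] by (simp add: P_def set_lebesgue_integral_def eq primitive_def)
        next
          case 3
          then have "(\<integral>x. indicator {..a} x * h x \<partial>M2) = (\<integral>x. h x \<partial>M2)"
            by (intro Bochner_Integration.integral_cong) (auto simp: indicator_def)
          then show ?thesis by (simp add: P_def set_lebesgue_integral_def eq tot)
        qed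
      next
        case empty then show ?case by (simp add: P_def set_lebesgue_integral_def)
      next
        case (compl A)
        have A: "A \<in> sets borel" using compl(1) by (simp add: borel_eq_atMost[where 'a=real])
        have "set_lebesgue_integral M2 ({0<..<2} \<inter> (UNIV - A)) h
            = (\<integral>x. h x - indicator ({0<..<2} \<inter> A) x *\<^sub>R h x \<partial>M2)"
          unfolding set_lebesgue_integral_def
          by (intro Bochner_Integration.integral_cong) (auto simp: indicator_def)
        also have "\<dots> = 0"
          using compl si[OF A] tot h
          by (subst Bochner_Integration.integral_diff) (auto simp: P_def set_lebesgue_integral_def set_integrable_def)
        finally show ?case by (simp add: P_def)
      next
        case (union A)
        have A: "A i \<in> sets borel" for i using union(2) by (auto simp: borel_eq_atMost[where 'a=real])
        have UN: "(\<Union>i. {0<..<2} \<inter> A i) = {0<..<2} \<inter> (\<Union>i. A i)" by blast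
        have "(\<Union>i. A i) \<in> sets borel" using A by blast
        from si[OF this] have siU: "set_integrable M2 (\<Union>i. {0<..<2} \<inter> A i) h" unfolding UN .
        have "set_lebesgue_integral M2 (\<Union>i. {0<..<2} \<inter> A i) h
            = (\<Sum>i. set_lebesgue_integral M2 ({0<..<2} \<inter> A i) h)"
        proof (rule lebesgue_integral_countable_add[OF BM[OF A] _ siU])
          fix i j :: nat assume "i \<noteq> j"
          then have "A i \<inter> A j = {}" using union(1) by (auto simp: disjoint_family_on_def)
          then show "{0<..<2} \<inter> A i \<inter> ({0<..<2} \<inter> A j) = {}" by blast
        qed
        also have "\<dots> = 0" using union(3) by (simp add: P_def)
        finally show ?case unfolding P_def UN .
      qed
    qed
    then show "set_lebesgue_integral M2 A h = 0" by (simp add: P_def B)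
  qed
  then show ?thesis by (rule density_zero[OF h])
qed

text \<open>On a subinterval take a bump \<open>\<eta>\<close> and test with the antiderivative of
  \<open>\<psi> = \<eta> * (d - c)\<close>. If \<open>\<psi>\<close> has mean zero, the integral of
  \<open>\<eta> * (d - c)^2\<close> vanishes, so \<open>d = c\<close> where the bump is positive.
  Test functions are only C1, so a piecewise linear bump is smooth enough.\<close>

lemma du_Bois_Reymond:
  fixes d :: "real \<Rightarrow> real"
  assumes d: "continuous_on {0..2} d"
    and orth: "\<And>\<phi> \<phi>'. test_function \<phi> \<phi>' \<Longrightarrow> (\<integral>x. d x * \<phi>' x \<partial>M2) = 0"
  assumes x: "x \<in> {0..2}"
  shows "d x = d 0"
proof -
  \<comment> \<open>Extends \<open>d\<close> by constants, because the derivative of a test function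
    has to be continuous on the whole line.\<close>
  define e where "e x = d (max 0 (min 2 x))" for x
  have e: "continuous_on UNIV e"
    unfolding e_def by (intro continuous_on_compose2[OF d] continuous_intros) auto
  have loc: "\<exists>c. \<forall>x\<in>{a<..<b}. d x = c" if ab: "0 < a" "a < b" "b < 2" for a b
  proof -
    define \<eta> where "\<eta> x = max 0 (min (x - a) (b - x))" for x :: real
    have \<eta>: "continuous_on S \<eta>" for S
      unfolding \<eta>_def by (intro continuous_intros)
    note cont = continuous_on_subset[OF e subset_UNIV]
    \<comment> \<open>The \<open>\<eta>\<close>-weighted mean of \<open>d\<close>, for which
      \<open>\<psi>\<close> integrates to zero and its antiderivative vanishes again to the right of
      \<open>b\<close>.\<close>
    define c where "c = integral {0..2} (\<lambda>x. \<eta> x * e x) / integral {0..2} \<eta>"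
    define \<psi> where "\<psi> x = \<eta> x * (e x - c)" for x
    have \<psi>: "continuous_on S \<psi>" for S
      unfolding \<psi>_def by (intro continuous_intros \<eta> cont)
    have pos: "integral {0..2} \<eta> \<noteq> 0"
    proof
      assume "integral {0..2} \<eta> = 0"
      then have "\<forall>x\<in>{0..2}. \<eta> x = 0"
        by (subst (asm) integral_eq_0_iff[OF \<eta>]) (auto simp: \<eta>_def)
      then have "\<eta> ((a+b)/2) = 0" using ab by auto
      then show False using ab by (auto simp: \<eta>_def max_def min_def split: if_splits)
    qed
    have int: "f integrable_on {0..2}" if "continuous_on {0..2} f" for f :: "real \<Rightarrow> real"
      using that by (rule integrable_continuous_real)
    have "integral {0..2} \<psi> = integral {0..2} (\<lambda>x. \<eta> x * e x - c * \<eta> x)"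
      by (intro Henstock_Kurzweil_Integration.integral_cong) (simp add: \<psi>_def algebra_simps)
    also have "\<dots> = integral {0..2} (\<lambda>x. \<eta> x * e x) - c * integral {0..2} \<eta>"
      by (subst Henstock_Kurzweil_Integration.integral_diff) (auto intro!: int continuous_intros \<eta> cont)
    also have "\<dots> = 0" using pos by (simp add: c_def)
    finally have \<psi>0: "integral {0..2} \<psi> = 0" .
    define \<phi> where "\<phi> x = integral {0..x} \<psi>" for x
    have out: "\<psi> x = 0" if "x \<notin> {a<..<b}" for x using that ab by (auto simp: \<psi>_def \<eta>_def max_def min_def)
    have \<phi>l: "\<phi> x = 0" if "x < a" for x
    proof -
      have "\<phi> x = integral {0..x} (\<lambda>x. 0)" unfolding \<phi>_def
        by (intro Henstock_Kurzweil_Integration.integral_cong out) (use that in auto)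
      then show ?thesis by simp
    qed
    have \<phi>r: "\<phi> x = 0" if "x > b" for x
    proof -
      have *: "\<phi> y = integral {0..b} \<psi>" if "y > b" for y
      proof -
        have "\<phi> y = integral {0..b} \<psi> + integral {b..y} \<psi>" unfolding \<phi>_def
          using that ab by (intro Henstock_Kurzweil_Integration.integral_combine[symmetric] integrable_continuous_real \<psi>) auto
        moreover have "integral {b..y} \<psi> = integral {b..y} (\<lambda>x. 0)"
          by (intro Henstock_Kurzweil_Integration.integral_cong out) auto
        ultimately show ?thesis by simp
      qed
      have "\<phi> 2 = 0" using \<psi>0 by (simp add: \<phi>_def)
      then show ?thesis using *[of 2] *[OF that] ab by simp
    qed
    have "(\<phi> has_real_derivative \<psi> x) (at x)" for x
    proof (cases "x < a")
      case True
      have "((\<lambda>x. 0) has_real_derivative 0) (at x)" by simp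
      then have "(\<phi> has_real_derivative 0) (at x)"
        by (rule DERIV_cong_ev[THEN iffD1, rotated 3])
          (auto intro: eventually_mono[OF eventually_nhds_in_open[of "{..<a}"]] simp: \<phi>l True)
      then show ?thesis using out[of x] True by simp
    next
      case False
      have "(\<phi> has_real_derivative \<psi> x) (at x within {0..x+1})"
        unfolding \<phi>_def using False ab by (intro integral_has_real_derivative \<psi>) auto
      moreover have "at x within {0..x+1} = at x"
        using False ab by (intro at_within_interior) auto
      ultimately show ?thesis by simp
    qed
    then have "test_function \<phi> \<psi>"
      unfolding test_function_def using ab \<phi>l \<phi>r
      by (intro conjI allI \<psi> exI[of _ a] exI[of _ b]) auto
    then have "(\<integral>x. d x * \<psi> x \<partial>M2) = 0" by (rule orth)
    moreover have HK: "(\<integral>x. f x \<partial>M2) = integral {0..2} f" if f: "continuous_on {0..2} f" for f :: "real \<Rightarrow> real"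
    proof -
      have "set_integrable lborel {0..2} f" by (rule borel_integrable_atLeastAtMost') (rule f)
      then have i: "set_integrable lborel {0<..<2} f" by (rule set_integrable_subset) auto
      have "(\<integral>x. f x \<partial>M2) = integral {0<..<2} f"
        using set_borel_integral_eq_integral(2)[OF i] by (simp add: LINT_M2)
      then show ?thesis by (simp add: integral_open_interval_real)
    qed
    ultimately have "integral {0..2} (\<lambda>x. d x * \<psi> x) = 0"
      by (subst (asm) HK) (auto intro!: continuous_intros d \<psi>)
    moreover have "integral {0..2} (\<lambda>x. \<eta> x * (e x - c)\<^sup>2) = integral {0..2} (\<lambda>x. d x * \<psi> x - c * \<psi> x)"
      by (intro Henstock_Kurzweil_Integration.integral_cong)
        (auto simp: \<psi>_def e_def power2_eq_square algebra_simps)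
    moreover have "\<dots> = integral {0..2} (\<lambda>x. d x * \<psi> x) - c * integral {0..2} \<psi>"
      by (subst Henstock_Kurzweil_Integration.integral_diff) (auto intro!: int continuous_intros \<psi> d)
    ultimately have "integral {0..2} (\<lambda>x. \<eta> x * (e x - c)\<^sup>2) = 0" using \<psi>0 by simp
    then have "\<forall>x\<in>{0..2}. \<eta> x * (e x - c)\<^sup>2 = 0"
      by (subst (asm) integral_eq_0_iff) (auto intro!: continuous_intros \<eta> cont simp: \<eta>_def)
    then have z: "\<eta> x = 0 \<or> e x = c" if "x \<in> {0..2}" for x using that by fastforce
    have "d x = c" if "x \<in> {a<..<b}" for x
      using z[of x] that ab by (auto simp: \<eta>_def e_def)
    then show ?thesis by blast
  qed
  have const: "d x = d 1" if "x \<in> {0<..<2}" for x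
  proof -
    define a b where "a = min x 1 / 2" and "b = (max x 1 + 2) / 2"
    have "0 < a" "a < b" "b < 2" "x \<in> {a<..<b}" "1 \<in> {a<..<b}"
      using that by (auto simp: a_def b_def)
    with loc[of a b] show ?thesis by metis
  qed
  have cl: "closure {0<..<2::real} = {0..2}" by simp
  have "d x = d 1" if "x \<in> {0..2}" for x
    using continuous_constant_on_closure[of "{0<..<2::real}" d "d 1", unfolded cl, OF d const that] .
  from this[OF x] this[of 0] show ?thesis by simp
qed

section \<open>The space H\<close>

text \<open>On a bounded interval an L2-Cauchy sequence is L1-Cauchy, which supplies a subsequence
  converging almost everywhere. Fatou's lemma along it bounds the L2 distance of \<open>f n\<close>
  from the pointwise limit.\<close>

lemma L2_complete:
  assumes f: "\<And>n. square_integrable (f n)"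
    and C: "\<And>e. e > 0 \<Longrightarrow> \<exists>N. \<forall>i\<ge>N. \<forall>j\<ge>N. (\<integral>x. (cmod (f i x - f j x))\<^sup>2 \<partial>M2) < e"
  obtains g where "square_integrable g" "(\<lambda>n. \<integral>x. (cmod (f n x - g x))\<^sup>2 \<partial>M2) \<longlonglongrightarrow> 0"
proof -
  have [measurable]: "\<And>n. f n \<in> borel_measurable M2" using f by (simp add: square_integrable_iff)
  have "\<exists>N. \<forall>i\<ge>N. \<forall>j\<ge>N. (\<integral>x. norm (f i x - f j x) \<partial>M2) < e" if "e > 0" for e
  proof -
    from C[of "e\<^sup>2 / 2"] that obtain N where
      N: "\<And>i j. i \<ge> N \<Longrightarrow> j \<ge> N \<Longrightarrow> (\<integral>x. (cmod (f i x - f j x))\<^sup>2 \<partial>M2) < e\<^sup>2 / 2" by auto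
    have "(\<integral>x. norm (f i x - f j x) \<partial>M2) < e" if "i \<ge> N" "j \<ge> N" for i j
    proof -
      have "(\<integral>x. cmod (f i x - f j x) \<partial>M2) \<le> sqrt (2 * (\<integral>x. (cmod (f i x - f j x))\<^sup>2 \<partial>M2))"
        by (rule integral_norm_le_L2) (intro square_integrable_diff f)
      also have "\<dots> < sqrt (e\<^sup>2)" using N[OF that] by (intro real_sqrt_less_mono) simp
      finally show ?thesis using \<open>e > 0\<close> by simp
    qed
    then show ?thesis by blast
  qed
  from cauchy_L1_AE_cauchy_subseq[OF square_integrable_integrable[OF f] this]
  obtain r where r: "strict_mono r" and AE: "AE x in M2. Cauchy (\<lambda>i. f (r i) x)" by blast
  define g where "g x = lim (\<lambda>i. f (r i) x)" for x
  have [measurable]: "g \<in> borel_measurable M2" unfolding g_def by measurable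
  have lim: "AE x in M2. (\<lambda>i. f (r i) x) \<longlonglongrightarrow> g x"
    using AE by (rule eventually_mono) (simp add: g_def Cauchy_convergent_iff convergent_LIMSEQ_iff)
  have key: "\<exists>N. \<forall>n\<ge>N. integrable M2 (\<lambda>x. (cmod (f n x - g x))\<^sup>2) \<and> (\<integral>x. (cmod (f n x - g x))\<^sup>2 \<partial>M2) \<le> e"
    if e: "e > 0" for e
  proof -
    from C[OF e] obtain N where
      N: "\<And>i j. i \<ge> N \<Longrightarrow> j \<ge> N \<Longrightarrow> (\<integral>x. (cmod (f i x - f j x))\<^sup>2 \<partial>M2) < e" by auto
    have "integrable M2 (\<lambda>x. (cmod (f n x - g x))\<^sup>2) \<and> (\<integral>x. (cmod (f n x - g x))\<^sup>2 \<partial>M2) \<le> e" if n: "n \<ge> N" for n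
    proof -
      have "(\<integral>\<^sup>+x. ennreal ((cmod (f n x - g x))\<^sup>2) \<partial>M2)
          = (\<integral>\<^sup>+x. liminf (\<lambda>j. ennreal ((cmod (f n x - f (r j) x))\<^sup>2)) \<partial>M2)"
      proof (rule nn_integral_cong_AE)
        show "AE x in M2. ennreal ((cmod (f n x - g x))\<^sup>2) = liminf (\<lambda>j. ennreal ((cmod (f n x - f (r j) x))\<^sup>2))"
          using lim
        proof (rule eventually_mono)
          fix x assume "(\<lambda>i. f (r i) x) \<longlonglongrightarrow> g x"
          then have "(\<lambda>j. ennreal ((cmod (f n x - f (r j) x))\<^sup>2)) \<longlonglongrightarrow> ennreal ((cmod (f n x - g x))\<^sup>2)"
            by (intro tendsto_intros)
          then show "ennreal ((cmod (f n x - g x))\<^sup>2) = liminf (\<lambda>j. ennreal ((cmod (f n x - f (r j) x))\<^sup>2))"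
            by (intro lim_imp_Liminf[symmetric]) simp_all
        qed
      qed
      also have "\<dots> \<le> liminf (\<lambda>j. \<integral>\<^sup>+x. ennreal ((cmod (f n x - f (r j) x))\<^sup>2) \<partial>M2)"
        by (rule nn_integral_liminf) measurable
      also have "\<dots> \<le> liminf (\<lambda>j. ennreal e)"
      proof (rule Liminf_mono)
        have "(\<integral>\<^sup>+x. ennreal ((cmod (f n x - f (r j) x))\<^sup>2) \<partial>M2) \<le> ennreal e" if "j \<ge> N" for j
        proof -
          have "r j \<ge> N" using that seq_suble[OF r, of j] by linarith
          then have "(\<integral>x. (cmod (f n x - f (r j) x))\<^sup>2 \<partial>M2) < e" using N n by blast
          moreover have "integrable M2 (\<lambda>x. (cmod (f n x - f (r j) x))\<^sup>2)"
            using square_integrable_diff[OF f f] by (simp add: square_integrable_iff)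
          ultimately show ?thesis by (simp add: nn_integral_eq_integral ennreal_leI)
        qed
        then show "\<forall>\<^sub>F j in sequentially. (\<integral>\<^sup>+x. ennreal ((cmod (f n x - f (r j) x))\<^sup>2) \<partial>M2) \<le> ennreal e"
          using eventually_sequentially by blast
      qed
      also have "\<dots> = ennreal e" by (simp add: Liminf_const)
      finally have le: "(\<integral>\<^sup>+x. ennreal ((cmod (f n x - g x))\<^sup>2) \<partial>M2) \<le> ennreal e" .
      have i: "integrable M2 (\<lambda>x. (cmod (f n x - g x))\<^sup>2)"
        by (rule integrableI_bounded) (use le in \<open>auto simp: le_less_trans\<close>)
      then have "ennreal (\<integral>x. (cmod (f n x - g x))\<^sup>2 \<partial>M2) \<le> ennreal e"
        using le by (simp add: nn_integral_eq_integral)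
      then show ?thesis using i e by (simp add: ennreal_le_iff)
    qed
    then show ?thesis by blast
  qed
  from key[of 1] obtain n where "integrable M2 (\<lambda>x. (cmod (f n x - g x))\<^sup>2)" by auto
  then have "square_integrable (\<lambda>x. f n x - g x)" by (simp add: square_integrable_iff)
  from square_integrable_diff[OF f[of n] this] have "square_integrable g" by simp
  moreover have "(\<lambda>n. \<integral>x. (cmod (f n x - g x))\<^sup>2 \<partial>M2) \<longlonglongrightarrow> 0"
  proof (rule LIMSEQ_I)
    fix e :: real assume "e > 0"
    then have "e / 2 > 0" by simp
    from key[OF this] obtain N where "\<forall>n\<ge>N. (\<integral>x. (cmod (f n x - g x))\<^sup>2 \<partial>M2) \<le> e / 2" by blast
    then show "\<exists>no. \<forall>n\<ge>no. norm ((\<integral>x. (cmod (f n x - g x))\<^sup>2 \<partial>M2) - 0) < e"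
      using \<open>e > 0\<close> by (intro exI[of _ N]) (auto intro: le_less_trans)
  qed
  ultimately show ?thesis by (rule that)
qed

lemma primitive_in_H [intro]:
  assumes "square_integrable g" shows "primitive g \<in> H_space"
  unfolding H_space_def
proof (intro CollectI conjI allI impI exI)
  show "continuous_on {0..2} (primitive g)"
    by (rule primitive_continuous[OF square_integrable_integrable[OF assms]])
  show "has_weak_deriv (primitive g) g" by (rule has_weak_deriv_primitive[OF assms])
  show "primitive g x = 0" if "x \<notin> {0..2}" for x using that by (auto simp: primitive_def)
qed simp

text \<open>The difference of \<open>v\<close> and the primitive of its weak derivative has weak
  derivative zero. Test functions are real, so du Bois-Reymond is applied to real and imaginary
  part; the constant is 0 by the condition at \<open>x = 0\<close>. From here on
  \<open>H_space\<close> is handled as the set of primitives of square integrable functions.\<close>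

lemma
  assumes v: "v \<in> H_space"
  shows square_integrable_weak_deriv: "square_integrable (weak_deriv v)"
    and primitive_weak_deriv: "primitive (weak_deriv v) = v"
proof -
  have w: "has_weak_deriv v (weak_deriv v)"
    unfolding weak_deriv_def using v someI_ex[of "has_weak_deriv v"] by (simp add: H_space_def)
  then show g: "square_integrable (weak_deriv v)" by (simp add: has_weak_deriv_def)
  define d where "d x = v x - primitive (weak_deriv v) x" for x
  note pc = primitive_continuous[OF square_integrable_integrable[OF g]]
  have vc: "continuous_on {0..2} v" using v by (simp add: H_space_def)
  have dc: "continuous_on {0..2} d" unfolding d_def by (intro continuous_intros vc pc)
  have orth: "(\<integral>x. d x * of_real (\<phi>' x) \<partial>M2) = 0" if t: "test_function \<phi> \<phi>'" for \<phi> \<phi>'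
  proof -
    have \<phi>': "square_integrable (\<lambda>x. complex_of_real (\<phi>' x))"
      using t by (intro square_integrable_continuous continuous_intros)
        (auto simp: test_function_def intro: continuous_on_subset)
    note i = square_integrable_prod[OF square_integrable_continuous[OF vc] \<phi>']
      square_integrable_prod[OF square_integrable_continuous[OF pc] \<phi>']
    have "(\<integral>x. d x * of_real (\<phi>' x) \<partial>M2)
        = (\<integral>x. v x * of_real (\<phi>' x) \<partial>M2) - (\<integral>x. primitive (weak_deriv v) x * of_real (\<phi>' x) \<partial>M2)"
      using i by (simp add: d_def left_diff_distrib Bochner_Integration.integral_diff)
    also have "\<dots> = 0"
      using w has_weak_deriv_primitive[OF g] t by (simp add: has_weak_deriv_def LINT_M2)
    finally show ?thesis .
  qed
  have i: "integrable M2 (\<lambda>x. d x * of_real (\<phi>' x))" if t: "test_function \<phi> \<phi>'" for \<phi> \<phi>'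
    using t by (intro square_integrable_prod square_integrable_continuous continuous_intros dc)
        (auto simp: test_function_def intro: continuous_on_subset)
  have "d x = 0" if x: "x \<in> {0..2}" for x
  proof (rule complex_eqI)
    have d0: "d 0 = 0" using v by (simp add: d_def H_space_def)
    have "Re (d x) = Re (d 0)"
    proof (rule du_Bois_Reymond[OF _ _ x])
      fix \<phi> \<phi>' assume t: "test_function \<phi> \<phi>'"
      show "(\<integral>x. Re (d x) * \<phi>' x \<partial>M2) = 0"
        using arg_cong[OF orth[OF t], of Re] integral_Re[OF i[OF t]] by simp
    qed (intro continuous_intros dc)
    then show "Re (d x) = Re 0" using d0 by simp
    have "Im (d x) = Im (d 0)"
    proof (rule du_Bois_Reymond[OF _ _ x])
      fix \<phi> \<phi>' assume t: "test_function \<phi> \<phi>'"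
      show "(\<integral>x. Im (d x) * \<phi>' x \<partial>M2) = 0"
        using arg_cong[OF orth[OF t], of Im] integral_Im[OF i[OF t]] by simp
    qed (intro continuous_intros dc)
    then show "Im (d x) = Im 0" using d0 by simp
  qed
  then have "primitive (weak_deriv v) x = v x" if "x \<in> {0..2}" for x using that by (simp add: d_def)
  moreover have "primitive (weak_deriv v) x = v x" if "x \<notin> {0..2}" for x
    using that v by (auto simp: primitive_def H_space_def)
  ultimately show "primitive (weak_deriv v) = v" by blast
qed

text \<open>The arbitrary choice in \<open>weak_deriv\<close> is harmless: the chosen function and
  \<open>g\<close> have the same primitive, and a primitive determines its integrand almost
  everywhere.\<close>

lemma weak_deriv_primitive_AE:
  assumes g: "square_integrable g"
  shows "AE x in M2. weak_deriv (primitive g) x = g x"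
proof -
  note w = square_integrable_weak_deriv[OF primitive_in_H[OF g]]
  note i = square_integrable_integrable[OF w] square_integrable_integrable[OF g]
  have "primitive (\<lambda>x. weak_deriv (primitive g) x + (-1) * g x) = (\<lambda>x. 0)"
    using primitive_weak_deriv[OF primitive_in_H[OF g]] i
    by (subst primitive_add) (auto simp: primitive_scale[of "-1", simplified])
  then have "AE x in M2. weak_deriv (primitive g) x + (-1) * g x = 0"
    using i by (intro primitive_eq_0_imp_AE) auto
  then show ?thesis by (rule eventually_mono) simp
qed

lemma weak_deriv_AE:
  assumes "square_integrable g" "v = primitive g"
  shows "AE x in M2. weak_deriv v x = g x"
  using weak_deriv_primitive_AE[OF assms(1)] assms(2) by simp

lemma H_continuous: "v \<in> H_space \<Longrightarrow> continuous_on {0..2} v"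
  by (simp add: H_space_def)

lemma H_square_integrable: "v \<in> H_space \<Longrightarrow> square_integrable v"
  by (intro square_integrable_continuous H_continuous)

text \<open>Linearity is inherited from \<open>primitive\<close>. For \<open>weak_deriv\<close> it
  is available only almost everywhere, since a representative is chosen separately for each
  function.\<close>

lemma
  assumes u: "u \<in> H_space" and v: "v \<in> H_space"
  shows H_add [intro]: "(\<lambda>x. u x + v x) \<in> H_space"
    and weak_deriv_add: "AE x in M2. weak_deriv (\<lambda>x. u x + v x) x = weak_deriv u x + weak_deriv v x"
proof -
  note w = square_integrable_weak_deriv[OF u] square_integrable_weak_deriv[OF v]
  have *: "(\<lambda>x. u x + v x) = primitive (\<lambda>x. weak_deriv u x + weak_deriv v x)"
    using w by (simp add: primitive_add square_integrable_integrable primitive_weak_deriv u v)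
  show "(\<lambda>x. u x + v x) \<in> H_space" unfolding * using w by blast
  show "AE x in M2. weak_deriv (\<lambda>x. u x + v x) x = weak_deriv u x + weak_deriv v x"
    using w * by (intro weak_deriv_AE) auto
qed

lemma
  assumes v: "v \<in> H_space"
  shows H_scale [intro]: "(\<lambda>x. c * v x) \<in> H_space"
    and weak_deriv_scale: "AE x in M2. weak_deriv (\<lambda>x. c * v x) x = c * weak_deriv v x"
proof -
  note w = square_integrable_weak_deriv[OF v]
  have *: "(\<lambda>x. c * v x) = primitive (\<lambda>x. c * weak_deriv v x)"
    by (simp add: primitive_scale primitive_weak_deriv v)
  show "(\<lambda>x. c * v x) \<in> H_space" unfolding * using w by blast
  show "AE x in M2. weak_deriv (\<lambda>x. c * v x) x = c * weak_deriv v x"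
    using w * by (intro weak_deriv_AE) auto
qed

lemma
  assumes v: "v \<in> H_space"
  shows H_cnj [intro]: "(\<lambda>x. cnj (v x)) \<in> H_space"
    and weak_deriv_cnj: "AE x in M2. weak_deriv (\<lambda>x. cnj (v x)) x = cnj (weak_deriv v x)"
proof -
  note w = square_integrable_weak_deriv[OF v]
  have *: "(\<lambda>x. cnj (v x)) = primitive (\<lambda>x. cnj (weak_deriv v x))"
    by (simp add: primitive_cnj primitive_weak_deriv v)
  show "(\<lambda>x. cnj (v x)) \<in> H_space" unfolding * using w by blast
  show "AE x in M2. weak_deriv (\<lambda>x. cnj (v x)) x = cnj (weak_deriv v x)"
    using w * by (intro weak_deriv_AE) auto
qed

lemma H_diff [intro]: "u \<in> H_space \<Longrightarrow> v \<in> H_space \<Longrightarrow> (\<lambda>x. u x - v x) \<in> H_space"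
  using H_add[OF _ H_scale[of v "-1"]] by fastforce

lemma H_zero [simp]: "(\<lambda>x. 0) \<in> H_space"
  using H_scale[OF primitive_in_H[OF square_integrable_1], of 0] by simp

section \<open>Inner product, completeness and the Riesz representation\<close>

definition H_inner :: "real \<Rightarrow> fn \<Rightarrow> fn \<Rightarrow> complex" where
  "H_inner k u v = (\<integral>x. weak_deriv u x * cnj (weak_deriv v x) \<partial>M2) / (of_real k)\<^sup>2
                   + (\<integral>x. u x * cnj (v x) \<partial>M2)"

lemma integrable_H [simp, intro]:
  assumes "u \<in> H_space" "v \<in> H_space"
  shows "integrable M2 (\<lambda>x. u x * cnj (v x))" "integrable M2 (\<lambda>x. weak_deriv u x * cnj (weak_deriv v x))"
  by (intro square_integrable_prod square_integrable_cnj H_square_integrable square_integrable_weak_deriv assms)+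

lemma integral_weak_deriv_cong:
  assumes "AE x in M2. weak_deriv u x = f x" "square_integrable f" "u \<in> H_space" "square_integrable g"
  shows "(\<integral>x. weak_deriv u x * g x \<partial>M2) = (\<integral>x. f x * g x \<partial>M2)"
  using assms square_integrable_prod[OF assms(2,4)]
    square_integrable_prod[OF square_integrable_weak_deriv[OF assms(3)] assms(4)]
  by (intro integral_cong_AE) (auto elim: eventually_mono)

lemma weak_deriv_integral_add:
  assumes "u \<in> H_space" "w \<in> H_space" "square_integrable g"
  shows "(\<integral>x. weak_deriv (\<lambda>x. u x + w x) x * g x \<partial>M2)
    = (\<integral>x. weak_deriv u x * g x \<partial>M2) + (\<integral>x. weak_deriv w x * g x \<partial>M2)"
  using assms square_integrable_weak_deriv[OF assms(1)] square_integrable_weak_deriv[OF assms(2)]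
  by (subst integral_weak_deriv_cong[OF weak_deriv_add])
    (auto simp: distrib_right intro!: Bochner_Integration.integral_add square_integrable_prod)

lemma weak_deriv_integral_scale:
  assumes "u \<in> H_space" "square_integrable g"
  shows "(\<integral>x. weak_deriv (\<lambda>x. c * u x) x * g x \<partial>M2) = c * (\<integral>x. weak_deriv u x * g x \<partial>M2)"
  using assms square_integrable_weak_deriv[OF assms(1)]
  by (subst integral_weak_deriv_cong[OF weak_deriv_scale]) (auto simp: mult.assoc)

lemma H_inner_add_left:
  assumes "u \<in> H_space" "w \<in> H_space" "v \<in> H_space"
  shows "H_inner k (\<lambda>x. u x + w x) v = H_inner k u v + H_inner k w v"
proof -
  have "(\<integral>x. (u x + w x) * cnj (v x) \<partial>M2) = (\<integral>x. u x * cnj (v x) \<partial>M2) + (\<integral>x. w x * cnj (v x) \<partial>M2)"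
    using assms by (simp add: distrib_right)
  then show ?thesis
    using assms by (simp add: H_inner_def weak_deriv_integral_add square_integrable_weak_deriv
        square_integrable_cnj add_divide_distrib)
qed

lemma H_inner_scale_left:
  assumes "u \<in> H_space" "v \<in> H_space"
  shows "H_inner k (\<lambda>x. c * u x) v = c * H_inner k u v"
  using assms by (simp add: H_inner_def weak_deriv_integral_scale square_integrable_weak_deriv
        square_integrable_cnj mult.assoc distrib_left)

lemma H_inner_commute: "H_inner k v u = cnj (H_inner k u v)"
proof -
  have "(\<integral>x. f x * cnj (g x) \<partial>M2) = cnj (\<integral>x. g x * cnj (f x) \<partial>M2)" for f g
  proof -
    have "(\<integral>x. f x * cnj (g x) \<partial>M2) = (\<integral>x. cnj (g x * cnj (f x)) \<partial>M2)"
      by (rule arg_cong[where f="integral\<^sup>L M2"]) (simp add: fun_eq_iff mult.commute)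
    also have "\<dots> = cnj (\<integral>x. g x * cnj (f x) \<partial>M2)" by (rule Bochner_Integration.integral_cnj)
    finally show ?thesis .
  qed
  from this[of v u] this[of "weak_deriv v" "weak_deriv u"] show ?thesis
    unfolding H_inner_def by (simp only: complex_cnj_add complex_cnj_divide complex_cnj_power complex_cnj_complex_of_real)
qed

lemma H_inner_add_right:
  assumes "u \<in> H_space" "w \<in> H_space" "v \<in> H_space"
  shows "H_inner k v (\<lambda>x. u x + w x) = H_inner k v u + H_inner k v w"
  using assms H_inner_add_left[OF assms] by (simp add: H_inner_commute[of k v])

lemma H_inner_scale_right:
  assumes "u \<in> H_space" "v \<in> H_space"
  shows "H_inner k v (\<lambda>x. c * u x) = cnj c * H_inner k v u"
  using assms H_inner_scale_left[OF assms] by (simp add: H_inner_commute[of k v])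

lemma H_norm_nonneg [simp]: "0 \<le> H_norm k v"
  by (auto simp: H_norm_def LINT_M2 intro!: add_nonneg_nonneg divide_nonneg_nonneg)

lemma H_norm_power2: "(H_norm k v)\<^sup>2 = (\<integral>x. (cmod (weak_deriv v x))\<^sup>2 \<partial>M2) / k\<^sup>2 + (\<integral>x. (cmod (v x))\<^sup>2 \<partial>M2)"
  by (auto simp: H_norm_def LINT_M2 intro!: add_nonneg_nonneg divide_nonneg_nonneg)

lemma H_inner_self: "H_inner k v v = of_real ((H_norm k v)\<^sup>2)"
  by (simp add: H_inner_def H_norm_power2 complex_norm_square[symmetric] del: of_real_power flip: of_real_power[of k])

lemma H_norm_add_power2:
  assumes "u \<in> H_space" "v \<in> H_space"
  shows "(H_norm k (\<lambda>x. u x + v x))\<^sup>2 = (H_norm k u)\<^sup>2 + 2 * Re (H_inner k u v) + (H_norm k v)\<^sup>2"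
proof -
  have "complex_of_real ((H_norm k (\<lambda>x. u x + v x))\<^sup>2)
      = of_real ((H_norm k u)\<^sup>2) + (H_inner k u v + cnj (H_inner k u v)) + of_real ((H_norm k v)\<^sup>2)"
    using assms by (simp only: flip: H_inner_self)
      (simp add: H_inner_add_left H_inner_add_right H_add H_inner_commute[of k v u])
  from arg_cong[OF this, of Re] show ?thesis by simp
qed

lemma H_norm_scale:
  assumes "v \<in> H_space" shows "H_norm k (\<lambda>x. c * v x) = cmod c * H_norm k v"
proof -
  have "complex_of_real ((H_norm k (\<lambda>x. c * v x))\<^sup>2) = c * cnj c * of_real ((H_norm k v)\<^sup>2)"
    using assms by (simp only: flip: H_inner_self) (simp add: H_inner_scale_left H_inner_scale_right H_scale)
  also have "\<dots> = of_real ((cmod c * H_norm k v)\<^sup>2)"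
    by (simp add: power_mult_distrib flip: complex_norm_square)
  finally have "(H_norm k (\<lambda>x. c * v x))\<^sup>2 = (cmod c * H_norm k v)\<^sup>2"
    using of_real_eq_iff by blast
  then show ?thesis by (simp add: power2_eq_iff_nonneg)
qed

lemma Re_H_inner_le:
  assumes u: "u \<in> H_space" and v: "v \<in> H_space"
  shows "\<bar>Re (H_inner k u v)\<bar> \<le> H_norm k u * H_norm k v"
proof -
  have "(Re (H_inner k u v))\<^sup>2 \<le> (H_norm k u)\<^sup>2 * (H_norm k v)\<^sup>2"
  proof (rule quadratic_nonneg_imp_discriminant)
    fix t :: real
    have "0 \<le> (H_norm k (\<lambda>x. u x + of_real t * v x))\<^sup>2" by simp
    also have "\<dots> = (H_norm k u)\<^sup>2 + 2 * t * Re (H_inner k u v) + t\<^sup>2 * (H_norm k v)\<^sup>2"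
      using assms by (simp add: H_norm_add_power2 H_scale H_inner_scale_right H_norm_scale power_mult_distrib)
    finally show "0 \<le> (H_norm k u)\<^sup>2 + 2 * t * Re (H_inner k u v) + t\<^sup>2 * (H_norm k v)\<^sup>2" .
  qed
  then show ?thesis
    by (metis abs_le_square_iff abs_mult abs_of_nonneg H_norm_nonneg power_mult_distrib)
qed

lemma norm_H_inner_le:
  assumes u: "u \<in> H_space" and v: "v \<in> H_space"
  shows "cmod (H_inner k u v) \<le> H_norm k u * H_norm k v"
proof -
  let ?z = "H_inner k u v"
  \<comment> \<open>Rotating \<open>u\<close> by the conjugate phase makes the inner product real
    and nonnegative, so that the bound on real parts applies.\<close>
  have "H_inner k (\<lambda>x. cnj (sgn ?z) * u x) v = cnj (sgn ?z) * ?z" using assms by (rule H_inner_scale_left)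
  also have "\<dots> = of_real (cmod ?z)"
    by (simp add: sgn_eq complex_norm_square[symmetric] mult.commute[of "cnj _"] power2_eq_square)
  finally have "cmod ?z = Re (H_inner k (\<lambda>x. cnj (sgn ?z) * u x) v)" by simp
  also have "\<dots> \<le> H_norm k (\<lambda>x. cnj (sgn ?z) * u x) * H_norm k v"
    using Re_H_inner_le[OF H_scale[OF u] v] by (meson abs_le_iff)
  also have "\<dots> \<le> 1 * H_norm k u * H_norm k v"
    using u by (auto simp: H_norm_scale norm_sgn intro!: mult_right_mono)
  finally show ?thesis by simp
qed

lemma H_norm_triangle:
  assumes "u \<in> H_space" "v \<in> H_space"
  shows "H_norm k (\<lambda>x. u x + v x) \<le> H_norm k u + H_norm k v"
proof (rule power2_le_imp_le)
  show "(H_norm k (\<lambda>x. u x + v x))\<^sup>2 \<le> (H_norm k u + H_norm k v)\<^sup>2"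
    using Re_H_inner_le[OF assms, of k] assms by (simp add: H_norm_add_power2 power2_sum abs_le_iff)
qed simp

lemma H_norm_minus_commute:
  assumes "u \<in> H_space" "v \<in> H_space"
  shows "H_norm k (\<lambda>x. u x - v x) = H_norm k (\<lambda>x. v x - u x)"
  using H_norm_scale[OF H_diff[OF assms(2,1)], of k "-1"] by simp

lemma H_norm_zero [simp]: "H_norm k (\<lambda>x. 0) = 0"
  using H_norm_scale[OF H_zero, of k 0] by simp

lemma integral_weak_deriv_le:
  assumes "k \<noteq> 0"
  shows "(\<integral>x. (cmod (weak_deriv v x))\<^sup>2 \<partial>M2) \<le> (k * H_norm k v)\<^sup>2"
proof -
  have "(\<integral>x. (cmod (weak_deriv v x))\<^sup>2 \<partial>M2) = k\<^sup>2 * ((\<integral>x. (cmod (weak_deriv v x))\<^sup>2 \<partial>M2) / k\<^sup>2 + 0)"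
    using assms by simp
  also have "\<dots> \<le> k\<^sup>2 * (H_norm k v)\<^sup>2"
    unfolding H_norm_power2 by (intro mult_left_mono add_left_mono) auto
  finally show ?thesis by (simp add: power_mult_distrib)
qed

lemma integral_le_H_norm: "(\<integral>x. (cmod (v x))\<^sup>2 \<partial>M2) \<le> (H_norm k v)\<^sup>2"
  unfolding H_norm_power2 by simp

text \<open>The root of 2 comes from the interval length, and the factor \<open>k\<close> undoes the
  weight on the derivative. This is what makes the trace term at \<open>x = 2\<close> a bounded
  form.\<close>

lemma norm_H_le:
  assumes "v \<in> H_space" and k: "k > 0"
  shows "cmod (v x) \<le> sqrt 2 * k * H_norm k v"
proof -
  have "cmod (primitive (weak_deriv v) x) \<le> sqrt (2 * (\<integral>x. (cmod (weak_deriv v x))\<^sup>2 \<partial>M2))"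
    by (rule norm_primitive_le[OF square_integrable_weak_deriv[OF assms(1)]])
  also have "\<dots> \<le> sqrt (2 * (k * H_norm k v)\<^sup>2)"
    using k by (intro real_sqrt_le_mono mult_left_mono integral_weak_deriv_le) auto
  also have "\<dots> = sqrt 2 * k * H_norm k v" using k by (simp add: real_sqrt_mult)
  finally show ?thesis by (simp add: primitive_weak_deriv assms)
qed

lemma H_norm_eq_0:
  assumes "v \<in> H_space" "k > 0" "H_norm k v = 0" shows "v = (\<lambda>x. 0)"
  using norm_H_le[OF assms(1,2)] assms(3) by auto

text \<open>The 4 is the squared supremum bound, twice the integral, integrated over a length of 2.
  Together with \<open>integral_weak_deriv_le\<close> this makes \<open>H_norm\<close> equivalent to
  the L2 norm of the derivative, which carries completeness over.\<close>

lemma H_norm_primitive_le: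
  assumes g: "square_integrable g"
  shows "(H_norm k (primitive g))\<^sup>2 \<le> (1 / k\<^sup>2 + 4) * (\<integral>x. (cmod (g x))\<^sup>2 \<partial>M2)"
proof -
  let ?I = "\<integral>x. (cmod (g x))\<^sup>2 \<partial>M2"
  have m: "measure M2 {0<..<2} = 2" by (simp add: measure_restrict_space)
  have "(\<integral>x. (cmod (weak_deriv (primitive g) x))\<^sup>2 \<partial>M2) = ?I"
    using weak_deriv_primitive_AE[OF g] g square_integrable_weak_deriv[OF primitive_in_H[OF g]]
    by (intro integral_cong_AE) (auto simp: square_integrable_iff elim: eventually_mono)
  moreover have "(\<integral>x. (cmod (primitive g x))\<^sup>2 \<partial>M2) \<le> (\<integral>x. 2 * ?I \<partial>M2)"
  proof (rule integral_mono)
    interpret finite_measure M2 by (rule finite_measure_M2)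
    show "integrable M2 (\<lambda>x. 2 * ?I)" by simp
    show "integrable M2 (\<lambda>x. (cmod (primitive g x))\<^sup>2)"
      using H_square_integrable[OF primitive_in_H[OF g]] by (simp add: square_integrable_iff)
    fix x
    have "(cmod (primitive g x))\<^sup>2 \<le> (sqrt (2 * ?I))\<^sup>2"
      by (intro power_mono norm_primitive_le g) auto
    then show "(cmod (primitive g x))\<^sup>2 \<le> 2 * ?I" by simp
  qed
  ultimately show ?thesis by (simp add: H_norm_power2 m algebra_simps)
qed

lemma H_complete:
  assumes v: "\<And>n. v n \<in> H_space" and k: "k > 0"
    and C: "\<And>e. e > 0 \<Longrightarrow> \<exists>N. \<forall>i\<ge>N. \<forall>j\<ge>N. H_norm k (\<lambda>x. v i x - v j x) < e"
  obtains w where "w \<in> H_space" "(\<lambda>n. H_norm k (\<lambda>x. v n x - w x)) \<longlonglongrightarrow> 0"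
proof -
  note wd = square_integrable_weak_deriv[OF v]
  have diff: "(\<lambda>x. v n x - primitive g x) = primitive (\<lambda>x. weak_deriv (v n) x - g x)" if "square_integrable g" for g n
    using primitive_add[OF square_integrable_integrable[OF wd] square_integrable_integrable[OF square_integrable_scale[OF that, of "-1"]], of n]
    by (simp add: primitive_weak_deriv[OF v] primitive_scale[of "-1", simplified])
  have "\<exists>N. \<forall>i\<ge>N. \<forall>j\<ge>N. (\<integral>x. (cmod (weak_deriv (v i) x - weak_deriv (v j) x))\<^sup>2 \<partial>M2) < e" if "e > 0" for e
  proof -
    have "sqrt e / k > 0" using that k by simp
    from C[OF this] obtain N where N: "\<And>i j. i \<ge> N \<Longrightarrow> j \<ge> N \<Longrightarrow> H_norm k (\<lambda>x. v i x - v j x) < sqrt e / k" by blast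
    have "(\<integral>x. (cmod (weak_deriv (v i) x - weak_deriv (v j) x))\<^sup>2 \<partial>M2) < e" if "i \<ge> N" "j \<ge> N" for i j
    proof -
      have eq: "(\<lambda>x. v i x - v j x) = primitive (\<lambda>x. weak_deriv (v i) x - weak_deriv (v j) x)"
        using diff[OF wd[of j], of i] by (simp add: primitive_weak_deriv[OF v])
      have sq: "square_integrable (\<lambda>x. weak_deriv (v i) x - weak_deriv (v j) x)" by (intro square_integrable_diff wd)
      have "(\<integral>x. (cmod (weak_deriv (v i) x - weak_deriv (v j) x))\<^sup>2 \<partial>M2)
          = (\<integral>x. (cmod (weak_deriv (\<lambda>x. v i x - v j x) x))\<^sup>2 \<partial>M2)"
        using weak_deriv_AE[OF sq eq] sq square_integrable_weak_deriv[OF H_diff[OF v v], of i j]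
        by (intro integral_cong_AE) (auto simp: square_integrable_iff elim: eventually_mono)
      also have "\<dots> \<le> (k * H_norm k (\<lambda>x. v i x - v j x))\<^sup>2" using k by (intro integral_weak_deriv_le) auto
      also have "\<dots> < (k * (sqrt e / k))\<^sup>2"
        using N[OF that] k by (intro power_strict_mono mult_strict_left_mono) auto
      also have "\<dots> = e" using k \<open>e > 0\<close> by simp
      finally show ?thesis .
    qed
    then show ?thesis by blast
  qed
  from L2_complete[OF wd this] obtain g where g: "square_integrable g"
    and lim: "(\<lambda>n. \<integral>x. (cmod (weak_deriv (v n) x - g x))\<^sup>2 \<partial>M2) \<longlonglongrightarrow> 0" by blast
  have "(\<lambda>n. (H_norm k (\<lambda>x. v n x - primitive g x))\<^sup>2) \<longlonglongrightarrow> 0"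
  proof (rule tendsto_sandwich[OF _ _ tendsto_const])
    show "(\<lambda>n. (1 / k\<^sup>2 + 4) * (\<integral>x. (cmod (weak_deriv (v n) x - g x))\<^sup>2 \<partial>M2)) \<longlonglongrightarrow> 0"
      using tendsto_mult_left[OF lim, of "1 / k\<^sup>2 + 4"] by simp
    show "\<forall>\<^sub>F n in sequentially. (H_norm k (\<lambda>x. v n x - primitive g x))\<^sup>2
        \<le> (1 / k\<^sup>2 + 4) * (\<integral>x. (cmod (weak_deriv (v n) x - g x))\<^sup>2 \<partial>M2)"
      unfolding diff[OF g] by (intro always_eventually allI H_norm_primitive_le square_integrable_diff wd g)
  qed simp
  from tendsto_real_sqrt[OF this] have "(\<lambda>n. H_norm k (\<lambda>x. v n x - primitive g x)) \<longlonglongrightarrow> 0" by simp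
  then show ?thesis using primitive_in_H[OF g] that by blast
qed


section \<open>The dual space, its norm, and the Riesz representation\<close>

lemma
  assumes "F \<in> H_dual k" "u \<in> H_space" "v \<in> H_space"
  shows H_dual_add: "F (\<lambda>x. u x + v x) = F u + F v"
    and H_dual_scale: "F (\<lambda>x. c * v x) = cnj c * F v"
  using assms by (auto simp: H_dual_def)

text \<open>A real \<open>SUP\<close> can be compared with its members only over a bounded set, so
  the bound contained in \<open>H_dual\<close> is extracted first. Vectors of norm zero cannot be
  normalised and form a separate case.\<close>

lemma
  assumes F: "F \<in> H_dual k"
  shows norm_le_dual_norm: "v \<in> H_space \<Longrightarrow> cmod (F v) \<le> dual_norm k F * H_norm k v"
    and dual_norm_nonneg: "0 \<le> dual_norm k F"
proof -
  obtain B where B: "\<And>v. v \<in> H_space \<Longrightarrow> cmod (F v) \<le> B * H_norm k v"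
    using F unfolding H_dual_def by blast
  have bdd: "bdd_above ((\<lambda>v. cmod (F v)) ` {v \<in> H_space. H_norm k v \<le> 1})"
  proof (rule bdd_aboveI2)
    fix v assume v: "v \<in> {v \<in> H_space. H_norm k v \<le> 1}"
    then have "cmod (F v) \<le> B * H_norm k v" using B by blast
    also have "\<dots> \<le> \<bar>B\<bar> * 1" using v by (intro mult_mono) auto
    finally show "cmod (F v) \<le> \<bar>B\<bar>" by simp
  qed
  have le: "cmod (F v) \<le> dual_norm k F" if "v \<in> H_space" "H_norm k v \<le> 1" for v
    unfolding dual_norm_def by (rule cSUP_upper[OF _ bdd]) (use that in auto)
  from le[OF H_zero] show "0 \<le> dual_norm k F" by (simp add: order_trans[OF norm_ge_zero])
  show "cmod (F v) \<le> dual_norm k F * H_norm k v" if v: "v \<in> H_space"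
  proof (cases "H_norm k v = 0")
    case True
    then show ?thesis using B[OF v] by simp
  next
    case False
    then have pos: "H_norm k v > 0" using H_norm_nonneg[of k v] by linarith
    let ?c = "complex_of_real (1 / H_norm k v)"
    have "cmod (F (\<lambda>x. ?c * v x)) \<le> dual_norm k F"
      by (intro le H_scale v) (use pos H_norm_scale[OF v, of k ?c] in \<open>simp add: norm_divide\<close>)
    then have "cmod (cnj ?c * F v) \<le> dual_norm k F" by (simp only: H_dual_scale[OF F v v])
    then show ?thesis using pos by (simp add: norm_mult norm_divide field_simps)
  qed
qed

lemma dual_norm_le:
  assumes "\<And>v. v \<in> H_space \<Longrightarrow> cmod (F v) \<le> b * H_norm k v" "0 \<le> b"
  shows "dual_norm k F \<le> b"
  unfolding dual_norm_def
proof (rule cSUP_least)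
  show "{v \<in> H_space. H_norm k v \<le> 1} \<noteq> {}" by (auto intro!: exI[of _ "\<lambda>x. 0"])
  fix v assume v: "v \<in> {v \<in> H_space. H_norm k v \<le> 1}"
  then have "cmod (F v) \<le> b * H_norm k v" using assms by blast
  also have "\<dots> \<le> b * 1" using v assms by (intro mult_left_mono) auto
  finally show "cmod (F v) \<le> b" by simp
qed

lemma H_dualI:
  assumes "\<And>u v. u \<in> H_space \<Longrightarrow> v \<in> H_space \<Longrightarrow> F (\<lambda>x. u x + v x) = F u + F v"
    and "\<And>c v. v \<in> H_space \<Longrightarrow> F (\<lambda>x. c * v x) = cnj c * F v"
    and "\<And>v. v \<in> H_space \<Longrightarrow> cmod (F v) \<le> B * H_norm k v"
    and "\<And>v. v \<notin> H_space \<Longrightarrow> F v = 0"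
  shows "F \<in> H_dual k"
  unfolding H_dual_def using assms by blast

lemma H_dual_zero [simp]: "(\<lambda>v. 0) \<in> H_dual k"
  by (rule H_dualI[where B=0]) auto

lemma dual_norm_zero [simp]: "dual_norm k (\<lambda>v. 0) = 0"
  using dual_norm_le[of "\<lambda>v. 0" 0 k] dual_norm_nonneg[OF H_dual_zero, of k] by simp

lemma H_dual_plus [intro]:
  assumes F: "F \<in> H_dual k" and G: "G \<in> H_dual k" shows "(\<lambda>v. F v + G v) \<in> H_dual k"
proof (rule H_dualI)
  show "cmod (F v + G v) \<le> (dual_norm k F + dual_norm k G) * H_norm k v" if "v \<in> H_space" for v
    using norm_triangle_ineq[of "F v" "G v"] norm_le_dual_norm[OF F that] norm_le_dual_norm[OF G that]
    by (simp add: distrib_right)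
qed (use assms in \<open>auto simp: H_dual_def algebra_simps\<close>)

lemma H_dual_times [intro]:
  assumes F: "F \<in> H_dual k" shows "(\<lambda>v. c * F v) \<in> H_dual k"
proof (rule H_dualI)
  show "cmod (c * F v) \<le> (cmod c * dual_norm k F) * H_norm k v" if "v \<in> H_space" for v
    using norm_le_dual_norm[OF F that] by (simp add: norm_mult mult_left_mono mult.assoc)
qed (use assms in \<open>auto simp: H_dual_def algebra_simps\<close>)

lemma dual_norm_plus_le:
  assumes F: "F \<in> H_dual k" and G: "G \<in> H_dual k"
  shows "dual_norm k (\<lambda>v. F v + G v) \<le> dual_norm k F + dual_norm k G"
proof (rule dual_norm_le)
  show "cmod (F v + G v) \<le> (dual_norm k F + dual_norm k G) * H_norm k v" if "v \<in> H_space" for v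
    using norm_triangle_ineq[of "F v" "G v"] norm_le_dual_norm[OF F that] norm_le_dual_norm[OF G that]
    by (simp add: distrib_right)
qed (use dual_norm_nonneg[OF F] dual_norm_nonneg[OF G] in auto)

lemma dual_norm_times_le:
  assumes F: "F \<in> H_dual k"
  shows "dual_norm k (\<lambda>v. c * F v) \<le> cmod c * dual_norm k F"
proof (rule dual_norm_le)
  show "cmod (c * F v) \<le> (cmod c * dual_norm k F) * H_norm k v" if "v \<in> H_space" for v
    using norm_le_dual_norm[OF F that] by (simp add: norm_mult mult_left_mono mult.assoc)
qed (use dual_norm_nonneg[OF F] in auto)

text \<open>The representative minimises \<open>\<parallel>v\<parallel>\<^sup>2 - 2 Re F(v)\<close>; minimising sequences are Cauchy by the
  parallelogram law.\<close>

lemma Riesz_representation: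
  assumes F: "F \<in> H_dual k" and k: "k > 0"
  obtains z where "z \<in> H_space" "\<And>v. v \<in> H_space \<Longrightarrow> F v = H_inner k z v" "H_norm k z \<le> dual_norm k F"
proof -
  define J where "J v = (H_norm k v)\<^sup>2 - 2 * Re (F v)" for v
  define B where "B = dual_norm k F"
  have low: "- B\<^sup>2 \<le> J v" if "v \<in> H_space" for v
  proof -
    have "Re (F v) \<le> B * H_norm k v"
      using norm_le_dual_norm[OF F that] complex_Re_le_cmod[of "F v"] by (simp add: B_def)
    moreover have "0 \<le> (H_norm k v - B)\<^sup>2" by simp
    ultimately show ?thesis by (simp add: J_def power2_diff algebra_simps)
  qed
  define I where "I = Inf (J ` H_space)"
  have bdd: "bdd_below (J ` H_space)" using low by (intro bdd_belowI2) auto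
  have I: "I \<le> J v" if "v \<in> H_space" for v
    unfolding I_def using that by (intro cINF_lower bdd)
  have "\<exists>v\<in>H_space. J v < I + 1 / real (Suc n)" for n
    using cINF_less_iff[OF _ bdd, of "I + 1 / real (Suc n)"] H_zero by (auto simp: I_def simp del: H_zero)
  then obtain v where v: "\<And>n. v n \<in> H_space" and Jv: "\<And>n. J (v n) < I + 1 / real (Suc n)" by metis
  have par: "(H_norm k (\<lambda>x. u x - w x))\<^sup>2 \<le> 2 * (J u + J w - 2 * I)" if u: "u \<in> H_space" and w: "w \<in> H_space" for u w
  proof -
    \<comment> \<open>The midpoint of \<open>u\<close> and \<open>w\<close> cannot fall below the
      infimum; this bounds their distance by their joint excess over it.\<close>
    have "I \<le> J (\<lambda>x. (1/2) * (u x + w x))" using u w by (intro I H_scale H_add)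
    also have "\<dots> = (H_norm k (\<lambda>x. u x + w x))\<^sup>2 / 4 - Re (F u) - Re (F w)"
    proof -
      have F: "F (\<lambda>x. (1/2) * (u x + w x)) = cnj (1/2) * (F u + F w)"
        using H_dual_scale[OF F H_add H_add, OF u w u w, of "1/2"] H_dual_add[OF F u w] by simp
      have n: "H_norm k (\<lambda>x. (1/2) * (u x + w x)) = cmod (1/2) * H_norm k (\<lambda>x. u x + w x)"
        by (rule H_norm_scale[OF H_add[OF u w]])
      show ?thesis unfolding J_def F n by (simp add: power_mult_distrib power2_eq_square field_simps)
    qed
    finally have 1: "I \<le> (H_norm k (\<lambda>x. u x + w x))\<^sup>2 / 4 - Re (F u) - Re (F w)" .
    have 2: "(H_norm k (\<lambda>x. u x - w x))\<^sup>2 = (H_norm k u)\<^sup>2 - 2 * Re (H_inner k u w) + (H_norm k w)\<^sup>2"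
      using H_norm_add_power2[OF u H_scale[OF w, of "-1"], of k] H_norm_scale[OF w, of k "-1"]
        H_inner_scale_right[OF w u, of k "-1"] by simp
    show ?thesis using 1 unfolding 2 J_def H_norm_add_power2[OF u w] by (simp add: field_simps)
  qed
  have "\<exists>N. \<forall>i\<ge>N. \<forall>j\<ge>N. H_norm k (\<lambda>x. v i x - v j x) < e" if e: "e > 0" for e
  proof -
    obtain N where N: "1 / real (Suc N) < e\<^sup>2 / 4"
      using reals_Archimedean[of "e\<^sup>2 / 4"] e by (auto simp: inverse_eq_divide)
    have "H_norm k (\<lambda>x. v i x - v j x) < e" if "i \<ge> N" "j \<ge> N" for i j
    proof (rule power2_less_imp_less)
      have *: "1 / real (Suc n) \<le> 1 / real (Suc N)" if "n \<ge> N" for n using that by (intro divide_left_mono) auto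
      have "(H_norm k (\<lambda>x. v i x - v j x))\<^sup>2 \<le> 2 * (J (v i) + J (v j) - 2 * I)" by (rule par[OF v v])
      then show "(H_norm k (\<lambda>x. v i x - v j x))\<^sup>2 < e\<^sup>2"
        using order_less_le_trans[OF Jv add_left_mono[OF *[OF that(1)]]]
          order_less_le_trans[OF Jv add_left_mono[OF *[OF that(2)]]] N by (simp del: of_nat_Suc)
    qed (use e in simp)
    then show ?thesis by blast
  qed
  from H_complete[OF v k this] obtain z where z: "z \<in> H_space"
    and lim: "(\<lambda>n. H_norm k (\<lambda>x. v n x - z x)) \<longlonglongrightarrow> 0" by blast
  have Re: "Re (F w) = Re (H_inner k z w)" if w: "w \<in> H_space" for w
  proof -
    have l: "(\<lambda>n. Re (H_inner k (v n) w)) \<longlonglongrightarrow> Re (H_inner k z w)"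
    proof (rule Lim_transform_bound[THEN LIM_zero_cancel])
      have "Re (H_inner k (v n) w) - Re (H_inner k z w) = Re (H_inner k (\<lambda>x. v n x - z x) w)" for n
        using H_inner_add_left[OF v H_scale[OF z, of "-1"] w, of k n] H_inner_scale_left[OF z w, of k "-1"] by simp
      then show "\<forall>\<^sub>F n in sequentially. norm (Re (H_inner k (v n) w) - Re (H_inner k z w))
          \<le> norm (H_norm k (\<lambda>x. v n x - z x) * H_norm k w)"
        using Re_H_inner_le[OF H_diff[OF v z] w, of k] by (simp add: abs_mult)
      show "(\<lambda>n. H_norm k (\<lambda>x. v n x - z x) * H_norm k w) \<longlonglongrightarrow> 0"
        using tendsto_mult_right[OF lim, of "H_norm k w"] by simp
    qed
    \<comment> \<open>First variation, carried out along the minimising sequence: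
      \<open>I \<le> J (v n + t w)\<close> and \<open>J (v n) < I + 1 / Suc n\<close> are combined
      and \<open>n\<close> tends to infinity. The constant term tends to 0, which forces the linear
      coefficient to vanish.\<close>
    have "0 \<le> 0 + 2 * t * (Re (H_inner k z w) - Re (F w)) + t\<^sup>2 * (H_norm k w)\<^sup>2" for t
    proof (rule tendsto_lowerbound)
      show "(\<lambda>n. 1 / real (Suc n) + 2 * t * (Re (H_inner k (v n) w) - Re (F w)) + t\<^sup>2 * (H_norm k w)\<^sup>2)
        \<longlonglongrightarrow> 0 + 2 * t * (Re (H_inner k z w) - Re (F w)) + t\<^sup>2 * (H_norm k w)\<^sup>2"
        by (intro tendsto_intros l LIMSEQ_Suc[OF lim_1_over_n])
      show "\<forall>\<^sub>F n in sequentially. 0 \<le> 1 / real (Suc n) + 2 * t * (Re (H_inner k (v n) w) - Re (F w)) + t\<^sup>2 * (H_norm k w)\<^sup>2"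
      proof (intro always_eventually allI)
        fix n
        let ?w = "\<lambda>x. of_real t * w x"
        have "I \<le> J (\<lambda>x. v n x + ?w x)" using v w by (intro I H_add H_scale)
        also have "\<dots> = J (v n) + 2 * t * (Re (H_inner k (v n) w) - Re (F w)) + t\<^sup>2 * (H_norm k w)\<^sup>2"
          using v w by (simp add: J_def H_norm_add_power2 H_scale H_inner_scale_right H_norm_scale
              power_mult_distrib H_dual_add[OF F] H_dual_scale[OF F w w] algebra_simps)
        finally show "0 \<le> 1 / real (Suc n) + 2 * t * (Re (H_inner k (v n) w) - Re (F w)) + t\<^sup>2 * (H_norm k w)\<^sup>2"
          using Jv[of n] by linarith
      qed
    qed simp
    from quadratic_nonneg_imp_discriminant[OF this] show ?thesis by simp
  qed
  have rep: "F w = H_inner k z w" if w: "w \<in> H_space" for w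
  proof (rule complex_eqI[OF Re[OF w]])
    \<comment> \<open>Antilinearity turns the identity of real parts at \<open>\<i> * w\<close> into
      that of imaginary parts at \<open>w\<close>.\<close>
    show "Im (F w) = Im (H_inner k z w)"
      using Re[OF H_scale[OF w, of \<i>]] H_dual_scale[OF F w w, of \<i>] H_inner_scale_right[OF w z, of k \<i>] by simp
  qed
  have "H_norm k z \<le> dual_norm k F"
  proof (cases "H_norm k z = 0")
    case False
    then have "H_norm k z > 0" using H_norm_nonneg[of k z] by linarith
    moreover have "H_norm k z * H_norm k z \<le> dual_norm k F * H_norm k z"
      using norm_le_dual_norm[OF F z] by (simp add: rep[OF z] H_inner_self power2_eq_square norm_mult)
    ultimately show ?thesis by simp
  qed (simp add: dual_norm_nonneg[OF F])
  with z rep show ?thesis by (rule that)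
qed

lemma
  assumes B: "\<And>F. F \<in> H_dual k \<Longrightarrow> H_norm k (T F) \<le> B * dual_norm k F"
  shows op_norm_upper: "F \<in> H_dual k \<Longrightarrow> dual_norm k F \<le> 1 \<Longrightarrow> H_norm k (T F) \<le> op_norm k T"
    and op_norm_nonneg: "0 \<le> op_norm k T"
proof -
  have bdd: "bdd_above ((\<lambda>F. H_norm k (T F)) ` {F \<in> H_dual k. dual_norm k F \<le> 1})"
  proof (rule bdd_aboveI2)
    fix F assume F: "F \<in> {F \<in> H_dual k. dual_norm k F \<le> 1}"
    then have "H_norm k (T F) \<le> B * dual_norm k F" using B by blast
    also have "\<dots> \<le> \<bar>B\<bar> * 1" using F by (intro mult_mono) (auto intro: dual_norm_nonneg)
    finally show "H_norm k (T F) \<le> \<bar>B\<bar>" by simp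
  qed
  show le: "H_norm k (T F) \<le> op_norm k T" if "F \<in> H_dual k" "dual_norm k F \<le> 1" for F
    unfolding op_norm_def by (rule cSUP_upper[OF _ bdd]) (use that in auto)
  show "0 \<le> op_norm k T" using order_trans[OF H_norm_nonneg le[of "\<lambda>v. 0"]] by simp
qed

lemma norm_le_op_norm:
  assumes T: "T \<in> bounded_ops k" and F: "F \<in> H_dual k"
  shows "H_norm k (T F) \<le> op_norm k T * dual_norm k F"
proof -
  obtain B where B: "\<And>F. F \<in> H_dual k \<Longrightarrow> H_norm k (T F) \<le> B * dual_norm k F"
    using T unfolding bounded_ops_def by blast
  show ?thesis
  proof (cases "dual_norm k F = 0")
    case True
    then show ?thesis using B[OF F] by simp
  next
    case False
    then have pos: "dual_norm k F > 0" using dual_norm_nonneg[OF F] by linarith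
    let ?c = "complex_of_real (1 / dual_norm k F)"
    have "dual_norm k (\<lambda>v. ?c * F v) \<le> 1"
      by (rule order_trans[OF dual_norm_times_le[OF F]]) (use pos in \<open>simp add: norm_divide\<close>)
    then have "H_norm k (T (\<lambda>v. ?c * F v)) \<le> op_norm k T" by (intro op_norm_upper[OF B] H_dual_times F)
    moreover have "T (\<lambda>v. ?c * F v) = (\<lambda>x. ?c * T F x)" "T F \<in> H_space"
      using T F unfolding bounded_ops_def by blast+
    ultimately have "cmod ?c * H_norm k (T F) \<le> op_norm k T" by (simp only: H_norm_scale)
    then show ?thesis using pos by (simp add: norm_divide field_simps)
  qed
qed

lemma op_norm_le:
  assumes "\<And>F. F \<in> H_dual k \<Longrightarrow> H_norm k (T F) \<le> b * dual_norm k F" "0 \<le> b"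
  shows "op_norm k T \<le> b"
  unfolding op_norm_def
proof (rule cSUP_least)
  show "{F \<in> H_dual k. dual_norm k F \<le> 1} \<noteq> {}" by (auto intro!: exI[of _ "\<lambda>v. 0"])
  fix F assume F: "F \<in> {F \<in> H_dual k. dual_norm k F \<le> 1}"
  then have "H_norm k (T F) \<le> b * dual_norm k F" using assms by blast
  also have "\<dots> \<le> b * 1" using F assms by (intro mult_left_mono) auto
  finally show "H_norm k (T F) \<le> b" by simp
qed

section \<open>Operators from the dual space: Neumann series and holomorphy\<close>

definition linear_to_dual :: "real \<Rightarrow> (fn \<Rightarrow> functional) \<Rightarrow> bool" where
  "linear_to_dual k L \<longleftrightarrow> (\<forall>u\<in>H_space. L u \<in> H_dual k) \<and>
     (\<forall>u\<in>H_space. \<forall>v\<in>H_space. L (\<lambda>x. u x + v x) = (\<lambda>w. L u w + L v w)) \<and>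
     (\<forall>c. \<forall>u\<in>H_space. L (\<lambda>x. c * u x) = (\<lambda>w. c * L u w))"

text \<open>The bound is an a priori estimate with an explicit constant, the form in which it passes
  through perturbations.\<close>

definition has_bounded_inverse :: "real \<Rightarrow> (fn \<Rightarrow> functional) \<Rightarrow> real \<Rightarrow> bool" where
  "has_bounded_inverse k L M \<longleftrightarrow> bij_betw L H_space (H_dual k) \<and>
     (\<forall>u\<in>H_space. H_norm k u \<le> M * dual_norm k (L u))"

lemma
  assumes "linear_to_dual k L" "u \<in> H_space"
  shows linear_to_dual_H_dual: "L u \<in> H_dual k"
    and linear_to_dual_add: "v \<in> H_space \<Longrightarrow> L (\<lambda>x. u x + v x) = (\<lambda>w. L u w + L v w)"
    and linear_to_dual_scale: "L (\<lambda>x. c * u x) = (\<lambda>w. c * L u w)"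
  using assms by (simp_all add: linear_to_dual_def)

lemma linear_to_dual_diff:
  assumes L: "linear_to_dual k L" and u: "u \<in> H_space" and v: "v \<in> H_space"
  shows "L (\<lambda>x. u x - v x) = (\<lambda>w. L u w - L v w)"
  using linear_to_dual_add[OF L u H_scale[OF v, of "-1"]] linear_to_dual_scale[OF L v, of "-1"] by simp

lemma linear_to_dual_combine:
  assumes L: "linear_to_dual k L" and B: "linear_to_dual k B"
  shows "linear_to_dual k (\<lambda>u v. L u v + z * B u v)"
  unfolding linear_to_dual_def
proof (intro conjI ballI allI)
  show "(\<lambda>v. L u v + z * B u v) \<in> H_dual k" if "u \<in> H_space" for u
    using assms that unfolding linear_to_dual_def by (intro H_dual_plus H_dual_times) auto
qed (use assms in \<open>simp_all add: linear_to_dual_def algebra_simps\<close>)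

lemma has_bounded_inverseI:
  assumes L: "linear_to_dual k L" and k: "k > 0"
    and bd: "\<And>u. u \<in> H_space \<Longrightarrow> H_norm k u \<le> M * dual_norm k (L u)"
    and surj: "\<And>F. F \<in> H_dual k \<Longrightarrow> \<exists>u\<in>H_space. L u = F"
  shows "has_bounded_inverse k L M"
proof -
  have "inj_on L H_space"
  proof (rule inj_onI)
    fix u v assume uv: "u \<in> H_space" "v \<in> H_space" "L u = L v"
    then have "L (\<lambda>x. u x - v x) = (\<lambda>w. 0)" by (simp add: linear_to_dual_diff[OF L])
    with bd[OF H_diff[OF uv(1,2)]] have "H_norm k (\<lambda>x. u x - v x) = 0"
      using H_norm_nonneg[of k "\<lambda>x. u x - v x"] by simp
    from H_norm_eq_0[OF H_diff[OF uv(1,2)] k this] show "u = v" by (simp add: fun_eq_iff)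
  qed
  moreover have "L ` H_space = H_dual k"
    using L surj unfolding linear_to_dual_def by blast
  ultimately show ?thesis using bd by (simp add: has_bounded_inverse_def bij_betw_def)
qed

lemma
  assumes L: "linear_to_dual k L" and inv: "has_bounded_inverse k L M"
  shows inverse_in_H: "F \<in> H_dual k \<Longrightarrow> inv_into H_space L F \<in> H_space"
    and inverse_right: "F \<in> H_dual k \<Longrightarrow> L (inv_into H_space L F) = F"
    and inverse_eqI: "u \<in> H_space \<Longrightarrow> L u = F \<Longrightarrow> inv_into H_space L F = u"
    and norm_inverse_le: "F \<in> H_dual k \<Longrightarrow> H_norm k (inv_into H_space L F) \<le> M * dual_norm k F"
    and inverse_bounded_ops: "inv_into H_space L \<in> bounded_ops k"
proof -
  have bij: "bij_betw L H_space (H_dual k)" and bd: "\<And>u. u \<in> H_space \<Longrightarrow> H_norm k u \<le> M * dual_norm k (L u)"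
    using inv by (auto simp: has_bounded_inverse_def)
  show H: "inv_into H_space L F \<in> H_space" if "F \<in> H_dual k" for F
    using that bij by (metis bij_betw_def inv_into_into)
  show R: "L (inv_into H_space L F) = F" if "F \<in> H_dual k" for F
    using that bij by (metis bij_betw_def f_inv_into_f)
  show E: "inv_into H_space L F = u" if "u \<in> H_space" "L u = F" for F u
    using that bij by (metis bij_betw_def inv_into_f_f)
  show N: "H_norm k (inv_into H_space L F) \<le> M * dual_norm k F" if "F \<in> H_dual k" for F
    using bd[OF H[OF that]] R[OF that] by simp
  show "inv_into H_space L \<in> bounded_ops k"
    unfolding bounded_ops_def
  proof (intro CollectI conjI ballI allI)
    fix F G assume F: "F \<in> H_dual k" and G: "G \<in> H_dual k"
    show "inv_into H_space L (\<lambda>v. F v + G v) = (\<lambda>x. inv_into H_space L F x + inv_into H_space L G x)"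
      using L H[OF F] H[OF G] R[OF F] R[OF G] by (intro E) (auto simp: linear_to_dual_def)
  next
    fix c F assume F: "F \<in> H_dual k"
    show "inv_into H_space L (\<lambda>v. c * F v) = (\<lambda>x. c * inv_into H_space L F x)"
      using L H[OF F] R[OF F] by (intro E) (auto simp: linear_to_dual_def)
  qed (use H N in blast)+
qed

text \<open>The library wants a metric to be symmetric also off its carrier.\<close>

definition H_dist :: "real \<Rightarrow> fn \<Rightarrow> fn \<Rightarrow> real" where
  "H_dist k u v = (if u \<in> H_space \<and> v \<in> H_space then H_norm k (\<lambda>x. u x - v x) else 0)"

lemma H_Metric_space:
  assumes "k > 0" shows "Metric_space H_space (H_dist k)"
proof
  show "(H_dist k u v = 0) = (u = v)" if "u \<in> H_space" "v \<in> H_space" for u v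
    using H_norm_eq_0[OF H_diff[OF that] assms] that by (auto simp: H_dist_def fun_eq_iff)
  show "H_dist k u w \<le> H_dist k u v + H_dist k v w"
    if "u \<in> H_space" "v \<in> H_space" "w \<in> H_space" for u v w
    using H_norm_triangle[OF H_diff[OF that(1,2)] H_diff[OF that(2,3)], of k] that by (simp add: H_dist_def)
qed (auto simp: H_dist_def intro: H_norm_minus_commute)

lemma H_mcomplete:
  assumes k: "k > 0" shows "Metric_space.mcomplete H_space (H_dist k)"
proof -
  interpret Metric_space H_space "H_dist k" by (rule H_Metric_space[OF k])
  show ?thesis
    unfolding mcomplete_def
  proof (intro allI impI)
    fix s assume s: "MCauchy s"
    then have sH: "s n \<in> H_space" for n by (auto simp: MCauchy_def)
    from s have "\<exists>N. \<forall>i\<ge>N. \<forall>j\<ge>N. H_norm k (\<lambda>x. s i x - s j x) < e" if "e > 0" for e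
      using that unfolding MCauchy_def by (simp add: H_dist_def sH)
    from H_complete[OF sH k this] obtain w where w: "w \<in> H_space"
      and l: "(\<lambda>n. H_norm k (\<lambda>x. s n x - w x)) \<longlonglongrightarrow> 0" by blast
    have "limitin mtopology s w sequentially"
      unfolding limitin_metric using w sH order_tendstoD(2)[OF l] by (simp add: H_dist_def)
    then show "\<exists>w. limitin mtopology s w sequentially" by blast
  qed
qed

text \<open>Solutions of \<open>L u + z B u = F\<close> are fixed points of
  \<open>u \<mapsto> L^-1 (F - z B u)\<close>, a contraction with factor \<open>cmod z * M\<close>
  because \<open>B\<close> has norm at most 1; Banach's theorem then sums the series. The new
  constant results from absorbing \<open>cmod z * M * H_norm k u\<close> into the left-hand
  side.\<close>

lemma Neumann:
  assumes L: "linear_to_dual k L" and inv: "has_bounded_inverse k L M"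
    and B: "linear_to_dual k B" and B_le: "\<And>u. u \<in> H_space \<Longrightarrow> dual_norm k (B u) \<le> H_norm k u"
    and k: "k > 0" and M: "0 \<le> M" and z: "cmod z * M < 1"
  shows "has_bounded_inverse k (\<lambda>u v. L u v + z * B u v) (M / (1 - cmod z * M))"
proof (rule has_bounded_inverseI[OF linear_to_dual_combine[OF L B] k])
  have LD: "L u \<in> H_dual k" and BD: "B u \<in> H_dual k" if "u \<in> H_space" for u
    using L B that by (auto simp: linear_to_dual_def)
  have bd: "\<And>u. u \<in> H_space \<Longrightarrow> H_norm k u \<le> M * dual_norm k (L u)"
    using inv by (simp add: has_bounded_inverse_def)
  show "H_norm k u \<le> M / (1 - cmod z * M) * dual_norm k (\<lambda>v. L u v + z * B u v)" if u: "u \<in> H_space" for u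
  proof -
    let ?A = "\<lambda>v. L u v + z * B u v"
    have A: "?A \<in> H_dual k" by (intro H_dual_plus H_dual_times LD BD u)
    have "dual_norm k (L u) = dual_norm k (\<lambda>v. ?A v + (-z) * B u v)" by simp
    also have "\<dots> \<le> dual_norm k ?A + dual_norm k (\<lambda>v. (-z) * B u v)"
      by (rule dual_norm_plus_le[OF A H_dual_times[OF BD[OF u]]])
    also have "dual_norm k (\<lambda>v. (-z) * B u v) \<le> cmod z * H_norm k u"
      using order_trans[OF dual_norm_times_le[OF BD[OF u], of "-z"] mult_left_mono[OF B_le[OF u]]] by simp
    finally have "H_norm k u \<le> M * (dual_norm k ?A + cmod z * H_norm k u)"
      using bd[OF u] M by (meson add_left_mono mult_left_mono order_trans)
    then show ?thesis using z by (simp add: field_simps)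
  qed
  fix F assume F: "F \<in> H_dual k"
  define T where "T = inv_into H_space L"
  note TH = inverse_in_H[OF L inv, folded T_def] and TR = inverse_right[OF L inv, folded T_def]
  interpret Metric_space H_space "H_dist k" by (rule H_Metric_space[OF k])
  have step: "(\<lambda>v. F v + (- z) * B u v) \<in> H_dual k" if "u \<in> H_space" for u
    by (intro H_dual_plus H_dual_times F BD that)
  obtain u where u: "u \<in> H_space" "T (\<lambda>v. F v + (- z) * B u v) = u"
  proof (rule Banach_fixedpoint_thm[OF H_mcomplete[OF k], where f="\<lambda>u. T (\<lambda>v. F v + (- z) * B u v)"])
    show "H_space \<noteq> {}" using H_zero by blast
    show "(\<lambda>u. T (\<lambda>v. F v + (- z) * B u v)) \<in> H_space \<rightarrow> H_space"
      using TH step by blast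
    show "cmod z * M < 1" by (rule z)
    fix u w assume u: "u \<in> H_space" and w: "w \<in> H_space"
    let ?u = "T (\<lambda>v. F v + (- z) * B u v)" and ?w = "T (\<lambda>v. F v + (- z) * B w v)"
    have H: "?u \<in> H_space" "?w \<in> H_space" using TH step u w by auto
    have "L (\<lambda>x. ?u x - ?w x) = (\<lambda>v. (- z) * B (\<lambda>x. u x - w x) v)"
      unfolding linear_to_dual_diff[OF L H] TR[OF step[OF u]] TR[OF step[OF w]]
          linear_to_dual_diff[OF B u w] by (simp add: fun_eq_iff algebra_simps)
    then have "H_norm k (\<lambda>x. ?u x - ?w x) \<le> M * dual_norm k (\<lambda>v. (- z) * B (\<lambda>x. u x - w x) v)"
      using bd[OF H_diff[OF H]] by simp
    also have "\<dots> \<le> M * (cmod (- z) * H_norm k (\<lambda>x. u x - w x))"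
      by (intro mult_left_mono[OF _ M] order_trans[OF dual_norm_times_le[OF BD[OF H_diff[OF u w]]]]
          mult_left_mono B_le H_diff u w) simp
    finally show "H_dist k ?u ?w \<le> cmod z * M * H_dist k u w"
      using H u w by (simp add: H_dist_def mult_ac)
  qed blast
  have "L u = (\<lambda>v. F v + (- z) * B u v)" using TR[OF step[OF u(1)]] u(2) by simp
  then have "(\<lambda>v. L u v + z * B u v) = F" by (simp add: fun_eq_iff)
  then show "\<exists>u\<in>H_space. (\<lambda>v. L u v + z * B u v) = F" using u(1) by blast
qed

text \<open>A sufficient form of the differentiability in \<open>op_holomorphic_on\<close>: the
  remainder is bounded functional by functional rather than through the supremum
  \<open>op_norm\<close>, and such bounds combine directly under sums and products.\<close>

definition has_op_deriv :: "real \<Rightarrow> (complex \<Rightarrow> functional \<Rightarrow> fn) \<Rightarrow> (functional \<Rightarrow> fn) \<Rightarrow> complex \<Rightarrow> complex set \<Rightarrow> bool" where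
  "has_op_deriv k T D y S \<longleftrightarrow> D \<in> bounded_ops k \<and>
     (\<exists>e. (e \<longlongrightarrow> 0) (at y within S) \<and>
       (\<forall>z\<in>S - {y}. \<forall>F\<in>H_dual k. H_norm k (\<lambda>x. (T z F x - T y F x) / (z - y) - D F x) \<le> e z * dual_norm k F))"

lemma op_holomorphic_onI:
  assumes "\<And>y. y \<in> S \<Longrightarrow> T y \<in> bounded_ops k" and "\<And>y. y \<in> S \<Longrightarrow> \<exists>D. has_op_deriv k T D y S"
  shows "op_holomorphic_on k T S"
  unfolding op_holomorphic_on_def
proof (intro ballI conjI)
  fix y assume y: "y \<in> S"
  from assms(1)[OF y] show "T y \<in> bounded_ops k" .
  from assms(2)[OF y] obtain D e where D: "D \<in> bounded_ops k" and e: "(e \<longlongrightarrow> 0) (at y within S)"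
    and le: "\<And>z F. z \<in> S - {y} \<Longrightarrow> F \<in> H_dual k \<Longrightarrow>
      H_norm k (\<lambda>x. (T z F x - T y F x) / (z - y) - D F x) \<le> e z * dual_norm k F"
    unfolding has_op_deriv_def by blast
  show "\<exists>D\<in>bounded_ops k. ((\<lambda>z. op_norm k (\<lambda>F x. (T z F x - T y F x) / (z - y) - D F x)) \<longlongrightarrow> 0) (at y within S)"
  proof (rule bexI[OF _ D], rule tendsto_sandwich[OF _ _ tendsto_const])
    \<comment> \<open>\<open>op_norm_le\<close> asks for a nonnegative bound, while the sign of
      \<open>e\<close> is not prescribed.\<close>
    show "((\<lambda>z. \<bar>e z\<bar>) \<longlongrightarrow> 0) (at y within S)" using tendsto_rabs[OF e] by simp
    have abs_le: "H_norm k (\<lambda>x. (T z F x - T y F x) / (z - y) - D F x) \<le> \<bar>e z\<bar> * dual_norm k F"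
      if "z \<in> S - {y}" "F \<in> H_dual k" for z F
      using le[OF that] mult_right_mono[OF abs_ge_self dual_norm_nonneg[OF that(2)], of "e z"] by linarith
    have ev: "\<forall>\<^sub>F z in at y within S. z \<in> S - {y}" by (auto simp: eventually_at_filter)
    show "\<forall>\<^sub>F z in at y within S. op_norm k (\<lambda>F x. (T z F x - T y F x) / (z - y) - D F x) \<le> \<bar>e z\<bar>"
      using ev by (rule eventually_mono) (intro op_norm_le abs_le, auto)
    show "\<forall>\<^sub>F z in at y within S. 0 \<le> op_norm k (\<lambda>F x. (T z F x - T y F x) / (z - y) - D F x)"
      using ev by (rule eventually_mono) (rule op_norm_nonneg[OF abs_le])
  qed
qed

lemma bounded_ops_linear:
  assumes "T \<in> bounded_ops k" "F \<in> H_dual k"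
  shows "T F \<in> H_space" "G \<in> H_dual k \<Longrightarrow> T (\<lambda>v. F v + G v) = (\<lambda>x. T F x + T G x)"
    "T (\<lambda>v. c * F v) = (\<lambda>x. c * T F x)"
  using assms by (simp_all add: bounded_ops_def)

lemma bounded_opsI:
  assumes "\<And>F. F \<in> H_dual k \<Longrightarrow> T F \<in> H_space"
    and "\<And>F G. F \<in> H_dual k \<Longrightarrow> G \<in> H_dual k \<Longrightarrow> T (\<lambda>v. F v + G v) = (\<lambda>x. T F x + T G x)"
    and "\<And>c F. F \<in> H_dual k \<Longrightarrow> T (\<lambda>v. c * F v) = (\<lambda>x. c * T F x)"
    and "\<And>F. F \<in> H_dual k \<Longrightarrow> H_norm k (T F) \<le> B * dual_norm k F"
  shows "T \<in> bounded_ops k"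
  unfolding bounded_ops_def
  by (intro CollectI conjI ballI allI exI[of _ B]) (rule assms; assumption)+

lemma bounded_ops_combine:
  assumes S: "S \<in> bounded_ops k" and T: "T \<in> bounded_ops k"
  shows "(\<lambda>F x. a * S F x + b * T F x) \<in> bounded_ops k"
proof (rule bounded_opsI)
  fix F assume F: "F \<in> H_dual k"
  note H = bounded_ops_linear(1)[OF S F] bounded_ops_linear(1)[OF T F]
  show "(\<lambda>x. a * S F x + b * T F x) \<in> H_space" by (intro H_add H_scale H)
  have "H_norm k (\<lambda>x. a * S F x + b * T F x) \<le> cmod a * H_norm k (S F) + cmod b * H_norm k (T F)"
    using H_norm_triangle[OF H_scale[OF H(1)] H_scale[OF H(2)], of k a b] by (simp add: H_norm_scale H)
  also have "\<dots> \<le> cmod a * (op_norm k S * dual_norm k F) + cmod b * (op_norm k T * dual_norm k F)"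
    by (intro add_mono mult_left_mono norm_le_op_norm S T F) auto
  finally show "H_norm k (\<lambda>x. a * S F x + b * T F x) \<le> (cmod a * op_norm k S + cmod b * op_norm k T) * dual_norm k F"
    by (simp add: algebra_simps)
qed (simp_all add: bounded_ops_linear[OF S] bounded_ops_linear[OF T] algebra_simps)

lemma has_op_deriv_const: "has_op_deriv k (\<lambda>z. T) (\<lambda>F x. 0) y S"
  unfolding has_op_deriv_def
proof (intro conjI exI[of _ "\<lambda>z. 0"])
  show "(\<lambda>F x. 0) \<in> bounded_ops k" by (rule bounded_opsI[where B=0]) auto
qed auto

lemma has_op_deriv_add:
  assumes S: "has_op_deriv k S S' y A" and T: "has_op_deriv k T T' y A"
    and b: "\<And>z. z \<in> A \<Longrightarrow> S z \<in> bounded_ops k" "\<And>z. z \<in> A \<Longrightarrow> T z \<in> bounded_ops k" "y \<in> A"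
  shows "has_op_deriv k (\<lambda>z F x. S z F x + T z F x) (\<lambda>F x. S' F x + T' F x) y A"
proof -
  from S obtain e where S': "S' \<in> bounded_ops k" and e: "(e \<longlongrightarrow> 0) (at y within A)"
    and le: "\<And>z F. z \<in> A - {y} \<Longrightarrow> F \<in> H_dual k \<Longrightarrow>
      H_norm k (\<lambda>x. (S z F x - S y F x) / (z - y) - S' F x) \<le> e z * dual_norm k F"
    unfolding has_op_deriv_def by blast
  from T obtain d where T': "T' \<in> bounded_ops k" and d: "(d \<longlongrightarrow> 0) (at y within A)"
    and ld: "\<And>z F. z \<in> A - {y} \<Longrightarrow> F \<in> H_dual k \<Longrightarrow>
      H_norm k (\<lambda>x. (T z F x - T y F x) / (z - y) - T' F x) \<le> d z * dual_norm k F"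
    unfolding has_op_deriv_def by blast
  show ?thesis
    unfolding has_op_deriv_def
  proof (intro conjI exI[of _ "\<lambda>z. e z + d z"] ballI)
    show "(\<lambda>F x. S' F x + T' F x) \<in> bounded_ops k" using bounded_ops_combine[OF S' T', of 1 1] by simp
    show "((\<lambda>z. e z + d z) \<longlongrightarrow> 0) (at y within A)" using tendsto_add[OF e d] by simp
    fix z F assume z: "z \<in> A - {y}" and F: "F \<in> H_dual k"
    have H: "(\<lambda>x. (R z F x - R y F x) / (z - y) - R' F x) \<in> H_space"
      if "R' \<in> bounded_ops k" "R z \<in> bounded_ops k" "R y \<in> bounded_ops k" for R R'
      using H_diff[OF H_scale[OF H_diff[OF bounded_ops_linear(1)[OF that(2) F] bounded_ops_linear(1)[OF that(3) F]],
            of "1 / (z - y)"] bounded_ops_linear(1)[OF that(1) F]] by simp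
    have "H_norm k (\<lambda>x. ((S z F x - S y F x) / (z - y) - S' F x) + ((T z F x - T y F x) / (z - y) - T' F x))
        \<le> e z * dual_norm k F + d z * dual_norm k F"
      using z b by (intro order_trans[OF H_norm_triangle[OF H H]] add_mono le ld F S' T') auto
    moreover have "(\<lambda>x. ((S z F x - S y F x) / (z - y) - S' F x) + ((T z F x - T y F x) / (z - y) - T' F x))
      = (\<lambda>x. (S z F x + T z F x - (S y F x + T y F x)) / (z - y) - (S' F x + T' F x))"
      by (simp add: fun_eq_iff add_divide_distrib diff_divide_distrib)
    ultimately show "H_norm k (\<lambda>x. (S z F x + T z F x - (S y F x + T y F x)) / (z - y) - (S' F x + T' F x))
        \<le> (e z + d z) * dual_norm k F" by (simp add: distrib_right)
  qed
qed

text \<open>The remainder of the product splits into \<open>f z\<close> times the remainder of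
  \<open>T\<close>, the increment of \<open>f\<close> times \<open>D F\<close>, and the remainder of
  \<open>f\<close> times \<open>T y F\<close>. Each tends to zero relative to
  \<open>dual_norm k F\<close>.\<close>

lemma has_op_deriv_scale:
  assumes T: "has_op_deriv k T D y S" and f: "(f has_field_derivative f') (at y within S)"
    and b: "\<And>z. z \<in> S \<Longrightarrow> T z \<in> bounded_ops k" "y \<in> S"
  shows "has_op_deriv k (\<lambda>z F x. f z * T z F x) (\<lambda>F x. f' * T y F x + f y * D F x) y S"
proof -
  from T obtain e where D: "D \<in> bounded_ops k" and e: "(e \<longlongrightarrow> 0) (at y within S)"
    and le: "\<And>z F. z \<in> S - {y} \<Longrightarrow> F \<in> H_dual k \<Longrightarrow>
      H_norm k (\<lambda>x. (T z F x - T y F x) / (z - y) - D F x) \<le> e z * dual_norm k F"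
    unfolding has_op_deriv_def by blast
  have Ty: "T y \<in> bounded_ops k" using b by blast
  let ?q = "\<lambda>z. (f z - f y) / (z - y) - f'"
  show ?thesis
    unfolding has_op_deriv_def
  proof (intro conjI exI[of _ "\<lambda>z. cmod (f z) * e z + cmod (f z - f y) * op_norm k D + cmod (?q z) * op_norm k (T y)"] ballI)
    show "(\<lambda>F x. f' * T y F x + f y * D F x) \<in> bounded_ops k" by (rule bounded_ops_combine[OF Ty D])
    have q: "(?q \<longlongrightarrow> 0) (at y within S)"
      using f unfolding has_field_derivative_iff by (rule LIM_zero)
    have c: "(f \<longlongrightarrow> f y) (at y within S)"
      using DERIV_continuous[OF f] by (simp add: continuous_within)
    have "((\<lambda>z. cmod (f z) * e z + cmod (f z - f y) * op_norm k D + cmod (?q z) * op_norm k (T y))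
        \<longlongrightarrow> cmod (f y) * 0 + cmod 0 * op_norm k D + cmod 0 * op_norm k (T y)) (at y within S)"
      by (intro tendsto_intros c e q LIM_zero)
    then show "((\<lambda>z. cmod (f z) * e z + cmod (f z - f y) * op_norm k D + cmod (?q z) * op_norm k (T y)) \<longlongrightarrow> 0) (at y within S)"
      by simp
    fix z F assume z: "z \<in> S - {y}" and F: "F \<in> H_dual k"
    let ?Q = "\<lambda>x. (T z F x - T y F x) / (z - y) - D F x"
    have Tz: "T z \<in> bounded_ops k" using z b(1) by blast
    note TzF = bounded_ops_linear(1)[OF Tz F] and TyF = bounded_ops_linear(1)[OF Ty F]
      and DF = bounded_ops_linear(1)[OF D F]
    have Q: "?Q \<in> H_space" using H_diff[OF H_scale[OF H_diff[OF TzF TyF], of "1 / (z - y)"] DF] by simp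
    have "(\<lambda>x. (f z * T z F x - f y * T y F x) / (z - y) - (f' * T y F x + f y * D F x))
      = (\<lambda>x. (f z * ?Q x + (f z - f y) * D F x) + ?q z * T y F x)"
    proof
      fix x
      have alg: "(a * p - b * q) / d - (f' * q + b * r) = (a * ((p - q) / d - r) + (a - b) * r) + ((a - b) / d - f') * q"
        if "d \<noteq> 0" for a b p q r d :: complex
        using that by (simp add: divide_simps) (simp add: algebra_simps)
      show "(f z * T z F x - f y * T y F x) / (z - y) - (f' * T y F x + f y * D F x)
          = (f z * ?Q x + (f z - f y) * D F x) + ?q z * T y F x"
        using z by (intro alg) auto
    qed
    note eq = this
    note t1 = H_norm_triangle[OF H_add[OF H_scale[OF Q, of "f z"] H_scale[OF DF, of "f z - f y"]] H_scale[OF TyF, of "?q z"], of k,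
        unfolded H_norm_scale[OF TyF]]
    note t2 = H_norm_triangle[OF H_scale[OF Q, of "f z"] H_scale[OF DF, of "f z - f y"], of k,
        unfolded H_norm_scale[OF Q] H_norm_scale[OF DF]]
    have "H_norm k (\<lambda>x. (f z * T z F x - f y * T y F x) / (z - y) - (f' * T y F x + f y * D F x))
      \<le> cmod (f z) * H_norm k ?Q + cmod (f z - f y) * H_norm k (D F) + cmod (?q z) * H_norm k (T y F)"
      unfolding eq by (rule order_trans[OF t1 add_right_mono[OF t2]])
    also have "\<dots> \<le> cmod (f z) * (e z * dual_norm k F) + cmod (f z - f y) * (op_norm k D * dual_norm k F)
        + cmod (?q z) * (op_norm k (T y) * dual_norm k F)"
      by (intro add_mono mult_left_mono le z F norm_le_op_norm D Ty) auto
    finally show "H_norm k (\<lambda>x. (f z * T z F x - f y * T y F x) / (z - y) - (f' * T y F x + f y * D F x))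
      \<le> (cmod (f z) * e z + cmod (f z - f y) * op_norm k D + cmod (?q z) * op_norm k (T y)) * dual_norm k F"
      by (simp add: algebra_simps)
  qed
qed

text \<open>The resolvent identity \<open>T z - T y = - (z - y) T z B T y\<close>, applied twice,
  leaves the remainder \<open>(z - y) T z B T y B T y\<close>. On \<open>S\<close> the Neumann bound
  gives inverses of norm at most \<open>2 * M\<close>, hence the factor \<open>(2 * M)^3\<close>.
  The centre \<open>c\<close> is 0 for the ball of holomorphy and the resonance itself in
  \<open>resonance_pole\<close>.\<close>

lemma has_op_deriv_inverse:
  assumes L: "linear_to_dual k L" and inv: "has_bounded_inverse k L M"
    and B: "linear_to_dual k B" and B_le: "\<And>u. u \<in> H_space \<Longrightarrow> dual_norm k (B u) \<le> H_norm k u"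
    and k: "k > 0" and M: "0 \<le> M" and S: "\<And>z. z \<in> S \<Longrightarrow> cmod (z - c) * M \<le> 1/2" and y: "y \<in> S"
  defines "T \<equiv> \<lambda>z. inv_into H_space (\<lambda>u v. L u v + (z - c) * B u v)"
  shows "has_op_deriv k T (\<lambda>F x. - T y (B (T y F)) x) y S"
proof -
  let ?A = "\<lambda>z u v. L u v + (z - c) * B u v"
  have lin: "linear_to_dual k (?A z)" for z by (rule linear_to_dual_combine[OF L B])
  have inv2: "has_bounded_inverse k (?A z) (2 * M)" if "z \<in> S" for z
  proof -
    have "cmod (z - c) * M < 1" using S[OF that] by simp
    from Neumann[OF L inv B B_le k M this] have N: "has_bounded_inverse k (?A z) (M / (1 - cmod (z - c) * M))" .
    have "M / (1 - cmod (z - c) * M) \<le> M / (1/2)"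
      using S[OF that] M by (intro divide_left_mono) auto
    then show ?thesis
      unfolding has_bounded_inverse_def
    proof (intro conjI ballI)
      show "bij_betw (?A z) H_space (H_dual k)" using N by (simp add: has_bounded_inverse_def)
      fix u assume u: "u \<in> H_space"
      then have "H_norm k u \<le> M / (1 - cmod (z - c) * M) * dual_norm k (?A z u)" "?A z u \<in> H_dual k"
        using N lin[of z] by (simp_all add: has_bounded_inverse_def linear_to_dual_def)
      moreover from this have "M / (1 - cmod (z - c) * M) * dual_norm k (?A z u) \<le> 2 * M * dual_norm k (?A z u)"
        using \<open>_ \<le> M / (1/2)\<close> by (intro mult_right_mono dual_norm_nonneg) auto
      ultimately show "H_norm k u \<le> 2 * M * dual_norm k (?A z u)" by linarith
    qed
  qed
  have inv_T: "inv_into H_space (?A z) = T z" for z by (simp add: T_def)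
  note TH = inverse_in_H[OF lin inv2, unfolded inv_T] and TR = inverse_right[OF lin inv2, unfolded inv_T]
    and TE = inverse_eqI[OF lin inv2, unfolded inv_T] and TN = norm_inverse_le[OF lin inv2, unfolded inv_T]
    and TB = inverse_bounded_ops[OF lin inv2, unfolded inv_T]
  have BD: "B u \<in> H_dual k" if "u \<in> H_space" for u using B that by (auto simp: linear_to_dual_def)
  have res: "T z F x - T y F x = - (z - y) * T z (B (T y F)) x" if z: "z \<in> S" and F: "F \<in> H_dual k" for z F x
  proof -
    let ?u = "T y F"
    have u: "?u \<in> H_space" by (rule TH[OF y F])
    have w: "T z (B ?u) \<in> H_space" by (rule TH[OF z BD[OF u]])
    have "T z F = (\<lambda>x. ?u x + (- (z - y)) * T z (B ?u) x)"
    proof (rule TE[OF z])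
      show "(\<lambda>x. ?u x + (- (z - y)) * T z (B ?u) x) \<in> H_space" by (intro H_add H_scale u w)
      have "?A z (\<lambda>x. ?u x + (- (z - y)) * T z (B ?u) x)
          = (\<lambda>v. ?A z ?u v + (- (z - y)) * ?A z (T z (B ?u)) v)"
        using linear_to_dual_add[OF lin[of z] u H_scale[OF w, of "- (z - y)"]]
          linear_to_dual_scale[OF lin[of z] w, of "- (z - y)"] by (simp only: fun_eq_iff simp_thms)
      also have "\<dots> = (\<lambda>v. ?A y ?u v)"
      proof
        fix v
        have "?A z (T z (B ?u)) v = B ?u v" using fun_cong[OF TR[OF z BD[OF u]], of v] .
        then show "?A z ?u v + (- (z - y)) * ?A z (T z (B ?u)) v = ?A y ?u v"
          by (simp only:) (simp add: algebra_simps)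
      qed
      also have "\<dots> = F" by (rule TR[OF y F])
      finally show "?A z (\<lambda>x. ?u x + (- (z - y)) * T z (B ?u) x) = F" .
    qed
    then show ?thesis by (metis add_diff_cancel_left')
  qed
  have N3: "H_norm k (T z (B u)) \<le> 2 * M * H_norm k u" if z: "z \<in> S" and u: "u \<in> H_space" for z u
    using order_trans[OF TN[OF z BD[OF u]] mult_left_mono[OF B_le[OF u]]] M by simp
  show ?thesis
    unfolding has_op_deriv_def
  proof (intro conjI exI[of _ "\<lambda>z. cmod (z - y) * (2 * M * (2 * M * (2 * M)))"] ballI)
    show "(\<lambda>F x. - T y (B (T y F)) x) \<in> bounded_ops k"
    proof (rule bounded_opsI)
      fix F assume F: "F \<in> H_dual k"
      note H = TH[OF y F] TH[OF y BD[OF TH[OF y F]]]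
      show "(\<lambda>x. - T y (B (T y F)) x) \<in> H_space" using H_scale[OF H(2), of "-1"] by simp
      have "H_norm k (\<lambda>x. - T y (B (T y F)) x) = H_norm k (T y (B (T y F)))"
        using H_norm_scale[OF H(2), of k "-1"] by simp
      also have "\<dots> \<le> 2 * M * (2 * M * dual_norm k F)"
        using M by (intro order_trans[OF N3[OF y H(1)]] mult_left_mono TN y F) auto
      finally show "H_norm k (\<lambda>x. - T y (B (T y F)) x) \<le> (2 * M * (2 * M)) * dual_norm k F" by (simp add: mult_ac)
      { fix G assume G: "G \<in> H_dual k"
        have "B (\<lambda>x. T y F x + T y G x) = (\<lambda>v. B (T y F) v + B (T y G) v)"
          using B TH[OF y F] TH[OF y G] by (simp add: linear_to_dual_def)
        then show "(\<lambda>x. - T y (B (T y (\<lambda>v. F v + G v))) x) = (\<lambda>x. - T y (B (T y F)) x + - T y (B (T y G)) x)"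
          by (simp add: bounded_ops_linear(2)[OF TB[OF y] F G]
              bounded_ops_linear(2)[OF TB[OF y] BD[OF TH[OF y F]] BD[OF TH[OF y G]]]) }
      fix c
      have "B (\<lambda>x. c * T y F x) = (\<lambda>v. c * B (T y F) v)"
          using B TH[OF y F] by (simp add: linear_to_dual_def)
      then show "(\<lambda>x. - T y (B (T y (\<lambda>v. c * F v))) x) = (\<lambda>x. c * - T y (B (T y F)) x)"
        by (simp add: bounded_ops_linear(3)[OF TB[OF y] F] bounded_ops_linear(3)[OF TB[OF y] BD[OF TH[OF y F]]])
    qed
    have "((\<lambda>z. cmod (z - y) * (2 * M * (2 * M * (2 * M)))) \<longlongrightarrow> cmod (y - y) * (2 * M * (2 * M * (2 * M)))) (at y within S)"
      by (intro tendsto_intros)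
    then show "((\<lambda>z. cmod (z - y) * (2 * M * (2 * M * (2 * M)))) \<longlongrightarrow> 0) (at y within S)" by simp
    fix z F assume z: "z \<in> S - {y}" and F: "F \<in> H_dual k"
    then have zS: "z \<in> S" and ne: "z \<noteq> y" by auto
    let ?w = "B (T y F)"
    have w: "?w \<in> H_dual k" by (rule BD[OF TH[OF y F]])
    have "(T z F x - T y F x) / (z - y) - - T y ?w x = (z - y) * T z (B (T y ?w)) x" for x
    proof -
      have "(T z F x - T y F x) / (z - y) = - T z ?w x" using ne by (simp only: res[OF zS F]) (simp add: field_simps)
      then show ?thesis using res[OF zS w, of x] by (simp add: algebra_simps)
    qed
    then have "H_norm k (\<lambda>x. (T z F x - T y F x) / (z - y) - - T y ?w x)
        = H_norm k (\<lambda>x. (z - y) * T z (B (T y ?w)) x)" by (simp only:)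
    also have "\<dots> = cmod (z - y) * H_norm k (T z (B (T y ?w)))"
      by (rule H_norm_scale[OF TH[OF zS BD[OF TH[OF y w]]]])
    also have "\<dots> \<le> cmod (z - y) * (2 * M * (2 * M * (2 * M * dual_norm k F)))"
      using M by (intro mult_left_mono order_trans[OF N3[OF zS TH[OF y w]]] order_trans[OF N3[OF y TH[OF y F]]] TN[OF y F]) auto
    finally show "H_norm k (\<lambda>x. (T z F x - T y F x) / (z - y) - - T y ?w x)
        \<le> cmod (z - y) * (2 * M * (2 * M * (2 * M))) * dual_norm k F" by (simp add: mult_ac)
  qed
qed

section \<open>The Helmholtz operator\<close>

definition potential :: "complex \<Rightarrow> fn" where
  "potential y x = 1 - (1/2 + y) * indicator {0..1} x"

text \<open>The derivative of the affine family \<open>helmholtz k y\<close> in \<open>y\<close>,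
  see \<open>helmholtz_split\<close>, cut off outside \<open>H_space\<close> as
  \<open>H_dual\<close> demands. As a map from H to its dual it has norm at most 1, so only the
  inverse enters the perturbation condition.\<close>

definition mass :: "fn \<Rightarrow> functional" where
  "mass u = (\<lambda>v. if v \<in> H_space then \<integral>x. indicator {0..1} x * u x * cnj (v x) \<partial>M2 else 0)"

lemma measurable_indicator_M2 [measurable]: "(\<lambda>x. indicator {0..1::real} x :: complex) \<in> borel_measurable M2"
  by (intro borel_measurable_indicator') (auto simp: sets_restrict_space)

lemma measurable_potential [measurable]: "potential y \<in> borel_measurable M2"
  unfolding potential_def[abs_def] by measurable

lemma norm_potential_le: "cmod (potential y x) \<le> 2 + cmod y"
proof -
  have "cmod (potential y x) \<le> cmod 1 + cmod (1/2 + y) * cmod (indicator {0..1} x :: complex)"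
    unfolding potential_def norm_mult[symmetric] by (rule norm_triangle_ineq4)
  also have "cmod (1/2 + y) * cmod (indicator {0..1} x :: complex) \<le> (1/2 + cmod y) * 1"
    using norm_triangle_ineq[of "1/2" y] by (intro mult_mono) (auto simp: indicator_def)
  finally show ?thesis by simp
qed

lemma square_integrable_mult:
  assumes [measurable]: "g \<in> borel_measurable M2" and g: "\<And>x. cmod (g x) \<le> B" and f: "square_integrable f"
  shows "square_integrable (\<lambda>x. g x * f x)"
proof -
  have [measurable]: "f \<in> borel_measurable M2" using f by (simp add: square_integrable_iff)
  have "integrable M2 (\<lambda>x. (cmod (g x * f x))\<^sup>2)"
  proof (rule Bochner_Integration.integrable_bound)
    show "integrable M2 (\<lambda>x. B\<^sup>2 * (cmod (f x))\<^sup>2)" using f by (simp add: square_integrable_iff)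
    show "AE x in M2. norm ((cmod (g x * f x))\<^sup>2) \<le> norm (B\<^sup>2 * (cmod (f x))\<^sup>2)"
      using g by (auto simp: norm_mult power_mult_distrib intro!: AE_I2 mult_right_mono power_mono)
  qed measurable
  then show ?thesis by (simp add: square_integrable_iff)
qed

lemma square_integrable_indicator:
  "square_integrable f \<Longrightarrow> square_integrable (\<lambda>x. indicator {0..1} x * f x)"
  by (rule square_integrable_mult[OF measurable_indicator_M2, where B=1]) (auto simp: indicator_def)

lemma square_integrable_potential:
  "square_integrable f \<Longrightarrow> square_integrable (\<lambda>x. potential y x * f x)"
  by (rule square_integrable_mult[OF _ norm_potential_le]) auto

lemma integrable_mass:
  assumes "u \<in> H_space" "v \<in> H_space"
  shows "integrable M2 (\<lambda>x. indicator {0..1} x * u x * cnj (v x))"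
  by (intro square_integrable_prod square_integrable_indicator square_integrable_cnj H_square_integrable assms)

lemma integrable_potential:
  assumes "u \<in> H_space" "v \<in> H_space"
  shows "integrable M2 (\<lambda>x. potential y x * u x * cnj (v x))"
  by (intro square_integrable_prod square_integrable_potential square_integrable_cnj H_square_integrable assms)

lemma norm_weighted_inner_le:
  assumes g: "\<And>x. cmod (g x) \<le> B" and u: "u \<in> H_space" and v: "v \<in> H_space"
  shows "cmod (\<integral>x. g x * u x * cnj (v x) \<partial>M2) \<le> B * H_norm k u * H_norm k v"
proof -
  note uv = H_square_integrable[OF u] H_square_integrable[OF v]
  have B: "0 \<le> B" using order_trans[OF norm_ge_zero g] .
  have i: "integrable M2 (\<lambda>x. cmod (u x) * cmod (v x))"
    using integrable_norm[OF square_integrable_prod[OF uv]] by (simp add: norm_mult)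
  have "cmod (\<integral>x. g x * u x * cnj (v x) \<partial>M2) \<le> (\<integral>x. B * (cmod (u x) * cmod (v x)) \<partial>M2)"
    using i g by (intro integral_norm_bound_integral[OF _ ] integral_norm_bound[THEN order_trans] integral_mono')
      (auto simp: norm_mult mult.assoc intro!: mult_right_mono mult_nonneg_nonneg B)
  also have "\<dots> = B * (\<integral>x. cmod (u x) * cmod (v x) \<partial>M2)" by simp
  also have "(\<integral>x. cmod (u x) * cmod (v x) \<partial>M2) \<le> H_norm k u * H_norm k v"
  proof (rule power2_le_imp_le)
    have "(\<integral>x. cmod (u x) * cmod (v x) \<partial>M2)\<^sup>2 \<le> (\<integral>x. (cmod (u x))\<^sup>2 \<partial>M2) * (\<integral>x. (cmod (v x))\<^sup>2 \<partial>M2)"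
      by (rule Cauchy_Schwarz_M2[OF uv])
    also have "\<dots> \<le> (H_norm k u)\<^sup>2 * (H_norm k v)\<^sup>2"
      by (intro mult_mono integral_le_H_norm) auto
    finally show "(\<integral>x. cmod (u x) * cmod (v x) \<partial>M2)\<^sup>2 \<le> (H_norm k u * H_norm k v)\<^sup>2"
      by (simp add: power_mult_distrib)
  qed simp
  finally show ?thesis using B by (simp add: mult.assoc mult_left_mono)
qed

lemma mass_H_dual:
  assumes u: "u \<in> H_space" shows "mass u \<in> H_dual k"
proof (rule H_dualI)
  show "cmod (mass u v) \<le> H_norm k u * H_norm k v" if "v \<in> H_space" for v
    using norm_weighted_inner_le[of "indicator {0..1}" 1 u v k] u that by (auto simp: mass_def indicator_def)
qed (use u in \<open>auto simp: mass_def H_add H_scale integrable_mass distrib_left mult.left_commute[of _ "cnj _"]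
  simp flip: Bochner_Integration.integral_add\<close>)

lemma linear_to_dual_mass: "linear_to_dual k mass"
  unfolding linear_to_dual_def
proof (intro conjI ballI allI ext)
  show "mass u \<in> H_dual k" if "u \<in> H_space" for u by (rule mass_H_dual[OF that])
  show "mass (\<lambda>x. u x + w x) v = mass u v + mass w v" if "u \<in> H_space" "w \<in> H_space" for u w v
    using integrable_mass[OF that(1)] integrable_mass[OF that(2)]
    by (simp add: mass_def distrib_left distrib_right)
  show "mass (\<lambda>x. c * u x) v = c * mass u v" if "u \<in> H_space" for u c v
    by (simp add: mass_def mult_ac flip: integral_mult_right_zero)
qed

lemma dual_norm_mass_le:
  assumes u: "u \<in> H_space" shows "dual_norm k (mass u) \<le> H_norm k u"
proof (rule dual_norm_le)
  show "cmod (mass u v) \<le> H_norm k u * H_norm k v" if "v \<in> H_space" for v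
    using norm_weighted_inner_le[of "indicator {0..1}" 1 u v k] u that by (auto simp: mass_def indicator_def)
qed simp

lemma helmholtz_outside: "v \<notin> H_space \<Longrightarrow> helmholtz k y u v = 0"
  by (simp add: helmholtz_def)

lemma helmholtz_eq:
  assumes u: "u \<in> H_space" and v: "v \<in> H_space"
  shows "helmholtz k y u v = (\<integral>x. weak_deriv u x * cnj (weak_deriv v x) \<partial>M2) / (of_real k)\<^sup>2
    - (\<integral>x. potential y x * u x * cnj (v x) \<partial>M2) - \<i> / of_real k * u 2 * cnj (v 2)"
  using u v by (simp add: helmholtz_def LINT_M2 integrable_potential flip: potential_def)

lemma helmholtz_split:
  assumes "u \<in> H_space"
  shows "helmholtz k y u v = helmholtz k 0 u v + y * mass u v"
proof (cases "v \<in> H_space")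
  case True
  have "(\<integral>x. potential y x * u x * cnj (v x) \<partial>M2)
      = (\<integral>x. potential 0 x * u x * cnj (v x) - y * (indicator {0..1} x * u x * cnj (v x)) \<partial>M2)"
    by (intro Bochner_Integration.integral_cong) (auto simp: potential_def algebra_simps)
  also have "\<dots> = (\<integral>x. potential 0 x * u x * cnj (v x) \<partial>M2) - y * mass u v"
    using True assms by (simp add: mass_def integrable_potential integrable_mass)
  finally show ?thesis by (simp add: helmholtz_eq assms True)
qed (simp add: helmholtz_outside mass_def)

text \<open>Shows what is left over when the Riesz representative of the data is inserted: a
  zero-order term, to be cancelled by \<open>source\<close>, and a boundary term, which goes into
  \<open>residual\<close>.\<close>

lemma helmholtz_eq_H_inner:
  assumes u: "u \<in> H_space" and v: "v \<in> H_space"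
  shows "helmholtz k y u v = H_inner k u v
    - (\<integral>x. (1 + potential y x) * u x * cnj (v x) \<partial>M2) - \<i> / of_real k * u 2 * cnj (v 2)"
  using u v by (simp add: helmholtz_eq H_inner_def distrib_right integrable_potential)

lemma linear_to_dual_helmholtz:
  assumes k: "k > 0" shows "linear_to_dual k (helmholtz k y)"
  unfolding linear_to_dual_def
proof (intro conjI ballI allI ext)
  fix u assume u: "u \<in> H_space"
  show "helmholtz k y u \<in> H_dual k"
  proof (rule H_dualI)
    fix v w assume v: "v \<in> H_space" and w: "w \<in> H_space"
    have "(\<integral>x. (1 + potential y x) * u x * cnj (v x + w x) \<partial>M2) =
      (\<integral>x. (1 + potential y x) * u x * cnj (v x) \<partial>M2) + (\<integral>x. (1 + potential y x) * u x * cnj (w x) \<partial>M2)"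
      using u v w integrable_potential by (simp add: distrib_right distrib_left)
    then show "helmholtz k y u (\<lambda>x. v x + w x) = helmholtz k y u v + helmholtz k y u w"
      using u v w by (simp add: helmholtz_eq_H_inner H_add H_inner_add_right algebra_simps)
  next
    fix c v assume v: "v \<in> H_space"
    have "(\<integral>x. (1 + potential y x) * u x * cnj (c * v x) \<partial>M2) =
      cnj c * (\<integral>x. (1 + potential y x) * u x * cnj (v x) \<partial>M2)"
      by (simp add: mult_ac flip: integral_mult_right_zero)
    then show "helmholtz k y u (\<lambda>x. c * v x) = cnj c * helmholtz k y u v"
      using u v by (simp add: helmholtz_eq_H_inner H_scale H_inner_scale_right algebra_simps)
  next
    fix v assume v: "v \<in> H_space"
    have "cmod (1 + potential y x) \<le> 3 + cmod y" for x
      using norm_triangle_ineq[of 1 "potential y x"] norm_potential_le[of y x] by simp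
    then have 1: "cmod (\<integral>x. (1 + potential y x) * u x * cnj (v x) \<partial>M2) \<le> (3 + cmod y) * H_norm k u * H_norm k v"
      by (intro norm_weighted_inner_le u v)
    have "cmod (\<i> / of_real k * u 2 * cnj (v 2)) = 1 / k * cmod (u 2) * cmod (v 2)"
      using k by (simp add: norm_mult norm_divide)
    also have "\<dots> \<le> 1 / k * (sqrt 2 * k * H_norm k u) * (sqrt 2 * k * H_norm k v)"
      using k norm_H_le[OF u k] norm_H_le[OF v k] by (intro mult_mono) auto
    also have "\<dots> = 2 * k * H_norm k u * H_norm k v" using k by (simp add: field_simps)
    finally have 2: "cmod (\<i> / of_real k * u 2 * cnj (v 2)) \<le> 2 * k * H_norm k u * H_norm k v" .
    have "cmod (helmholtz k y u v) \<le> H_norm k u * H_norm k v + (3 + cmod y) * H_norm k u * H_norm k v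
        + 2 * k * H_norm k u * H_norm k v"
      unfolding helmholtz_eq_H_inner[OF u v]
      by (intro order_trans[OF norm_triangle_ineq4] add_mono norm_H_inner_le u v 1 2)
    then show "cmod (helmholtz k y u v) \<le> ((1 + (3 + cmod y) + 2 * k) * H_norm k u) * H_norm k v"
      by (simp add: algebra_simps)
  qed (rule helmholtz_outside)
next
  fix u w v assume u: "u \<in> H_space" and w: "w \<in> H_space"
  show "helmholtz k y (\<lambda>x. u x + w x) v = helmholtz k y u v + helmholtz k y w v"
  proof (cases "v \<in> H_space")
    case v: True
    have "(\<integral>x. (1 + potential y x) * (u x + w x) * cnj (v x) \<partial>M2) =
      (\<integral>x. (1 + potential y x) * u x * cnj (v x) \<partial>M2) + (\<integral>x. (1 + potential y x) * w x * cnj (v x) \<partial>M2)"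
      using u v w integrable_potential by (simp add: distrib_right distrib_left)
    then show ?thesis
      using u v w by (simp add: helmholtz_eq_H_inner H_add H_inner_add_left algebra_simps)
  qed (simp add: helmholtz_outside)
next
  fix c u v assume u: "u \<in> H_space"
  show "helmholtz k y (\<lambda>x. c * u x) v = c * helmholtz k y u v"
  proof (cases "v \<in> H_space")
    case v: True
    have "(\<integral>x. (1 + potential y x) * (c * u x) * cnj (v x) \<partial>M2) =
      c * (\<integral>x. (1 + potential y x) * u x * cnj (v x) \<partial>M2)"
      by (simp add: mult_ac flip: integral_mult_right_zero)
    then show ?thesis
      using u v by (simp add: helmholtz_eq_H_inner H_scale H_inner_scale_left algebra_simps)
  qed (simp add: helmholtz_outside)
qed

lemma mass_cnj_commute:
  "u \<in> H_space \<Longrightarrow> v \<in> H_space \<Longrightarrow> mass u (\<lambda>x. cnj (v x)) = mass v (\<lambda>x. cnj (u x))"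
  by (simp add: mass_def H_cnj mult_ac)

text \<open>With a conjugated test function the form becomes bilinear, and all three of its terms
  are symmetric. This is used for injectivity in \<open>has_bounded_inverse_symmetric\<close> and
  for the vanishing residual in \<open>inverse_shifted\<close>.\<close>

lemma helmholtz_cnj_commute:
  assumes u: "u \<in> H_space" and v: "v \<in> H_space"
  shows "helmholtz k y u (\<lambda>x. cnj (v x)) = helmholtz k y v (\<lambda>x. cnj (u x))"
proof -
  have 1: "(\<integral>x. weak_deriv u x * cnj (weak_deriv (\<lambda>x. cnj (v x)) x) \<partial>M2) = (\<integral>x. weak_deriv u x * weak_deriv v x \<partial>M2)"
    if u: "u \<in> H_space" and v: "v \<in> H_space" for u v
  proof (rule integral_cong_AE)
    show "AE x in M2. weak_deriv u x * cnj (weak_deriv (\<lambda>x. cnj (v x)) x) = weak_deriv u x * weak_deriv v x"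
      using weak_deriv_cnj[OF v] by (rule eventually_mono) simp
    show "(\<lambda>x. weak_deriv u x * cnj (weak_deriv (\<lambda>x. cnj (v x)) x)) \<in> borel_measurable M2"
      by (rule borel_measurable_integrable) (intro integrable_H(2) H_cnj u v)
    show "(\<lambda>x. weak_deriv u x * weak_deriv v x) \<in> borel_measurable M2"
      by (rule borel_measurable_integrable) (intro square_integrable_prod square_integrable_weak_deriv u v)
  qed
  show ?thesis
    using u v by (simp add: helmholtz_eq H_cnj 1 mult_ac)
qed

text \<open>A piecewise C2 solution enters H as \<open>primitive W1\<close>, which equals
  \<open>W\<close> on \<open>[0,2]\<close> and 0 elsewhere. Integration by parts leaves a term at 2
  only, since \<open>v 0 = 0\<close>. In the norm bound each of the two squared terms is at most
  \<open>2 * C^2\<close> because the interval has length 2.\<close>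

lemma classical_weak_form:
  fixes W W1 q :: fn
  assumes W: "continuous_on {0..2} W" and W1: "continuous_on {0..2} W1" and "finite S"
    and d: "\<And>x. x \<in> {0<..<2} - S \<Longrightarrow> (W has_vector_derivative W1 x) (at x)"
    and d1: "\<And>x. x \<in> {0<..<2} - S \<Longrightarrow> (W1 has_vector_derivative q x) (at x)"
    and q: "integrable M2 q" and W0: "W 0 = 0"
  shows "primitive W1 \<in> H_space" and "x \<in> {0..2} \<Longrightarrow> primitive W1 x = W x"
    and "v \<in> H_space \<Longrightarrow> (\<integral>x. weak_deriv (primitive W1) x * cnj (weak_deriv v x) \<partial>M2)
      = W1 2 * cnj (v 2) - (\<integral>x. q x * cnj (v x) \<partial>M2)"
    and "\<lbrakk>\<And>x. x \<in> {0..2} \<Longrightarrow> cmod (W x) \<le> C; \<And>x. x \<in> {0..2} \<Longrightarrow> cmod (W1 x) \<le> k * C; k > 0; 0 \<le> C\<rbrakk>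
      \<Longrightarrow> H_norm k (primitive W1) \<le> 2 * C"
proof -
  note sq = square_integrable_continuous[OF W1]
  show H: "primitive W1 \<in> H_space" using sq by blast
  show eq: "primitive W1 x = W x" if "x \<in> {0..2}" for x
    using primitive_FTC[OF W \<open>finite S\<close> d square_integrable_integrable[OF sq] that] W0 by simp
  have wd: "AE x in M2. weak_deriv (primitive W1) x = W1 x" by (rule weak_deriv_primitive_AE[OF sq])
  show "(\<integral>x. weak_deriv (primitive W1) x * cnj (weak_deriv v x) \<partial>M2)
      = W1 2 * cnj (v 2) - (\<integral>x. q x * cnj (v x) \<partial>M2)" if v: "v \<in> H_space"
  proof -
    have g: "square_integrable (\<lambda>x. cnj (weak_deriv v x))"
      by (intro square_integrable_cnj square_integrable_weak_deriv v)
    have "(\<integral>x. weak_deriv (primitive W1) x * cnj (weak_deriv v x) \<partial>M2) = (\<integral>x. W1 x * cnj (weak_deriv v x) \<partial>M2)"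
      by (rule integral_weak_deriv_cong[OF wd sq H g])
    moreover have "(\<integral>x. q x * primitive (\<lambda>x. cnj (weak_deriv v x)) x \<partial>M2)
      = W1 2 * primitive (\<lambda>x. cnj (weak_deriv v x)) 2 - (\<integral>x. cnj (weak_deriv v x) * W1 x \<partial>M2)"
      by (rule integral_by_parts[OF W1 \<open>finite S\<close> d1 q g])
    ultimately show ?thesis by (simp add: primitive_cnj primitive_weak_deriv v mult.commute)
  qed
  assume C: "\<And>x. x \<in> {0..2} \<Longrightarrow> cmod (W x) \<le> C" and C1: "\<And>x. x \<in> {0..2} \<Longrightarrow> cmod (W1 x) \<le> k * C"
    and k: "k > 0" and C0: "0 \<le> C"
  have m: "measure M2 {0<..<2} = 2" by (simp add: measure_restrict_space)
  interpret finite_measure M2 by (rule finite_measure_M2)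
  have bound: "(\<integral>x. (cmod (f x))\<^sup>2 \<partial>M2) \<le> 2 * B\<^sup>2" if "square_integrable f" "\<And>x. x \<in> {0..2} \<Longrightarrow> cmod (f x) \<le> B" for f B
  proof -
    have "(\<integral>x. (cmod (f x))\<^sup>2 \<partial>M2) \<le> (\<integral>x. B\<^sup>2 \<partial>M2)"
      using that by (intro integral_mono) (auto simp: square_integrable_iff intro!: power_mono)
    then show ?thesis by (simp add: m)
  qed
  have "(\<integral>x. (cmod (weak_deriv (primitive W1) x))\<^sup>2 \<partial>M2) = (\<integral>x. (cmod (W1 x))\<^sup>2 \<partial>M2)"
    using wd sq square_integrable_weak_deriv[OF H]
    by (intro integral_cong_AE) (auto simp: square_integrable_iff elim: eventually_mono)
  also have "\<dots> \<le> 2 * (k * C)\<^sup>2" using C1 by (intro bound sq)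
  finally have 1: "(\<integral>x. (cmod (weak_deriv (primitive W1) x))\<^sup>2 \<partial>M2) / k\<^sup>2 \<le> 2 * C\<^sup>2"
    using k by (simp add: field_simps)
  have 2: "(\<integral>x. (cmod (primitive W1 x))\<^sup>2 \<partial>M2) \<le> 2 * C\<^sup>2"
    using C eq by (intro bound H_square_integrable H) auto
  have "(H_norm k (primitive W1))\<^sup>2 \<le> (2 * C)\<^sup>2" unfolding H_norm_power2 using 1 2 by (simp add: power_mult_distrib)
  then show "H_norm k (primitive W1) \<le> 2 * C" by (rule power2_le_imp_le) (use C0 in simp)
qed

section \<open>Variation of constants in the layered medium\<close>

lemma isCont_indicator_ne:
  assumes "x \<noteq> 0" "x \<noteq> 1" shows "isCont (indicator {0..1} :: fn) (x::real)"
proof (cases "x \<in> {0<..<1}")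
  case True
  show ?thesis
    by (rule isCont_cong[THEN iffD1, OF _ continuous_const[of _ 1]])
      (use eventually_nhds_in_open[OF _ True] in \<open>auto elim!: eventually_mono simp: indicator_def\<close>)
next
  case False
  then have "x \<in> - {0..1}" using assms by auto
  from eventually_nhds_in_open[OF _ this] show ?thesis
    by (intro isCont_cong[THEN iffD1, OF _ continuous_const[of _ 0]])
      (auto elim!: eventually_mono simp: indicator_def)
qed

lemma primitive_has_vector_derivative:
  assumes g: "integrable M2 g" and x: "x \<in> {0<..<2}" and c: "isCont g x"
  shows "(primitive g has_vector_derivative g x) (at x)"
proof -
  let ?g = "\<lambda>t. indicator {0<..<2} t * g t"
  have "isCont ?g x"
  proof (rule isCont_cong[THEN iffD1, OF _ c])
    show "\<forall>\<^sub>F t in nhds x. g t = ?g t"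
      using eventually_nhds_in_open[of "{0<..<2}" x] x by (auto elim!: eventually_mono simp: indicator_def)
  qed
  then have "((\<lambda>u. integral {0..u} ?g) has_vector_derivative ?g x) (at x within {0..2})"
    using integral_has_vector_derivative_continuous_at[OF primitive_HK(1)[OF g], of x "{}"] x
    by (simp add: continuous_at_imp_continuous_at_within)
  moreover have "at x within {0..2} = at x" using x by (intro at_within_interior) auto
  ultimately have d: "((\<lambda>u. integral {0..u} ?g) has_vector_derivative g x) (at x)" using x by simp
  show ?thesis
    by (rule has_vector_derivative_transform_within_open[OF d, of "{0<..<2}"])
      (use x primitive_HK(2)[OF g] in auto)
qed

text \<open>Parametrised by the inner refractive index \<kappa> instead of
  \<open>y = 1/2 - \<kappa>^2\<close>, so that no branch of the square root has to be chosen. It is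
  instantiated at \<open>\<kappa> = 1 / sqrt 2\<close>, where \<open>y = 0\<close>, and at the
  resonance.\<close>

locale layered_medium =
  fixes k :: real and \<kappa> :: complex
  assumes k: "k > 0" and \<kappa>: "\<kappa> \<noteq> 0"
begin

definition K :: complex where "K = of_real k * \<kappa>"

abbreviation y :: complex where "y \<equiv> 1/2 - \<kappa>\<^sup>2"

lemma K_ne: "K \<noteq> 0" using k \<kappa> by (simp add: K_def)

text \<open>The continuously differentiable solution of \<open>U'' + k\<^sup>2 c U = 0\<close> with \<open>U 0 = b\<close> and
  \<open>U' 0 = K a\<close>, where \<open>c\<close> is the piecewise constant potential, together with its derivative \<open>V\<close>.\<close>

definition U :: "complex \<Rightarrow> complex \<Rightarrow> fn" where
  "U a b x = (if x \<le> 1 then a * sin (K * of_real x) + b * cos (K * of_real x)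
    else (a * sin K + b * cos K) * cos (of_real k * (of_real x - 1))
       + \<kappa> * (a * cos K - b * sin K) * sin (of_real k * (of_real x - 1)))"

definition V :: "complex \<Rightarrow> complex \<Rightarrow> fn" where
  "V a b x = (if x \<le> 1 then K * (a * cos (K * of_real x) - b * sin (K * of_real x))
    else of_real k * (\<kappa> * (a * cos K - b * sin K) * cos (of_real k * (of_real x - 1))
       - (a * sin K + b * cos K) * sin (of_real k * (of_real x - 1))))"

lemma potential_y: "x \<in> {0..2} \<Longrightarrow> potential y x = (if x \<le> 1 then \<kappa>\<^sup>2 else 1)"
  by (auto simp: potential_def indicator_def)

lemma continuous_UV: "continuous_on {0..2} (U a b)" "continuous_on {0..2} (V a b)"
  unfolding U_def[abs_def] V_def[abs_def]
  by (intro continuous_on_cases_le continuous_intros; simp add: K_def)+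

lemma has_vector_derivative_UV:
  assumes x: "x \<in> {0<..<2} - {1}"
  shows "(U a b has_vector_derivative V a b x) (at x)"
    and "(V a b has_vector_derivative - (of_real k)\<^sup>2 * potential y x * U a b x) (at x)"
proof -
  consider "x \<in> {..<1}" | "x \<in> {1<..}" using x by force
  then have "(U a b has_vector_derivative V a b x) (at x) \<and>
    (V a b has_vector_derivative - (of_real k)\<^sup>2 * potential y x * U a b x) (at x)"
  proof cases
    case 1
    have "((\<lambda>x. a * sin (K * of_real x) + b * cos (K * of_real x)) has_vector_derivative
        K * (a * cos (K * of_real x) - b * sin (K * of_real x))) (at x)"
      by (rule has_vector_derivative_real_field, (rule derivative_eq_intros refl)+) (simp add: algebra_simps)
    moreover have "((\<lambda>x. K * (a * cos (K * of_real x) - b * sin (K * of_real x))) has_vector_derivative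
        - (of_real k)\<^sup>2 * \<kappa>\<^sup>2 * (a * sin (K * of_real x) + b * cos (K * of_real x))) (at x)"
      by (rule has_vector_derivative_real_field, (rule derivative_eq_intros refl)+)
        (simp add: algebra_simps K_def power2_eq_square)
    ultimately have "(U a b has_vector_derivative K * (a * cos (K * of_real x) - b * sin (K * of_real x))) (at x)"
      "(V a b has_vector_derivative
        - (of_real k)\<^sup>2 * \<kappa>\<^sup>2 * (a * sin (K * of_real x) + b * cos (K * of_real x))) (at x)"
      using 1 by (auto elim!: has_vector_derivative_transform_within_open[of _ _ _ "{..<1}"] simp: U_def V_def)
    then show ?thesis using x 1 by (simp add: U_def V_def potential_y)
  next
    case 2
    have d1: "((\<lambda>x. A * cos (of_real k * (of_real x - 1)) + B * sin (of_real k * (of_real x - 1))) has_vector_derivative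
        of_real k * (B * cos (of_real k * (of_real x - 1)) - A * sin (of_real k * (of_real x - 1)))) (at x)" for A B :: complex
      by (rule has_vector_derivative_real_field, (rule derivative_eq_intros refl)+) (simp add: algebra_simps)
    have d2: "((\<lambda>x. of_real k * (B * cos (of_real k * (of_real x - 1)) - A * sin (of_real k * (of_real x - 1)))) has_vector_derivative
        - (of_real k)\<^sup>2 * 1 * (A * cos (of_real k * (of_real x - 1)) + B * sin (of_real k * (of_real x - 1)))) (at x)" for A B :: complex
      by (rule has_vector_derivative_real_field, (rule derivative_eq_intros refl)+)
        (simp add: algebra_simps power2_eq_square)
    from d1[of "a * sin K + b * cos K" "\<kappa> * (a * cos K - b * sin K)"]
      d2[of "\<kappa> * (a * cos K - b * sin K)" "a * sin K + b * cos K"]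
    have "(U a b has_vector_derivative V a b x) (at x)"
      "(V a b has_vector_derivative - (of_real k)\<^sup>2 * 1 * U a b x) (at x)"
      using 2 by (auto elim!: has_vector_derivative_transform_within_open[of _ _ _ "{1<..}"] simp: U_def V_def)
    then show ?thesis using x 2 by (simp add: potential_y)
  qed
  then show "(U a b has_vector_derivative V a b x) (at x)"
    and "(V a b has_vector_derivative - (of_real k)\<^sup>2 * potential y x * U a b x) (at x)" by auto
qed

text \<open>In the outer layer this is \<open>K\<close> times a product of two Pythagorean
  identities. Being nonzero, it serves both variation of constants and
  \<open>mode_2_ne\<close>.\<close>

lemma Wronskian:
  shows "V 1 0 x * U 0 1 x - V 0 1 x * U 1 0 x = K"
proof (cases "x \<le> 1")
  case True
  have "K * cos z * cos z - - K * sin z * sin z = K" for z :: complex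
    using sin_cos_squared_add[of z] by (metis (no_types, lifting) add.commute diff_minus_eq_add mult.assoc mult_minus_left
      mult.right_neutral power2_eq_square ring_class.ring_distribs(1))
  then show ?thesis using True by (simp add: U_def V_def)
next
  case False
  have "of_real k * (\<kappa> * c * C - s * S) * (c * C + \<kappa> * - s * S) - of_real k * (\<kappa> * - s * C - c * S) * (s * C + \<kappa> * c * S)
    = of_real k * \<kappa> * ((s\<^sup>2 + c\<^sup>2) * (S\<^sup>2 + C\<^sup>2))" for s c S C :: complex
    by (simp add: power2_eq_square algebra_simps)
  from this[of "cos K" "cos (of_real k * (of_real x - 1))" "sin K" "sin (of_real k * (of_real x - 1))"]
  show ?thesis using False by (simp add: U_def V_def K_def)
qed

text \<open>The source for which \<open>W + z\<close> solves the Helmholtz problem with data \<open>z\<close>. The solution \<open>W\<close> comes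
  from variation of constants, and \<open>W1\<close> is its derivative.\<close>

definition source :: "fn \<Rightarrow> fn" where
  "source z x = - (of_real k)\<^sup>2 * (1 + potential y x) * z x"

definition W :: "fn \<Rightarrow> fn" where
  "W z x = (U 1 0 x * primitive (\<lambda>t. U 0 1 t * source z t) x - U 0 1 x * primitive (\<lambda>t. U 1 0 t * source z t) x) / K"

definition W1 :: "fn \<Rightarrow> fn" where
  "W1 z x = (V 1 0 x * primitive (\<lambda>t. U 0 1 t * source z t) x - V 0 1 x * primitive (\<lambda>t. U 1 0 t * source z t) x) / K"

lemma square_integrable_source:
  assumes "z \<in> H_space" shows "square_integrable (source z)"
proof -
  have "square_integrable (\<lambda>x. (- (of_real k)\<^sup>2) * (z x + potential y x * z x))"
    using H_square_integrable[OF assms]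
    by (intro square_integrable_scale square_integrable_add square_integrable_potential)
  then show ?thesis by (simp add: source_def[abs_def] algebra_simps)
qed

lemma integrable_U_source:
  assumes "z \<in> H_space" shows "integrable M2 (\<lambda>t. U a b t * source z t)"
  by (intro square_integrable_prod square_integrable_continuous continuous_UV square_integrable_source assms)

lemma isCont_U_source:
  assumes z: "z \<in> H_space" and x: "x \<in> {0<..<2} - {1}"
  shows "isCont (\<lambda>t. U a b t * source z t) x"
proof -
  have in02: "isCont f x" if "continuous_on {0..2} f" for f :: fn
    using that x by (intro continuous_on_interior[of "{0..2}"]) auto
  have "isCont (indicator {0..1} :: fn) x" using x by (intro isCont_indicator_ne) auto
  then show ?thesis
    unfolding source_def potential_def
    by (intro continuous_intros in02[OF continuous_UV(1)] in02[OF H_continuous[OF z]])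
qed

lemma W_solves:
  assumes z: "z \<in> H_space"
  shows "continuous_on {0..2} (W z)" and "continuous_on {0..2} (W1 z)" and "W z 0 = 0"
    and "x \<in> {0<..<2} - {1} \<Longrightarrow> (W z has_vector_derivative W1 z x) (at x)"
    and "x \<in> {0<..<2} - {1} \<Longrightarrow> (W1 z has_vector_derivative
        - (of_real k)\<^sup>2 * potential y x * W z x + source z x) (at x)"
proof -
  show "continuous_on {0..2} (W z)" "continuous_on {0..2} (W1 z)"
    unfolding W_def[abs_def] W1_def[abs_def]
    by (intro continuous_intros continuous_UV primitive_continuous integrable_U_source z; simp add: K_ne)+
  show "W z 0 = 0" by (simp add: W_def)
  assume x: "x \<in> {0<..<2} - {1}"
  have P: "(primitive (\<lambda>t. U a b t * source z t) has_vector_derivative U a b x * source z x) (at x)" for a b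
    using x by (intro primitive_has_vector_derivative integrable_U_source isCont_U_source z) auto
  note d = has_vector_derivative_UV[OF x]
  have "(W z has_vector_derivative ((U 1 0 x * (U 0 1 x * source z x) + V 1 0 x * primitive (\<lambda>t. U 0 1 t * source z t) x)
     - (U 0 1 x * (U 1 0 x * source z x) + V 0 1 x * primitive (\<lambda>t. U 1 0 t * source z t) x)) / K) (at x)"
    unfolding W_def[abs_def] by (intro has_vector_derivative_divide has_vector_derivative_diff has_vector_derivative_mult d P)
  then show "(W z has_vector_derivative W1 z x) (at x)" by (simp add: W1_def algebra_simps)
  let ?q = "- (of_real k)\<^sup>2 * potential y x"
  have dW1: "(W1 z has_vector_derivative ((V 1 0 x * (U 0 1 x * source z x) + ?q * U 1 0 x * primitive (\<lambda>t. U 0 1 t * source z t) x)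
     - (V 0 1 x * (U 1 0 x * source z x) + ?q * U 0 1 x * primitive (\<lambda>t. U 1 0 t * source z t) x)) / K) (at x)"
    unfolding W1_def[abs_def] by (intro has_vector_derivative_divide has_vector_derivative_diff has_vector_derivative_mult d P)
  \<comment> \<open>The coefficient of the source collapses to the Wronskian, so division by
    \<open>K\<close> leaves the source alone.\<close>
  have alg: "((v1 * (u0 * s) + q * u1 * A) - (v0 * (u1 * s) + q * u0 * B)) / K = q * ((u1 * A - u0 * B) / K) + s"
    if "v1 * u0 - v0 * u1 = K" for v1 v0 u1 u0 q s A B
  proof -
    have "((v1 * (u0 * s) + q * u1 * A) - (v0 * (u1 * s) + q * u0 * B)) = q * (u1 * A - u0 * B) + (v1 * u0 - v0 * u1) * s"
      by (simp add: algebra_simps)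
    then show ?thesis using K_ne that by (simp add: add_divide_distrib)
  qed
  from dW1 show "(W1 z has_vector_derivative ?q * W z x + source z x) (at x)"
    unfolding W_def alg[OF Wronskian] .
qed

text \<open>Each primitive is at most \<open>J\<close>, with \<open>k\<^sup>2\<close> from the
  source and a root of 2 from comparing L1 with L2. Two such terms over
  \<open>K = k \<kappa>\<close> give the factor \<open>2 * sqrt 2 \<le> 3\<close> and leave one
  power of \<open>k\<close>.\<close>

lemma norm_W_le:
  assumes z: "z \<in> H_space" and N: "\<And>x. x \<in> {0..2} \<Longrightarrow> cmod (U 1 0 x) \<le> N" "\<And>x. x \<in> {0..2} \<Longrightarrow> cmod (U 0 1 x) \<le> N"
    and N1: "\<And>x. x \<in> {0..2} \<Longrightarrow> cmod (V 1 0 x) \<le> k * N" "\<And>x. x \<in> {0..2} \<Longrightarrow> cmod (V 0 1 x) \<le> k * N"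
    and P: "\<And>x. x \<in> {0..2} \<Longrightarrow> cmod (1 + potential y x) \<le> P"
    and x: "x \<in> {0..2}"
  defines "Q \<equiv> 3 * k * N\<^sup>2 * P / cmod \<kappa>"
  shows "cmod (W z x) \<le> Q * H_norm k z" and "cmod (W1 z x) \<le> k * (Q * H_norm k z)" and "0 \<le> Q"
proof -
  have N0: "0 \<le> N" using order_trans[OF norm_ge_zero N(1)[of 0]] by simp
  have P0: "0 \<le> P" using order_trans[OF norm_ge_zero P[of 0]] by simp
  show "0 \<le> Q" using N0 P0 k by (simp add: Q_def)
  have h: "cmod (source z t) \<le> k\<^sup>2 * P * cmod (z t)" if "t \<in> {0..2}" for t
    using P[OF that] k by (simp add: source_def norm_mult norm_power mult_right_mono mult_left_mono)
  have zi: "integrable M2 z" by (intro square_integrable_integrable H_square_integrable z)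
  have z1: "(\<integral>t. cmod (z t) \<partial>M2) \<le> sqrt 2 * H_norm k z"
  proof -
    have "(\<integral>t. cmod (z t) \<partial>M2) \<le> sqrt (2 * (\<integral>t. (cmod (z t))\<^sup>2 \<partial>M2))"
      by (rule integral_norm_le_L2[OF H_square_integrable[OF z]])
    also have "\<dots> \<le> sqrt (2 * (H_norm k z)\<^sup>2)" using integral_le_H_norm by simp
    finally show ?thesis by (simp add: real_sqrt_mult)
  qed
  define J where "J = N * (k\<^sup>2 * P * (sqrt 2 * H_norm k z))"
  have prim: "cmod (primitive (\<lambda>t. U a b t * source z t) x) \<le> J"
    if U: "\<And>t. t \<in> {0..2} \<Longrightarrow> cmod (U a b t) \<le> N" for a b
  proof -
    note i = integrable_U_source[OF z, of a b]
    have "cmod (primitive (\<lambda>t. U a b t * source z t) x)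
        = cmod (\<integral>t. indicator {..x} t * (U a b t * source z t) \<partial>M2)"
      using x by (simp add: primitive_def)
    also have "\<dots> \<le> (\<integral>t. N * (k\<^sup>2 * P * cmod (z t)) \<partial>M2)"
    proof (rule order_trans[OF integral_norm_bound], rule integral_mono)
      show "integrable M2 (\<lambda>t. cmod (indicator {..x} t * (U a b t * source z t)))"
        by (intro integrable_norm integrable_indicator_M2 i)
      show "integrable M2 (\<lambda>t. N * (k\<^sup>2 * P * cmod (z t)))" using zi by simp
      fix t assume "t \<in> space M2"
      then have t: "t \<in> {0..2}" by simp
      have "cmod (indicator {..x} t * (U a b t * source z t)) \<le> cmod (U a b t) * cmod (source z t)"
        by (auto simp: indicator_def norm_mult)
      also have "\<dots> \<le> N * (k\<^sup>2 * P * cmod (z t))"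
        using U[OF t] h[OF t] N0 by (intro mult_mono) auto
      finally show "cmod (indicator {..x} t * (U a b t * source z t)) \<le> N * (k\<^sup>2 * P * cmod (z t))" .
    qed
    also have "\<dots> = N * (k\<^sup>2 * P * (\<integral>t. cmod (z t) \<partial>M2))" by simp
    also have "\<dots> \<le> J" unfolding J_def using N0 P0 by (intro mult_left_mono z1) auto
    finally show ?thesis .
  qed
  have J0: "0 \<le> J" using N0 P0 by (simp add: J_def)
  have comb: "cmod ((a * p - b * q) / K) \<le> 2 * B * J / cmod K"
    if "cmod a \<le> B" "cmod b \<le> B" "cmod p \<le> J" "cmod q \<le> J" for a b p q B
  proof -
    have B0: "0 \<le> B" using order_trans[OF norm_ge_zero that(1)] .
    have "cmod (a * p - b * q) \<le> cmod a * cmod p + cmod b * cmod q"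
      using norm_triangle_ineq4[of "a * p" "b * q"] by (simp add: norm_mult)
    also have "\<dots> \<le> B * J + B * J" using that B0 by (intro add_mono mult_mono) auto
    finally show ?thesis by (simp add: norm_divide divide_right_mono)
  qed
  have s2: "2 * sqrt 2 \<le> (3::real)" by (rule power2_le_imp_le) (simp_all add: power_mult_distrib)
  have Qb: "2 * N * J / cmod K \<le> Q * H_norm k z"
  proof -
    have "2 * N * J / cmod K = (2 * sqrt 2) * (k * N\<^sup>2 * P / cmod \<kappa> * H_norm k z)"
      using k \<kappa> by (simp add: J_def K_def norm_mult field_simps power2_eq_square)
    also have "\<dots> \<le> 3 * (k * N\<^sup>2 * P / cmod \<kappa> * H_norm k z)"
      using s2 k P0 by (intro mult_right_mono) auto
    finally show ?thesis by (simp add: Q_def mult_ac)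
  qed
  show "cmod (W z x) \<le> Q * H_norm k z"
    unfolding W_def by (rule order_trans[OF comb[OF N(1)[OF x] N(2)[OF x] prim[OF N(2)] prim[OF N(1)]] Qb])
  have "cmod (W1 z x) \<le> 2 * (k * N) * J / cmod K"
    unfolding W1_def by (rule comb[OF N1(1)[OF x] N1(2)[OF x] prim[OF N(2)] prim[OF N(1)]])
  also have "\<dots> = k * (2 * N * J / cmod K)" by simp
  also have "\<dots> \<le> k * (Q * H_norm k z)" using k by (intro mult_left_mono Qb) auto
  finally show "cmod (W1 z x) \<le> k * (Q * H_norm k z)" .
qed

end

definition inner_functional :: "real \<Rightarrow> fn \<Rightarrow> functional" where
  "inner_functional k z = (\<lambda>v. if v \<in> H_space then H_inner k z v else 0)"

lemma inner_functional_H_dual: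
  assumes "z \<in> H_space" shows "inner_functional k z \<in> H_dual k"
proof (rule H_dualI)
  show "cmod (inner_functional k z v) \<le> H_norm k z * H_norm k v" if "v \<in> H_space" for v
    using norm_H_inner_le[OF assms that] that by (simp add: inner_functional_def)
qed (use assms in \<open>auto simp: inner_functional_def H_add H_scale H_inner_add_right H_inner_scale_right\<close>)

text \<open>For \<open>d\<close> in the kernel, solve \<open>L v\<close> = inner product with the
  conjugate of \<open>d\<close>. Evaluating at that conjugate and using symmetry gives the squared
  norm of \<open>d\<close> as \<open>L d\<close> at the conjugate of \<open>v\<close>, which is 0.
  Hence producing one bounded solution for every functional is enough.\<close>

lemma has_bounded_inverse_symmetric:
  assumes L: "linear_to_dual k L" and k: "k > 0"
    and sym: "\<And>u v. u \<in> H_space \<Longrightarrow> v \<in> H_space \<Longrightarrow> L u (\<lambda>x. cnj (v x)) = L v (\<lambda>x. cnj (u x))"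
    and surj: "\<And>F. F \<in> H_dual k \<Longrightarrow> \<exists>u\<in>H_space. L u = F \<and> H_norm k u \<le> M * dual_norm k F"
  shows "has_bounded_inverse k L M"
proof (rule has_bounded_inverseI[OF L k])
  fix u assume u: "u \<in> H_space"
  from surj[OF linear_to_dual_H_dual[OF L u]] obtain u' where u': "u' \<in> H_space" "L u' = L u"
    and le: "H_norm k u' \<le> M * dual_norm k (L u)" by blast
  define d where "d = (\<lambda>x. u x - u' x)"
  have d: "d \<in> H_space" unfolding d_def using u u' by (intro H_diff)
  define dc where "dc = (\<lambda>x. cnj (d x))"
  have dc: "dc \<in> H_space" unfolding dc_def using d by (intro H_cnj)
  have Ld: "L d = (\<lambda>w. 0)" unfolding d_def linear_to_dual_diff[OF L u u'(1)] u'(2) by simp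
  obtain v where v: "v \<in> H_space" "L v = inner_functional k dc"
    using surj[OF inner_functional_H_dual[OF dc]] by blast
  have "H_inner k dc dc = L v dc" using v dc by (simp add: inner_functional_def)
  also have "\<dots> = L d (\<lambda>x. cnj (v x))" unfolding dc_def by (rule sym[OF v(1) d])
  finally have "H_norm k dc = 0" by (simp add: Ld H_inner_self)
  from H_norm_eq_0[OF dc k this] have "u = u'" by (simp add: dc_def d_def fun_eq_iff)
  then show "H_norm k u \<le> M * dual_norm k (L u)" using le by simp
qed (use surj in blast)

lemma helmholtz_invertibleI:
  assumes "k > 0" "has_bounded_inverse k (helmholtz k y) M"
  shows "helmholtz_invertible k y"
  using inverse_bounded_ops[OF linear_to_dual_helmholtz[OF assms(1)] assms(2)] assms(2)
  by (simp add: helmholtz_invertible_def helmholtz_inv_def has_bounded_inverse_def)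

lemma H_dual_eqI:
  assumes "F \<in> H_dual k" "\<And>v. v \<in> H_space \<Longrightarrow> f v = F v" "\<And>v. v \<notin> H_space \<Longrightarrow> f v = 0"
  shows "f = F"
proof
  show "f v = F v" for v using assms by (cases "v \<in> H_space") (simp_all add: H_dual_def)
qed

section \<open>Explicit solutions: particular solution, mode, and correction of the boundary
  residual\<close>

context layered_medium
begin

definition particular :: "fn \<Rightarrow> fn" where
  "particular z = (\<lambda>x. primitive (W1 z) x + z x)"

text \<open>The amount by which \<open>particular z\<close> misses the outgoing condition, scaled as
  it multiplies \<open>cnj (v 2)\<close> in the weak form.\<close>

definition residual :: "fn \<Rightarrow> complex" where
  "residual z = (W1 z 2 - \<i> * of_real k * (W z 2 + z 2)) / (of_real k)\<^sup>2"

lemma W_weak: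
  assumes z: "z \<in> H_space"
  shows "primitive (W1 z) \<in> H_space" and "x \<in> {0..2} \<Longrightarrow> primitive (W1 z) x = W z x"
    and "v \<in> H_space \<Longrightarrow> (\<integral>x. weak_deriv (primitive (W1 z)) x * cnj (weak_deriv v x) \<partial>M2)
      = W1 z 2 * cnj (v 2) - (\<integral>x. (- (of_real k)\<^sup>2 * potential y x * W z x + source z x) * cnj (v x) \<partial>M2)"
    and "\<lbrakk>\<And>x. x \<in> {0..2} \<Longrightarrow> cmod (W z x) \<le> C; \<And>x. x \<in> {0..2} \<Longrightarrow> cmod (W1 z x) \<le> k * C; 0 \<le> C\<rbrakk>
      \<Longrightarrow> H_norm k (primitive (W1 z)) \<le> 2 * C"
proof -
  note s = W_solves[OF z]
  have "square_integrable (\<lambda>x. - (of_real k)\<^sup>2 * (potential y x * W z x) + source z x)"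
    by (intro square_integrable_add square_integrable_scale square_integrable_potential
        square_integrable_continuous s square_integrable_source z)
  then have q: "integrable M2 (\<lambda>x. - (of_real k)\<^sup>2 * potential y x * W z x + source z x)"
    by (intro square_integrable_integrable) (simp add: mult.assoc)
  note c = classical_weak_form[OF s(1,2) finite.insertI[OF finite.emptyI] s(4,5) q s(3)]
  show "primitive (W1 z) \<in> H_space" by (rule c(1))
  show "primitive (W1 z) x = W z x" if "x \<in> {0..2}" by (rule c(2)[OF _ _ that])
  show "(\<integral>x. weak_deriv (primitive (W1 z)) x * cnj (weak_deriv v x) \<partial>M2)
      = W1 z 2 * cnj (v 2) - (\<integral>x. (- (of_real k)\<^sup>2 * potential y x * W z x + source z x) * cnj (v x) \<partial>M2)"
    if "v \<in> H_space" by (rule c(3)[OF _ _ that])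
  show "H_norm k (primitive (W1 z)) \<le> 2 * C"
    if "\<And>x. x \<in> {0..2} \<Longrightarrow> cmod (W z x) \<le> C" "\<And>x. x \<in> {0..2} \<Longrightarrow> cmod (W1 z x) \<le> k * C" "0 \<le> C"
    by (rule c(4)[OF _ _ that(1,2) k that(3)])
qed

lemma particular_H: "z \<in> H_space \<Longrightarrow> particular z \<in> H_space"
  unfolding particular_def by (intro H_add W_weak)

text \<open>By \<open>helmholtz_eq_H_inner\<close>, \<open>z\<close> yields its inner product minus
  a term with the factor \<open>1 + potential y\<close>. The source of \<open>W\<close> cancels
  exactly that term, and only boundary terms remain.\<close>

lemma helmholtz_particular:
  assumes z: "z \<in> H_space" and v: "v \<in> H_space"
  shows "helmholtz k y (particular z) v = H_inner k z v + residual z * cnj (v 2)"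
proof -
  let ?w = "primitive (W1 z)"
  note w = W_weak(1)[OF z]
  have k2: "(complex_of_real k)\<^sup>2 \<noteq> 0" using k by simp
  have i1: "integrable M2 (\<lambda>x. potential y x * ?w x * cnj (v x))" by (rule integrable_potential[OF w v])
  have i2: "integrable M2 (\<lambda>x. (1 + potential y x) * z x * cnj (v x))"
    using integrable_H(1)[OF z v] integrable_potential[OF z v] by (simp add: distrib_right)
  have "(\<integral>x. (- (of_real k)\<^sup>2 * potential y x * W z x + source z x) * cnj (v x) \<partial>M2)
      = (\<integral>x. - (of_real k)\<^sup>2 * (potential y x * ?w x * cnj (v x) + (1 + potential y x) * z x * cnj (v x)) \<partial>M2)"
    by (intro Bochner_Integration.integral_cong) (auto simp: source_def W_weak(2)[OF z] algebra_simps)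
  also have "\<dots> = - (of_real k)\<^sup>2 * ((\<integral>x. potential y x * ?w x * cnj (v x) \<partial>M2)
      + (\<integral>x. (1 + potential y x) * z x * cnj (v x) \<partial>M2))"
    by (simp only: integral_mult_right_zero Bochner_Integration.integral_add[OF i1 i2])
  finally have "(\<integral>x. weak_deriv ?w x * cnj (weak_deriv v x) \<partial>M2) = W1 z 2 * cnj (v 2) + (of_real k)\<^sup>2 *
      ((\<integral>x. potential y x * ?w x * cnj (v x) \<partial>M2) + (\<integral>x. (1 + potential y x) * z x * cnj (v x) \<partial>M2))"
    using W_weak(3)[OF z v] by simp
  then have hw: "helmholtz k y ?w v = W1 z 2 * cnj (v 2) / (of_real k)\<^sup>2
      + (\<integral>x. (1 + potential y x) * z x * cnj (v x) \<partial>M2) - \<i> / of_real k * W z 2 * cnj (v 2)"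
    unfolding helmholtz_eq[OF w v] using k2 by (simp add: add_divide_distrib W_weak(2)[OF z])
  have "helmholtz k y (particular z) v = helmholtz k y ?w v + helmholtz k y z v"
    unfolding particular_def using linear_to_dual_add[OF linear_to_dual_helmholtz[OF k] w z] by simp
  also have "\<dots> = H_inner k z v + residual z * cnj (v 2)"
    unfolding hw helmholtz_eq_H_inner[OF z v] residual_def using k
    by (simp add: field_simps power2_eq_square)
  finally show ?thesis .
qed

text \<open>The solution with Dirichlet condition at 0, written as a primitive so that it vanishes
  off \<open>[0,2]\<close> as \<open>H_space\<close> demands.\<close>

definition mode :: fn where "mode = primitive (V 1 0)"

text \<open>The defect of the mode in the outgoing condition, scaled like \<open>residual\<close>;
  its zeros are the resonances.\<close>

definition discriminant :: complex where
  "discriminant = (V 1 0 2 - \<i> * of_real k * U 1 0 2) / (of_real k)\<^sup>2"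

lemma mode_H: "mode \<in> H_space"
  and mode_eq: "x \<in> {0..2} \<Longrightarrow> mode x = U 1 0 x"
  and helmholtz_mode: "v \<in> H_space \<Longrightarrow> helmholtz k y mode v = discriminant * cnj (v 2)"
  and norm_mode_le: "\<lbrakk>\<And>x. x \<in> {0..2} \<Longrightarrow> cmod (U 1 0 x) \<le> N; \<And>x. x \<in> {0..2} \<Longrightarrow> cmod (V 1 0 x) \<le> k * N; 0 \<le> N\<rbrakk>
      \<Longrightarrow> H_norm k mode \<le> 2 * N"
proof -
  have U0: "U 1 0 0 = 0" by (simp add: U_def)
  have "square_integrable (\<lambda>x. - (of_real k)\<^sup>2 * (potential y x * U 1 0 x))"
    by (intro square_integrable_scale square_integrable_potential square_integrable_continuous continuous_UV)
  then have q: "integrable M2 (\<lambda>x. - (of_real k)\<^sup>2 * potential y x * U 1 0 x)"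
    by (intro square_integrable_integrable) (simp add: mult.assoc)
  note c = classical_weak_form[OF continuous_UV finite.insertI[OF finite.emptyI, of 1] has_vector_derivative_UV q U0]
  show H: "mode \<in> H_space" unfolding mode_def by (rule c(1))
  show eq: "mode x = U 1 0 x" if "x \<in> {0..2}" for x unfolding mode_def by (rule c(2)[OF _ _ that])
  show "H_norm k mode \<le> 2 * N"
    if "\<And>x. x \<in> {0..2} \<Longrightarrow> cmod (U 1 0 x) \<le> N" "\<And>x. x \<in> {0..2} \<Longrightarrow> cmod (V 1 0 x) \<le> k * N" "0 \<le> N"
    unfolding mode_def by (rule c(4)[OF _ _ that(1,2) k that(3)])
  assume v: "v \<in> H_space"
  have "(\<integral>x. - (of_real k)\<^sup>2 * potential y x * U 1 0 x * cnj (v x) \<partial>M2)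
      = (\<integral>x. - (of_real k)\<^sup>2 * (potential y x * mode x * cnj (v x)) \<partial>M2)"
    by (intro Bochner_Integration.integral_cong) (auto simp: eq)
  also have "\<dots> = - (of_real k)\<^sup>2 * (\<integral>x. potential y x * mode x * cnj (v x) \<partial>M2)"
    by (rule integral_mult_right_zero)
  finally have "(\<integral>x. weak_deriv mode x * cnj (weak_deriv v x) \<partial>M2)
      = V 1 0 2 * cnj (v 2) + (of_real k)\<^sup>2 * (\<integral>x. potential y x * mode x * cnj (v x) \<partial>M2)"
    using c(3)[OF _ _ v] by (simp add: mode_def)
  then show "helmholtz k y mode v = discriminant * cnj (v 2)"
    unfolding helmholtz_eq[OF H v] using k
    by (simp add: eq discriminant_def field_simps power2_eq_square)
qed

text \<open>Propagation through the outer layer, of index 1, contributes only a phase of modulus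
  one; size and zeros are decided by the inner layer.\<close>

lemma discriminant_eq:
  "(of_real k)\<^sup>2 * discriminant = (K * cos K - \<i> * of_real k * sin K) * exp (- \<i> * of_real k)"
proof -
  have e: "exp (- \<i> * of_real k) = cos (of_real k) - \<i> * sin (of_real k)"
    using exp_Euler[of "- of_real k"] by (simp add: mult.commute)
  have "(of_real k)\<^sup>2 * discriminant = V 1 0 2 - \<i> * of_real k * U 1 0 2"
    using k by (simp add: discriminant_def)
  also have "\<dots> = (K * cos K - \<i> * of_real k * sin K) * (cos (of_real k) - \<i> * sin (of_real k))"
    by (simp add: U_def V_def K_def algebra_simps)
  finally show ?thesis unfolding e .
qed

lemma residual_le:
  assumes z: "z \<in> H_space" and Q: "0 \<le> Q" and "\<And>x. x \<in> {0..2} \<Longrightarrow> cmod (W z x) \<le> Q * H_norm k z"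
    and "\<And>x. x \<in> {0..2} \<Longrightarrow> cmod (W1 z x) \<le> k * (Q * H_norm k z)"
  shows "cmod (residual z) \<le> (2 * Q + 2 * k) / k * H_norm k z"
    and "H_norm k (particular z) \<le> (2 * Q + 1) * H_norm k z"
proof -
  have "cmod (W1 z 2 - \<i> * of_real k * (W z 2 + z 2)) \<le> cmod (W1 z 2) + k * (cmod (W z 2) + cmod (z 2))"
    using k norm_triangle_ineq[of "W z 2" "z 2"]
    by (intro norm_triangle_ineq4[THEN order_trans] add_mono) (auto simp: norm_mult)
  also have "\<dots> \<le> k * (Q * H_norm k z) + k * (Q * H_norm k z + 2 * k * H_norm k z)"
  proof (intro add_mono mult_left_mono)
    have "sqrt 2 * k * H_norm k z \<le> 2 * k * H_norm k z"
      using k by (intro mult_right_mono) (auto simp: real_le_lsqrt)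
    then show "cmod (z 2) \<le> 2 * k * H_norm k z" using norm_H_le[OF z k, of 2] by linarith
  qed (use assms k in auto)
  finally have "cmod (W1 z 2 - \<i> * of_real k * (W z 2 + z 2)) \<le> k * (2 * Q + 2 * k) * H_norm k z"
    by (simp add: algebra_simps)
  then have "cmod (residual z) \<le> k * (2 * Q + 2 * k) * H_norm k z / k\<^sup>2"
    using k by (simp add: residual_def norm_divide norm_power divide_right_mono)
  also have "\<dots> = (2 * Q + 2 * k) / k * H_norm k z" using k by (simp add: power2_eq_square)
  finally show "cmod (residual z) \<le> (2 * Q + 2 * k) / k * H_norm k z" .
  have "H_norm k (primitive (W1 z)) \<le> 2 * (Q * H_norm k z)"
    using assms by (intro W_weak(4)) auto
  then show "H_norm k (particular z) \<le> (2 * Q + 1) * H_norm k z"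
    unfolding particular_def using H_norm_triangle[OF W_weak(1)[OF z] z, of k] by (simp add: algebra_simps)
qed

text \<open>\<open>particular z\<close> solves the problem up to a boundary defect, and the mode
  carries a nonzero defect of the same kind. Adding \<open>- residual z / discriminant\<close> times
  the mode removes it, at the cost of a factor \<open>1 / cmod discriminant\<close> in the
  bound.\<close>

lemma inverse_nonresonant:
  assumes D: "discriminant \<noteq> 0"
    and N: "\<And>x. x \<in> {0..2} \<Longrightarrow> cmod (U 1 0 x) \<le> N" "\<And>x. x \<in> {0..2} \<Longrightarrow> cmod (U 0 1 x) \<le> N"
    and N1: "\<And>x. x \<in> {0..2} \<Longrightarrow> cmod (V 1 0 x) \<le> k * N" "\<And>x. x \<in> {0..2} \<Longrightarrow> cmod (V 0 1 x) \<le> k * N"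
    and P: "\<And>x. x \<in> {0..2} \<Longrightarrow> cmod (1 + potential y x) \<le> P"
  defines "Q \<equiv> 3 * k * N\<^sup>2 * P / cmod \<kappa>"
  shows "has_bounded_inverse k (helmholtz k y) (2 * Q + 1 + (2 * Q + 2 * k) / k / cmod discriminant * (2 * N))"
proof (rule has_bounded_inverse_symmetric[OF linear_to_dual_helmholtz[OF k] k helmholtz_cnj_commute])
  fix F assume F: "F \<in> H_dual k"
  obtain z where z: "z \<in> H_space" and Fz: "\<And>v. v \<in> H_space \<Longrightarrow> F v = H_inner k z v"
    and zF: "H_norm k z \<le> dual_norm k F" by (rule Riesz_representation[OF F k]) blast
  have N0: "0 \<le> N" using order_trans[OF norm_ge_zero N(1)[of 0]] by simp
  note W_le = norm_W_le[OF z N N1 P, folded Q_def]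
  have Q0: "0 \<le> Q" using W_le(3)[of 0] by simp
  note r = residual_le[OF z Q0 W_le(1,2)]
  let ?c = "- residual z / discriminant"
  let ?M = "2 * Q + 1 + (2 * Q + 2 * k) / k / cmod discriminant * (2 * N)"
  define u where "u = (\<lambda>x. particular z x + ?c * mode x)"
  have p: "particular z \<in> H_space" by (rule particular_H[OF z])
  have u: "u \<in> H_space" unfolding u_def by (intro H_add H_scale p mode_H)
  note lin = linear_to_dual_helmholtz[OF k, of y]
  have "helmholtz k y u = F"
  proof (rule H_dual_eqI[OF F])
    show "helmholtz k y u v = F v" if v: "v \<in> H_space" for v
      unfolding u_def linear_to_dual_add[OF lin p H_scale[OF mode_H]] linear_to_dual_scale[OF lin mode_H]
        helmholtz_particular[OF z v] helmholtz_mode[OF v] Fz[OF v] using D by simp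
  qed (rule helmholtz_outside)
  moreover have "H_norm k u \<le> ?M * dual_norm k F"
  proof -
    have "H_norm k u \<le> H_norm k (particular z) + cmod ?c * H_norm k mode"
      unfolding u_def using H_norm_triangle[OF p H_scale[OF mode_H, of ?c], of k] by (simp only: H_norm_scale[OF mode_H])
    also have "\<dots> \<le> (2 * Q + 1) * H_norm k z + ((2 * Q + 2 * k) / k * H_norm k z / cmod discriminant) * (2 * N)"
    proof (intro add_mono mult_mono)
      show "H_norm k (particular z) \<le> (2 * Q + 1) * H_norm k z" by (rule r(2)) assumption+
      show "cmod ?c \<le> (2 * Q + 2 * k) / k * H_norm k z / cmod discriminant"
        unfolding norm_divide norm_minus_cancel by (intro divide_right_mono r(1)) auto
      show "H_norm k mode \<le> 2 * N" by (rule norm_mode_le[OF N(1) N1(1) N0])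
    qed (use Q0 k N0 in auto)
    also have "\<dots> = ?M * H_norm k z" by (simp add: algebra_simps)
    also have "\<dots> \<le> ?M * dual_norm k F" using zF Q0 N0 k by (intro mult_left_mono) auto
    finally show ?thesis .
  qed
  ultimately show "\<exists>u\<in>H_space. helmholtz k y u = F \<and> H_norm k u \<le> ?M * dual_norm k F" using u by blast
qed

text \<open>\<open>mass\<close> applied to the projection of \<open>u\<close> onto the mode, with
  respect to the bilinear pairing by the integral of \<open>u * w\<close> over the inner layer. On
  the mode it acts as \<open>mass\<close>, and being built from the bilinear pairing it keeps the
  complex symmetry.\<close>

definition rank_one :: "fn \<Rightarrow> functional" where
  "rank_one u = (\<lambda>v. mass u (\<lambda>x. cnj (mode x)) / mass mode (\<lambda>x. cnj (mode x)) * mass mode v)"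

lemma mode_cnj_H: "(\<lambda>x. cnj (mode x)) \<in> H_space"
  by (intro H_cnj mode_H)

lemma linear_to_dual_rank_one: "linear_to_dual k rank_one"
  unfolding linear_to_dual_def
proof (intro conjI ballI allI)
  show "rank_one u \<in> H_dual k" for u unfolding rank_one_def by (intro H_dual_times mass_H_dual mode_H)
  show "rank_one (\<lambda>x. u x + v x) = (\<lambda>w. rank_one u w + rank_one v w)" if "u \<in> H_space" "v \<in> H_space" for u v
    using linear_to_dual_add[OF linear_to_dual_mass that]
    by (simp add: rank_one_def add_divide_distrib distrib_right)
  show "rank_one (\<lambda>x. c * u x) = (\<lambda>w. c * rank_one u w)" if "u \<in> H_space" for u c
    using linear_to_dual_scale[OF linear_to_dual_mass that] by (simp add: rank_one_def mult.assoc)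
qed

text \<open>The factor 1 matches the shape \<open>L u v + z * B u v\<close> of
  \<open>linear_to_dual_combine\<close>.\<close>

definition shifted :: "fn \<Rightarrow> functional" where
  "shifted u = (\<lambda>v. helmholtz k y u v + 1 * rank_one u v)"

lemma linear_to_dual_shifted: "linear_to_dual k shifted"
  unfolding shifted_def[abs_def]
  by (rule linear_to_dual_combine[OF linear_to_dual_helmholtz[OF k] linear_to_dual_rank_one])

lemma shifted_cnj_commute:
  assumes "u \<in> H_space" "v \<in> H_space"
  shows "shifted u (\<lambda>x. cnj (v x)) = shifted v (\<lambda>x. cnj (u x))"
  using assms by (simp add: shifted_def rank_one_def helmholtz_cnj_commute[OF assms]
      mass_cnj_commute[OF mode_H assms(1)] mass_cnj_commute[OF mode_H assms(2)])

text \<open>Otherwise the outgoing condition would make both Cauchy data of the mode vanish at 2,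
  against the Wronskian.\<close>

lemma mode_2_ne:
  assumes D: "discriminant = 0" shows "mode 2 \<noteq> 0"
proof
  assume "mode 2 = 0"
  then have "U 1 0 2 = 0" by (simp add: mode_eq)
  moreover from this D have "V 1 0 2 = 0" using k by (simp add: discriminant_def)
  ultimately show False using Wronskian[of 2] K_ne by simp
qed

lemma bounded_UV: "\<exists>N. \<forall>x\<in>{0..2}. cmod (U a b x) \<le> N \<and> cmod (V a b x) \<le> k * N"
proof -
  have "bounded (U a b ` {0..2})" "bounded (V a b ` {0..2})"
    by (intro compact_imp_bounded compact_continuous_image continuous_UV compact_Icc)+
  then obtain A B where A: "\<forall>x\<in>{0..2}. cmod (U a b x) \<le> A" and B: "\<forall>x\<in>{0..2}. cmod (V a b x) \<le> B"
    unfolding bounded_iff by auto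
  have "A \<le> max A (B / k)" "B \<le> k * max A (B / k)"
    using k by (auto simp: max_def field_simps)
  then show ?thesis using A B by (intro exI[of _ "max A (B / k)"]) force
qed

text \<open>Split \<open>F = F1 + (t / \<beta>) mass mode\<close> so that \<open>F1\<close>
  annihilates the conjugate mode. Then \<open>F1\<close> is solvable for the resonant operator
  itself. The solution is free up to multiples of the mode, and this freedom lets the rank-one term
  reproduce the other part of \<open>F\<close>.\<close>

lemma inverse_shifted:
  assumes D: "discriminant = 0" and \<beta>: "mass mode (\<lambda>x. cnj (mode x)) \<noteq> 0"
  obtains M where "0 \<le> M" "has_bounded_inverse k shifted M"
proof -
  obtain N1 where N1: "\<forall>x\<in>{0..2}. cmod (U 1 0 x) \<le> N1 \<and> cmod (V 1 0 x) \<le> k * N1"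
    using bounded_UV by blast
  obtain N2 where N2: "\<forall>x\<in>{0..2}. cmod (U 0 1 x) \<le> N2 \<and> cmod (V 0 1 x) \<le> k * N2"
    using bounded_UV by blast
  define N where "N = max N1 N2"
  define P where "P = 3 + cmod y"
  have kN: "k * N1 \<le> k * N" "k * N2 \<le> k * N" using k by (auto simp: N_def)
  have N: "\<And>x. x \<in> {0..2} \<Longrightarrow> cmod (U 1 0 x) \<le> N" "\<And>x. x \<in> {0..2} \<Longrightarrow> cmod (U 0 1 x) \<le> N"
    "\<And>x. x \<in> {0..2} \<Longrightarrow> cmod (V 1 0 x) \<le> k * N" "\<And>x. x \<in> {0..2} \<Longrightarrow> cmod (V 0 1 x) \<le> k * N"
    using N1 N2 kN by (fastforce simp: N_def)+
  have P: "\<And>x. x \<in> {0..2} \<Longrightarrow> cmod (1 + potential y x) \<le> P"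
    unfolding P_def using norm_triangle_ineq[of 1 "potential y _"] norm_potential_le[of y] by (smt (verit) norm_one)
  define Q where "Q = 3 * k * N\<^sup>2 * P / cmod \<kappa>"
  define \<beta> where "\<beta> = mass mode (\<lambda>x. cnj (mode x))"
  define E where "E = H_norm k (\<lambda>x. cnj (mode x))"
  define e where "e = H_norm k mode"
  define A where "A = (2 * Q + 1) * (1 + E / cmod \<beta> * e)"
  define M where "M = A + (E + A * E) / cmod \<beta> * e"
  have e0: "0 \<le> e" and E0: "0 \<le> E" by (simp_all add: e_def E_def)
  have Q0: "0 \<le> Q" using norm_W_le(3)[OF H_zero N P, of 0] by (simp add: Q_def)
  have A0: "0 \<le> A" using Q0 e0 E0 by (simp add: A_def)
  have M0: "0 \<le> M" using A0 e0 E0 by (simp add: M_def)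
  note linH = linear_to_dual_helmholtz[OF k, of y] and ec = mode_cnj_H
  have mass_mode: "dual_norm k (mass mode) \<le> e" unfolding e_def by (rule dual_norm_mass_le[OF mode_H])
  have "has_bounded_inverse k shifted M"
  proof (rule has_bounded_inverse_symmetric[OF linear_to_dual_shifted k shifted_cnj_commute])
    fix F assume F: "F \<in> H_dual k"
    note F0 = dual_norm_nonneg[OF F]
    define t where "t = F (\<lambda>x. cnj (mode x))"
    have t: "cmod t \<le> dual_norm k F * E" unfolding t_def E_def by (rule norm_le_dual_norm[OF F ec])
    define F1 where "F1 = (\<lambda>v. F v + (- t / \<beta>) * mass mode v)"
    have F1: "F1 \<in> H_dual k" unfolding F1_def by (intro H_dual_plus H_dual_times F mass_H_dual mode_H)
    have "dual_norm k F1 \<le> dual_norm k F + cmod (- t / \<beta>) * dual_norm k (mass mode)"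
      unfolding F1_def using dual_norm_plus_le[OF F H_dual_times[OF mass_H_dual[OF mode_H]]]
        dual_norm_times_le[OF mass_H_dual[OF mode_H], of k "- t / \<beta>"] by (meson add_left_mono order_trans)
    also have "\<dots> \<le> dual_norm k F + (dual_norm k F * E) / cmod \<beta> * e"
      unfolding norm_divide norm_minus_cancel using t F0 E0
      by (intro add_mono mult_mono divide_right_mono mass_mode) (auto intro: dual_norm_nonneg mass_H_dual mode_H)
    finally have nF1: "dual_norm k F1 \<le> (1 + E / cmod \<beta> * e) * dual_norm k F" by (simp add: algebra_simps)
    have F1e: "F1 (\<lambda>x. cnj (mode x)) = 0" using \<beta> by (simp add: F1_def t_def \<beta>_def)
    obtain z where z: "z \<in> H_space" and Fz: "\<And>v. v \<in> H_space \<Longrightarrow> F1 v = H_inner k z v"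
      and zF: "H_norm k z \<le> dual_norm k F1" by (rule Riesz_representation[OF F1 k]) blast
    note W_le = norm_W_le[OF z N P, folded Q_def]
    define u1 where "u1 = particular z"
    have u1: "u1 \<in> H_space" unfolding u1_def by (rule particular_H[OF z])
    have hu1: "helmholtz k y u1 v = F1 v + residual z * cnj (v 2)" if "v \<in> H_space" for v
      unfolding u1_def Fz[OF that] by (rule helmholtz_particular[OF z that])
    txt \<open>\<open>F1\<close> is orthogonal to the kernel, so the boundary residual vanishes.\<close>
    have "residual z * mode 2 = helmholtz k y u1 (\<lambda>x. cnj (mode x))" using hu1[OF ec] F1e by simp
    also have "\<dots> = helmholtz k y mode (\<lambda>x. cnj (u1 x))" by (rule helmholtz_cnj_commute[OF u1 mode_H])
    also have "\<dots> = 0" using helmholtz_mode[OF H_cnj[OF u1]] D by simp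
    finally have r0: "residual z = 0" using mode_2_ne[OF D] by simp
    have "H_norm k u1 \<le> (2 * Q + 1) * H_norm k z"
      unfolding u1_def by (rule residual_le(2)[OF z Q0 W_le(1,2)])
    also have "\<dots> \<le> (2 * Q + 1) * ((1 + E / cmod \<beta> * e) * dual_norm k F)"
      using Q0 zF nF1 by (intro mult_left_mono) auto
    finally have nu1: "H_norm k u1 \<le> A * dual_norm k F" by (simp add: A_def mult_ac)
    \<comment> \<open>Chosen so that \<open>u1 + s * mode\<close> has pairing \<open>t\<close> with
      the mode, whence its rank-one term is \<open>t / \<beta>\<close> times
      \<open>mass mode\<close>.\<close>
    define s where "s = (t - mass u1 (\<lambda>x. cnj (mode x))) / \<beta>"
    have "cmod (mass u1 (\<lambda>x. cnj (mode x))) \<le> dual_norm k (mass u1) * E"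
      unfolding E_def by (rule norm_le_dual_norm[OF mass_H_dual[OF u1] ec])
    also have "\<dots> \<le> A * dual_norm k F * E"
      using dual_norm_mass_le[OF u1, of k] nu1 E0 by (intro mult_right_mono) auto
    finally have "cmod (t - mass u1 (\<lambda>x. cnj (mode x))) \<le> dual_norm k F * E + A * dual_norm k F * E"
      using t norm_triangle_ineq4[of t "mass u1 (\<lambda>x. cnj (mode x))"] by linarith
    then have ns: "cmod s \<le> (dual_norm k F * E + A * dual_norm k F * E) / cmod \<beta>"
      unfolding s_def norm_divide by (intro divide_right_mono) auto
    define u where "u = (\<lambda>x. u1 x + s * mode x)"
    have u: "u \<in> H_space" unfolding u_def by (intro H_add H_scale u1 mode_H)
    have "mass u = (\<lambda>v. mass u1 v + s * mass mode v)"
      unfolding u_def linear_to_dual_add[OF linear_to_dual_mass u1 H_scale[OF mode_H]]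
        linear_to_dual_scale[OF linear_to_dual_mass mode_H] ..
    then have mu: "mass u (\<lambda>x. cnj (mode x)) = t" using \<beta> by (simp add: s_def \<beta>_def)
    have "shifted u = F"
    proof (rule H_dual_eqI[OF F])
      show "shifted u v = F v" if v: "v \<in> H_space" for v
      proof -
        have "helmholtz k y u v = helmholtz k y u1 v + s * helmholtz k y mode v"
          unfolding u_def linear_to_dual_add[OF linH u1 H_scale[OF mode_H]] linear_to_dual_scale[OF linH mode_H] ..
        also have "\<dots> = F1 v" using hu1[OF v] helmholtz_mode[OF v] D r0 by simp
        finally show ?thesis by (simp add: shifted_def rank_one_def mu F1_def \<beta>_def)
      qed
    qed (simp add: shifted_def rank_one_def helmholtz_outside mass_def)
    moreover have "H_norm k u \<le> M * dual_norm k F"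
    proof -
      have "H_norm k u \<le> H_norm k u1 + cmod s * e"
        unfolding u_def e_def using H_norm_triangle[OF u1 H_scale[OF mode_H, of s], of k]
        by (simp only: H_norm_scale[OF mode_H])
      also have "\<dots> \<le> A * dual_norm k F + (dual_norm k F * E + A * dual_norm k F * E) / cmod \<beta> * e"
        by (intro add_mono nu1 mult_right_mono ns e0)
      also have "\<dots> = M * dual_norm k F" by (simp add: M_def algebra_simps add_divide_distrib)
      finally show ?thesis .
    qed
    ultimately show "\<exists>u\<in>H_space. shifted u = F \<and> H_norm k u \<le> M * dual_norm k F" using u by blast
  qed
  with M0 show ?thesis by (rule that)
qed

text \<open>Near a resonance the inverse is the inverse of the operator shifted by a rank-one term, which is
  holomorphic by the Neumann series, plus an explicit rank-one term with a simple pole.\<close>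

lemma resonance_pole:
  assumes D: "discriminant = 0" and \<beta>: "mass mode (\<lambda>x. cnj (mode x)) \<noteq> 0"
  shows "op_has_pole k (helmholtz_inv k) y" and "\<forall>\<^sub>F z in at y. helmholtz_invertible k z"
proof -
  obtain M where M: "0 \<le> M" "has_bounded_inverse k shifted M" by (rule inverse_shifted[OF D \<beta>])
  define \<beta> where "\<beta> = mass mode (\<lambda>x. cnj (mode x))"
  have \<beta>0: "\<beta> \<noteq> 0" using \<beta> by (simp add: \<beta>_def)
  \<comment> \<open>\<open>r * M \<le> 1/2\<close> is for the Neumann series, and
    \<open>r \<le> 1/2\<close> keeps \<open>1 + (z - y)\<close> away from 0.\<close>
  define r where "r = 1 / (2 * (M + 1))"
  have r: "0 < r" "r * M \<le> 1/2" "r \<le> 1/2" using M by (auto simp: r_def field_simps)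
  define T where "T z = inv_into H_space (\<lambda>u v. shifted u v + (z - y) * mass u v)" for z
  have S: "cmod (z - y) * M \<le> 1/2" if "z \<in> ball y r" for z
    using that r M by (intro order_trans[OF mult_right_mono r(2)]) (auto simp: dist_norm norm_minus_commute)
  have ne1: "1 + (z - y) \<noteq> 0" if "z \<in> ball y r" for z
  proof
    assume "1 + (z - y) = 0"
    then have "cmod (z - y) = 1" by (metis add_eq_0_iff norm_minus_cancel norm_one)
    then show False using that r by (auto simp: dist_norm norm_minus_commute)
  qed
  have lin: "linear_to_dual k (\<lambda>u v. shifted u v + (z - y) * mass u v)" for z
    by (rule linear_to_dual_combine[OF linear_to_dual_shifted linear_to_dual_mass])
  have inv: "has_bounded_inverse k (\<lambda>u v. shifted u v + (z - y) * mass u v) (M / (1 - cmod (z - y) * M))"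
    if "z \<in> ball y r" for z
    using S[OF that] by (intro Neumann linear_to_dual_shifted linear_to_dual_mass M dual_norm_mass_le k) auto
  have inv_T: "inv_into H_space (\<lambda>u v. shifted u v + (z - y) * mass u v) = T z" for z by (simp add: T_def)
  note TH = inverse_in_H[OF lin inv, unfolded inv_T] and TR = inverse_right[OF lin inv, unfolded inv_T]
    and TB = inverse_bounded_ops[OF lin inv, unfolded inv_T]
  note ec = mode_cnj_H
  \<comment> \<open>Up to the factor \<open>1 / \<beta>\<close>, the residue of the inverse at the
    resonance.\<close>
  define R :: "functional \<Rightarrow> fn" where "R F = (\<lambda>x. F (\<lambda>x. cnj (mode x)) * mode x)" for F
  have RB: "R \<in> bounded_ops k"
  proof (rule bounded_opsI)
    fix F assume F: "F \<in> H_dual k"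
    show "R F \<in> H_space" unfolding R_def by (intro H_scale mode_H)
    have "H_norm k (R F) = cmod (F (\<lambda>x. cnj (mode x))) * H_norm k mode"
      unfolding R_def by (rule H_norm_scale[OF mode_H])
    also have "\<dots> \<le> (dual_norm k F * H_norm k (\<lambda>x. cnj (mode x))) * H_norm k mode"
      by (intro mult_right_mono norm_le_dual_norm F ec) auto
    finally show "H_norm k (R F) \<le> (H_norm k (\<lambda>x. cnj (mode x)) * H_norm k mode) * dual_norm k F"
      by (simp add: mult_ac)
  qed (simp_all add: R_def distrib_right mult.assoc)
  define g where "g z = 1 / (\<beta> * (1 + (z - y)))" for z
  \<comment> \<open>Turns out to be \<open>z - y\<close> times the inverse, see
    \<open>solves\<close> below; it extends holomorphically to \<open>z = y\<close>.\<close>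
  define G where "G z F x = (z - y) * T z F x + g z * R F x" for z F x
  have GB: "G z \<in> bounded_ops k" if "z \<in> ball y r" for z
    unfolding G_def[abs_def] by (rule bounded_ops_combine[OF TB[OF that] RB])
  have holo: "op_holomorphic_on k G (ball y r)"
  proof (rule op_holomorphic_onI[OF GB])
    fix w assume w: "w \<in> ball y r"
    have dT: "has_op_deriv k T (\<lambda>F x. - T w (mass (T w F)) x) w (ball y r)"
      using has_op_deriv_inverse[OF linear_to_dual_shifted M(2) linear_to_dual_mass dual_norm_mass_le k M(1) S w]
      by (simp only: inv_T)
    have d1: "((\<lambda>z. z - y) has_field_derivative 1) (at w within ball y r)"
      by (auto intro!: derivative_eq_intros)
    have d2: "(g has_field_derivative - \<beta> / (\<beta> * (1 + (w - y)))\<^sup>2) (at w within ball y r)"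
      unfolding g_def using ne1[OF w] \<beta>0
      by (auto intro!: derivative_eq_intros simp: power2_eq_square)
    have "has_op_deriv k G (\<lambda>F x. (1 * T w F x + (w - y) * - T w (mass (T w F)) x)
        + ((- \<beta> / (\<beta> * (1 + (w - y)))\<^sup>2) * R F x + g w * 0)) w (ball y r)"
      unfolding G_def[abs_def]
    proof (rule has_op_deriv_add[OF has_op_deriv_scale[OF dT d1 TB w] has_op_deriv_scale[OF has_op_deriv_const d2 RB w] _ _ w])
      show "(\<lambda>F x. (z - y) * T z F x) \<in> bounded_ops k" if "z \<in> ball y r" for z
        using bounded_ops_combine[OF TB[OF that] TB[OF that], of "z - y" 0] by simp
      show "(\<lambda>F x. g z * R F x) \<in> bounded_ops k" if "z \<in> ball y r" for z
        using bounded_ops_combine[OF RB RB, of "g z" 0] by simp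
    qed
    then show "\<exists>D. has_op_deriv k G D w (ball y r)" by blast
  qed
  \<comment> \<open>Evaluate the equation for \<open>T z F\<close> at the conjugate mode and use
    symmetry. On the mode the Helmholtz part vanishes, while the shift and the perturbation both act
    as multiples of \<open>mass mode\<close>, with total factor \<open>1 + (z - y)\<close>.\<close>
  have massfact: "mass (T z F) (\<lambda>x. cnj (mode x)) = F (\<lambda>x. cnj (mode x)) / (1 + (z - y))"
    if z: "z \<in> ball y r" and F: "F \<in> H_dual k" for z F
  proof -
    let ?A = "\<lambda>u v. shifted u v + (z - y) * mass u v"
    note u = TH[OF z F]
    have "F (\<lambda>x. cnj (mode x)) = ?A (T z F) (\<lambda>x. cnj (mode x))" using fun_cong[OF TR[OF z F], of "\<lambda>x. cnj (mode x)"] by simp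
    also have "\<dots> = ?A mode (\<lambda>x. cnj (T z F x))"
      by (simp only: shifted_cnj_commute[OF u mode_H] mass_cnj_commute[OF u mode_H])
    also have "\<dots> = (1 + (z - y)) * mass mode (\<lambda>x. cnj (T z F x))"
      using helmholtz_mode[OF H_cnj[OF u]] D \<beta>0 by (simp add: shifted_def rank_one_def \<beta>_def algebra_simps)
    also have "mass mode (\<lambda>x. cnj (T z F x)) = mass (T z F) (\<lambda>x. cnj (mode x))"
      by (rule mass_cnj_commute[OF mode_H u])
    finally show ?thesis using ne1[OF z] by (simp add: field_simps)
  qed
  have hz: "helmholtz k z u v = helmholtz k y u v + (z - y) * mass u v" if "u \<in> H_space" for z u v
    unfolding helmholtz_split[OF that, of k z] helmholtz_split[OF that, of k y] by (simp add: algebra_simps)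
  define sol where "sol z F = (\<lambda>x. G z F x / (z - y))" for z F
  have sol_H: "sol z F \<in> H_space" if "z \<in> ball y r" "F \<in> H_dual k" for z F
    using H_scale[OF bounded_ops_linear(1)[OF GB[OF that(1)] that(2)], of "1 / (z - y)"] by (simp add: sol_def)
  have solves: "helmholtz k z (sol z F) = F" if z: "z \<in> ball y r - {y}" and F: "F \<in> H_dual k" for z F
  proof -
    have zb: "z \<in> ball y r" and zy: "z - y \<noteq> 0" using z by auto
    let ?f = "F (\<lambda>x. cnj (mode x))"
    \<comment> \<open>\<open>T z F\<close> misses \<open>F\<close> by the rank-one term, a multiple
      of \<open>mass mode\<close>. Since \<open>helmholtz k z mode\<close> is \<open>z - y\<close>
      times \<open>mass mode\<close>, this multiple of the mode makes up for it, at the price of one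
      factor \<open>1 / (z - y)\<close>.\<close>
    let ?s = "g z * ?f / (z - y)"
    note u = TH[OF zb F] and linz = linear_to_dual_helmholtz[OF k, of z]
    have sol_eq: "sol z F = (\<lambda>x. T z F x + ?s * mode x)"
    proof
      have "(d * a + c * (f * m)) / d = a + c * f / d * m" if "d \<noteq> 0" for d a c f m :: complex
        using that by (simp add: field_simps)
      from this[OF zy] show "sol z F x = T z F x + ?s * mode x" for x
        unfolding sol_def G_def R_def .
    qed
    show ?thesis
    proof (rule H_dual_eqI[OF F])
      fix v assume v: "v \<in> H_space"
      have hT: "helmholtz k z (T z F) v = F v - ?f / (1 + (z - y)) / \<beta> * mass mode v"
      proof -
        have "helmholtz k z (T z F) v = (shifted (T z F) v + (z - y) * mass (T z F) v) - rank_one (T z F) v"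
          unfolding hz[OF u, of z] shifted_def by simp
        moreover have "rank_one (T z F) v = ?f / (1 + (z - y)) / \<beta> * mass mode v"
          unfolding rank_one_def massfact[OF zb F] \<beta>_def ..
        ultimately show ?thesis using fun_cong[OF TR[OF zb F], of v] by (simp only:)
      qed
      have hm: "helmholtz k z mode v = (z - y) * mass mode v"
        unfolding hz[OF mode_H, of z] helmholtz_mode[OF v] using D by simp
      have "helmholtz k z (sol z F) v = helmholtz k z (T z F) v + ?s * helmholtz k z mode v"
        unfolding sol_eq linear_to_dual_add[OF linz u H_scale[OF mode_H]] linear_to_dual_scale[OF linz mode_H] ..
      also have "\<dots> = F v"
      proof -
        have "a - f / p / b * m + 1 / (b * p) * f / d * (d * m) = a" if "d \<noteq> 0" for a f p b m d :: complex
          using that by (simp add: mult_ac)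
        from this[OF zy] show ?thesis unfolding hT hm g_def .
      qed
      finally show "helmholtz k z (sol z F) v = F v" .
    qed (rule helmholtz_outside)
  qed
  have hinv: "has_bounded_inverse k (helmholtz k z) (op_norm k (G z) / cmod (z - y))" if z: "z \<in> ball y r - {y}" for z
  proof (rule has_bounded_inverse_symmetric[OF linear_to_dual_helmholtz[OF k] k helmholtz_cnj_commute])
    fix F assume F: "F \<in> H_dual k"
    have zb: "z \<in> ball y r" using z by auto
    have "H_norm k (sol z F) = cmod (1 / (z - y)) * H_norm k (G z F)"
      using H_norm_scale[OF bounded_ops_linear(1)[OF GB[OF zb] F], of k "1 / (z - y)"] by (simp add: sol_def)
    also have "\<dots> \<le> cmod (1 / (z - y)) * (op_norm k (G z) * dual_norm k F)"
      by (intro mult_left_mono norm_le_op_norm GB zb F) auto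
    finally have "H_norm k (sol z F) \<le> op_norm k (G z) / cmod (z - y) * dual_norm k F" by (simp add: norm_divide)
    then show "\<exists>u\<in>H_space. helmholtz k z u = F \<and> H_norm k u \<le> op_norm k (G z) / cmod (z - y) * dual_norm k F"
      using solves[OF z F] sol_H[OF zb F] by blast
  qed
  show "\<forall>\<^sub>F z in at y. helmholtz_invertible k z"
    unfolding eventually_at_topological
    using r by (intro exI[of _ "ball y r"]) (auto intro!: helmholtz_invertibleI[OF k hinv])
  have "helmholtz_inv k z F = sol z F" if "z \<in> ball y r - {y}" "F \<in> H_dual k" for z F
    unfolding helmholtz_inv_def using that
    by (intro inverse_eqI[OF linear_to_dual_helmholtz[OF k] hinv] sol_H solves) auto
  \<comment> \<open>At the centre the first term of \<open>G\<close> drops out, and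
    \<open>mass mode\<close> detects the residue because its value at the conjugate mode is
    \<open>\<beta>\<close>.\<close>
  moreover have "G y (mass mode) = mode"
    using \<beta>0 by (simp add: G_def[abs_def] g_def R_def \<beta>_def)
  then have "G y (mass mode) \<noteq> (\<lambda>x. 0)" using mode_2_ne[OF D] by auto
  ultimately show "op_has_pole k (helmholtz_inv k) y"
    unfolding op_has_pole_def using r holo mass_H_dual[OF mode_H]
    by (intro exI[of _ 1] exI[of _ r] exI[of _ G]) (auto simp: sol_def)
qed

end

section \<open>The resonance near zero\<close>

text \<open>\<open>helmholtz k y\<close> and its affine form in \<open>y\<close> agree on
  \<open>H_space\<close> only, so their inverses have to be identified by congruence on that
  set.\<close>

lemma inv_into_cong:
  assumes "\<And>x. x \<in> A \<Longrightarrow> f x = g x" shows "inv_into A f = inv_into A g"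
proof
  have "(x \<in> A \<and> f x = b) = (x \<in> A \<and> g x = b)" for x b using assms by auto
  then show "inv_into A f b = inv_into A g b" for b by (simp add: inv_into_def)
qed

lemma has_bounded_inverse_cong:
  assumes "\<And>u. u \<in> H_space \<Longrightarrow> L u = L' u"
  shows "has_bounded_inverse k L M \<longleftrightarrow> has_bounded_inverse k L' M"
  unfolding has_bounded_inverse_def using bij_betw_cong[of H_space L L' "H_dual k"] assms by simp

section \<open>The resonance condition and nondegeneracy of the mode\<close>

context layered_medium
begin

lemma resonance_iff: "discriminant = 0 \<longleftrightarrow> \<kappa> * cos K = \<i> * sin K"
proof -
  have "discriminant = 0 \<longleftrightarrow> (of_real k)\<^sup>2 * discriminant = 0" using k by simp
  also have "\<dots> \<longleftrightarrow> of_real k * (\<kappa> * cos K - \<i> * sin K) = 0"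
    unfolding discriminant_eq by (simp add: K_def algebra_simps)
  also have "\<dots> \<longleftrightarrow> \<kappa> * cos K = \<i> * sin K" using k by simp
  finally show ?thesis .
qed

text \<open>This is \<open>\<kappa> cos K = \<i> sin K\<close> multiplied by
  \<open>2 exp (\<i> K)\<close> and rearranged. In exponential form the summand
  \<open>2 pi m\<close> of \<open>K\<close> disappears, and a logarithm can be taken.\<close>

lemma resonance_if_exp:
  assumes e: "exp (2 * \<i> * K) * (1 - \<kappa>) = 1 + \<kappa>"
  shows "discriminant = 0"
proof -
  define E where "E = exp (\<i> * K)"
  have E: "E \<noteq> 0" by (simp add: E_def)
  have "E * E = exp (2 * \<i> * K)" by (simp add: E_def mult.assoc flip: exp_add)
  then have "E * E * (1 - \<kappa>) = 1 + \<kappa>" using e by simp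
  moreover have "\<kappa> * (E * E + 1) - (E * E - 1) = (1 + \<kappa>) - E * E * (1 - \<kappa>)" by (simp add: algebra_simps)
  ultimately have "\<kappa> * (E * E + 1) = E * E - 1" by simp
  moreover have "E * (\<kappa> * (E + inverse E)) = \<kappa> * (E * E + 1)" "E * (E - inverse E) = E * E - 1"
    using E by (simp_all add: field_simps)
  ultimately have "E * (\<kappa> * (E + inverse E)) = E * (E - inverse E)" by simp
  then have 1: "\<kappa> * (E + inverse E) = E - inverse E" using E by simp
  have i: "exp (- (\<i> * K)) = inverse E" by (simp add: E_def exp_minus)
  have "\<kappa> * cos K = \<kappa> * (E + inverse E) / 2" by (simp add: cos_exp_eq i flip: E_def)
  also have "\<dots> = \<i> * sin K" unfolding 1 by (simp add: sin_exp_eq i field_simps flip: E_def)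
  finally show ?thesis by (simp add: resonance_iff)
qed

lemma mass_mode: "mass mode (\<lambda>x. cnj (mode x)) = 1/2 - inverse (2 * K) * (sin K * cos K)"
proof -
  let ?g = "\<lambda>x. (sin (K * of_real x))\<^sup>2"
  have g: "integrable M2 ?g"
    by (intro square_integrable_integrable square_integrable_continuous continuous_intros)
  have "mass mode (\<lambda>x. cnj (mode x)) = (\<integral>x. indicator {0..1} x * mode x * cnj (cnj (mode x)) \<partial>M2)"
    using mode_cnj_H by (simp add: mass_def)
  also have "\<dots> = (\<integral>x. indicator {..1} x * ?g x \<partial>M2)"
    by (intro Bochner_Integration.integral_cong) (auto simp: indicator_def mode_eq U_def power2_eq_square)
  also have "\<dots> = primitive ?g 1" by (simp add: primitive_def)
  also have "\<dots> = (of_real 1 / 2 - inverse (2 * K) * (sin (K * of_real 1) * cos (K * of_real 1))) -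
      (of_real 0 / 2 - inverse (2 * K) * (sin (K * of_real 0) * cos (K * of_real 0)))"
  proof (rule primitive_FTC[OF _ finite.emptyI _ g])
    show "continuous_on {0..2} (\<lambda>x. of_real x / 2 - inverse (2 * K) * (sin (K * of_real x) * cos (K * of_real x)))"
      by (intro continuous_intros) auto
    fix x :: real
    show "((\<lambda>x. of_real x / 2 - inverse (2 * K) * (sin (K * of_real x) * cos (K * of_real x))) has_vector_derivative ?g x) (at x)"
    proof (rule has_vector_derivative_real_field)
      have "((\<lambda>z. z / 2 - inverse (2 * K) * (sin (K * z) * cos (K * z))) has_field_derivative
        1 / 2 - inverse (2 * K) * (sin (K * of_real x) * (- sin (K * of_real x) * K) + cos (K * of_real x) * K * cos (K * of_real x))) (at (of_real x))"
        by (auto intro!: derivative_eq_intros)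
      moreover have "1 / 2 - inverse (2 * K) * (S * (- S * K) + C * K * C) = S\<^sup>2" if "S\<^sup>2 + C\<^sup>2 = 1" for S C :: complex
      proof -
        have C: "C * C = 1 - S * S" using that by (simp add: power2_eq_square eq_diff_eq add.commute)
        have "S * (- S * K) + C * K * C = K * (C * C - S * S)" by (simp add: algebra_simps)
        also have "\<dots> = K * (1 - 2 * (S * S))" unfolding C by simp
        finally show ?thesis using K_ne by (simp add: power2_eq_square field_simps)
      qed
      ultimately show "((\<lambda>z. z / 2 - inverse (2 * K) * (sin (K * z) * cos (K * z))) has_field_derivative ?g x) (at (of_real x))"
        by simp
    qed
  qed simp
  finally show ?thesis by simp
qed

text \<open>The mode is complex, so the integral of its square is not positive for free. The
  resonance condition gives \<open>sin K = - \<i> \<kappa> cos K\<close> and hence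
  \<open>(cos K)^2 * (1 - \<kappa>^2) = 1\<close>. If the integral vanished,
  \<open>sin K * cos K = K\<close> would follow, hence \<open>k * (1 - \<kappa>^2) = - \<i>\<close>,
  whose left-hand side has modulus above 1.\<close>

lemma mass_mode_ne_0:
  assumes D: "discriminant = 0" and \<kappa>2: "1 < k * (1 - (cmod \<kappa>)\<^sup>2)"
  shows "mass mode (\<lambda>x. cnj (mode x)) \<noteq> 0"
proof
  assume "mass mode (\<lambda>x. cnj (mode x)) = 0"
  then have 1: "sin K * cos K = K" using K_ne by (simp add: mass_mode field_simps)
  have s: "sin K = - \<i> * (\<kappa> * cos K)" using D unfolding resonance_iff by simp
  have "(- \<i> * (\<kappa> * cos K))\<^sup>2 + (cos K)\<^sup>2 = 1" using sin_cos_squared_add[of K] unfolding s .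
  then have c: "(cos K)\<^sup>2 * (1 - \<kappa>\<^sup>2) = 1" by (simp add: power_mult_distrib algebra_simps)
  have "K * (1 - \<kappa>\<^sup>2) = (sin K * cos K) * (1 - \<kappa>\<^sup>2)" by (simp only: 1)
  also have "\<dots> = - \<i> * \<kappa> * ((cos K)\<^sup>2 * (1 - \<kappa>\<^sup>2))"
    unfolding s by (simp add: power2_eq_square)
  finally have "K * (1 - \<kappa>\<^sup>2) = - \<i> * \<kappa> * ((cos K)\<^sup>2 * (1 - \<kappa>\<^sup>2))" .
  then have "\<kappa> * (of_real k * (1 - \<kappa>\<^sup>2)) = \<kappa> * - \<i>" unfolding c by (simp add: K_def mult_ac)
  then have "of_real k * (1 - \<kappa>\<^sup>2) = - \<i>" using \<kappa> by (metis mult_left_cancel)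
  then have "cmod (of_real k * (1 - \<kappa>\<^sup>2)) = 1" by simp
  then have "k * cmod (1 - \<kappa>\<^sup>2) = 1" using k by (simp add: norm_mult)
  moreover have "1 - (cmod \<kappa>)\<^sup>2 \<le> cmod (1 - \<kappa>\<^sup>2)"
    using norm_triangle_ineq2[of 1 "\<kappa>\<^sup>2"] by (simp add: norm_power)
  then have "k * (1 - (cmod \<kappa>)\<^sup>2) \<le> k * cmod (1 - \<kappa>\<^sup>2)" using k by (intro mult_left_mono) auto
  ultimately show False using \<kappa>2 by simp
qed

end

text \<open>Here \<open>K = 2 pi m\<close>, so the sine vanishes and the discriminant has modulus
  \<open>1 / (sqrt 2 * k)\<close>. The residual is bounded by a constant times the norm of the data
  because \<open>Q\<close> is of order \<open>k\<close>; dividing by the discriminant gives one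
  power of \<open>k\<close>.\<close>

lemma inverse_at_0:
  assumes m: "m \<ge> 1" and k_eq: "k = 2 * pi * real m * sqrt 2"
  shows "has_bounded_inverse k (helmholtz k 0) (80 * k)"
proof -
  have k1: "k \<ge> 1"
  proof -
    have "1 * 1 * 1 * 1 \<le> 2 * pi * real m * sqrt 2" using m pi_ge_two by (intro mult_mono) auto
    then show ?thesis by (simp add: k_eq)
  qed
  define \<kappa> where "\<kappa> = complex_of_real (1 / sqrt 2)"
  interpret layered_medium k \<kappa> using k1 by unfold_locales (auto simp: \<kappa>_def)
  have y0: "1/2 - \<kappa>\<^sup>2 = 0" by (simp add: \<kappa>_def power_divide flip: of_real_power)
  have n\<kappa>: "cmod \<kappa> = 1 / sqrt 2" by (simp add: \<kappa>_def norm_divide)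
  have \<kappa>1: "cmod \<kappa> \<le> 1" by (simp add: n\<kappa> divide_le_eq)
  have K: "K = of_real (2 * real m * pi)"
  proof -
    have "K = of_real (k * (1 / sqrt 2))" by (simp add: K_def) (simp add: \<kappa>_def)
    also have "k * (1 / sqrt 2) = 2 * real m * pi" unfolding k_eq by simp
    finally show ?thesis .
  qed
  have sK: "sin K = 0" and cK: "cos K = 1"
    unfolding K sin_of_real cos_of_real by (simp_all add: sin_2npi cos_2npi)
  have nK: "cmod K \<le> k"
    using k1 \<kappa>1 by (simp add: K_def norm_mult mult_left_le)
  have trig: "cmod (sin (of_real t)) \<le> 1" "cmod (cos (of_real t)) \<le> 1" for t :: real
    by (simp_all add: sin_of_real cos_of_real)
  have Kx: "K * of_real x = of_real (2 * real m * pi * x)" for x by (simp add: K)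
  have kx: "complex_of_real k * (of_real x - 1) = of_real (k * (x - 1))" for x by simp
  have P: "cmod (1 + potential (1/2 - \<kappa>\<^sup>2) x) \<le> 2" if "x \<in> {0..2}" for x
    unfolding y0 potential_def using that by (auto simp: indicator_def)
  have prod: "cmod (a * b) \<le> c" if "cmod a \<le> c" "cmod b \<le> 1" "0 \<le> c" for a b c
    using mult_mono[OF that(1,2)] that(3) by (simp add: norm_mult)
  have N: "cmod (U 1 0 x) \<le> 1" "cmod (U 0 1 x) \<le> 1" "cmod (V 1 0 x) \<le> k * 1" "cmod (V 0 1 x) \<le> k * 1" for x
    using k1 by (auto simp: U_def V_def sK cK Kx kx simp del: of_real_mult of_real_diff
        intro!: prod trig \<kappa>1 nK)
  have "k\<^sup>2 * cmod discriminant = cmod ((of_real k)\<^sup>2 * discriminant)" by (simp add: norm_mult norm_power)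
  also have "\<dots> = cmod K" unfolding discriminant_eq sK cK by (simp add: norm_mult norm_exp_eq_Re)
  also have "\<dots> = k / sqrt 2" using k1 by (simp add: K_def norm_mult n\<kappa>)
  finally have nD: "cmod discriminant = 1 / (sqrt 2 * k)"
    using k1 by (simp add: power2_eq_square field_simps)
  then have D: "discriminant \<noteq> 0" using k1 by auto
  define Q where "Q = 3 * k * 1\<^sup>2 * 2 / cmod \<kappa>"
  note inverse_nonresonant[OF D N P, folded Q_def, unfolded y0]
  then have inv: "has_bounded_inverse k (helmholtz k 0) (2 * Q + 1 + (2 * Q + 2 * k) / k / cmod discriminant * (2 * 1))"
    by blast
  have s2: "2 * sqrt 2 \<le> (3::real)" by (rule power2_le_imp_le) (simp_all add: power_mult_distrib)
  have Q: "Q = 6 * k * sqrt 2" by (simp add: Q_def n\<kappa>)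
  have "Q \<le> 9 * k" unfolding Q using s2 k1 by (simp add: mult_left_mono)
  have "0 \<le> Q" using k1 by (simp add: Q)
  have "2 * Q + 1 + (2 * Q + 2 * k) / k / cmod discriminant * (2 * 1) = 2 * Q + 1 + (2 * Q + 2 * k) * (2 * sqrt 2)"
    using k1 by (simp add: nD field_simps)
  \<comment> \<open>The sum is \<open>18 k + k + 60 k\<close>; the summand 1 is absorbed by
    \<open>k \<ge> 1\<close>.\<close>
  also have "\<dots> \<le> 2 * (9 * k) + k + (2 * (9 * k) + 2 * k) * 3"
    using s2 k1 \<open>Q \<le> 9 * k\<close> \<open>0 \<le> Q\<close> by (intro add_mono mult_mono) auto
  also have "\<dots> \<le> 80 * k" using k1 by simp
  finally have le: "2 * Q + 1 + (2 * Q + 2 * k) / k / cmod discriminant * (2 * 1) \<le> 80 * k" .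
  show ?thesis
    unfolding has_bounded_inverse_def
  proof (intro conjI ballI)
    show "bij_betw (helmholtz k 0) H_space (H_dual k)" using inv by (simp add: has_bounded_inverse_def)
    fix u assume u: "u \<in> H_space"
    have "H_norm k u \<le> (2 * Q + 1 + (2 * Q + 2 * k) / k / cmod discriminant * (2 * 1)) * dual_norm k (helmholtz k 0 u)"
      using inv u by (simp only: has_bounded_inverse_def)
    also have "\<dots> \<le> 80 * k * dual_norm k (helmholtz k 0 u)"
      by (intro mult_right_mono[OF le] dual_norm_nonneg linear_to_dual_H_dual[OF linear_to_dual_helmholtz u]) (use k1 in simp)
    finally show "H_norm k u \<le> 80 * k * dual_norm k (helmholtz k 0 u)" .
  qed
qed

lemma inverse_sqrt2_bounds: "7/10 \<le> 1 / sqrt 2" "1 / sqrt 2 \<le> (71/100::real)"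
proof -
  have "sqrt 2 \<le> 1 / (7/10::real)" by (rule real_le_lsqrt) (auto simp: power2_eq_square)
  then show "7/10 \<le> 1 / sqrt 2" by (simp add: field_simps)
  have "1 / (71/100) \<le> sqrt (2::real)" by (rule real_le_rsqrt) (auto simp: power2_eq_square)
  then show "1 / sqrt 2 \<le> (71/100::real)" by (simp add: field_simps)
qed

text \<open>With \<open>K = 2 \<pi> m + w\<close> the resonance condition is the fixed-point equation
  \<open>w = Ln ((1 + \<kappa>) / (1 - \<kappa>)) / (2 \<i>)\<close> with \<open>\<kappa> = 1 / sqrt 2 + w / k\<close>.\<close>

lemma resonance_fixpoint:
  assumes k: "k \<ge> 125"
  obtains w :: complex where "cmod w \<le> 5"
    "exp (2 * \<i> * w) = (1 + (of_real (1 / sqrt 2) + w / of_real k)) / (1 - (of_real (1 / sqrt 2) + w / of_real k))"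
proof -
  define \<kappa> where "\<kappa> w = complex_of_real (1 / sqrt 2) + w / of_real k" for w
  define q where "q w = (1 + \<kappa> w) / (1 - \<kappa> w)" for w
  note s = inverse_sqrt2_bounds
  have ns: "cmod (complex_of_real (1 / sqrt 2)) = 1 / sqrt 2" by (simp add: norm_divide)
  \<comment> \<open>Radius 5 and \<open>k \<ge> 125\<close> move \<kappa> by at most 1/25. Hence its
    modulus stays below \<open>71/100 + 4/100 = 3/4\<close> and its real part above
    \<open>7/10 - 4/100 = 33/50\<close>.\<close>
  have near: "cmod (\<kappa> w - of_real (1 / sqrt 2)) \<le> (1/25)" if "cmod w \<le> 5" for w
  proof -
    have "cmod (\<kappa> w - of_real (1 / sqrt 2)) = cmod w / k" using k by (simp add: \<kappa>_def norm_divide)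
    also have "\<dots> \<le> 5 / 125" using that k by (intro frac_le) auto
    finally show ?thesis by simp
  qed
  have \<kappa>_le: "cmod (\<kappa> w) \<le> (3/4)" if "cmod w \<le> 5" for w
    using norm_triangle_sub[of "\<kappa> w" "of_real (1 / sqrt 2)"] near[OF that] s ns by linarith
  have \<kappa>_Re: "Re (\<kappa> w) \<ge> (33/50)" if "cmod w \<le> 5" for w
    using abs_Re_le_cmod[of "\<kappa> w - of_real (1 / sqrt 2)"] near[OF that] s by simp
  have ne: "1 - \<kappa> w \<noteq> 0" if "cmod w \<le> 5" for w
  proof
    assume "1 - \<kappa> w = 0"
    then have "cmod (\<kappa> w) = 1" by (metis eq_iff_diff_eq_0 norm_one)
    then show False using \<kappa>_le[OF that] by simp
  qed
  \<comment> \<open>Keeps \<open>q\<close> off the branch cut of \<open>Ln\<close>. The real part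
    has the sign of one minus the squared modulus of \<kappa>.\<close>
  have q_Re: "Re (q w) > 0" if "cmod w \<le> 5" for w
  proof -
    have "q w = (1 + \<kappa> w) * cnj (1 - \<kappa> w) / of_real ((cmod (1 - \<kappa> w))\<^sup>2)"
      unfolding q_def by (rule complex_div_cnj)
    then have "Re (q w) = Re ((1 + \<kappa> w) * cnj (1 - \<kappa> w)) / (cmod (1 - \<kappa> w))\<^sup>2"
      by (simp only: Re_divide_of_real)
    also have "Re ((1 + \<kappa> w) * cnj (1 - \<kappa> w)) = 1 - (cmod (\<kappa> w))\<^sup>2"
      using cmod_power2[of "\<kappa> w"] by (simp add: power2_eq_square algebra_simps)
    finally have "Re (q w) = (1 - (cmod (\<kappa> w))\<^sup>2) / (cmod (1 - \<kappa> w))\<^sup>2" .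
    moreover have "(cmod (\<kappa> w))\<^sup>2 < 1" using \<kappa>_le[OF that] by (simp add: power_less_one_iff)
    ultimately show ?thesis using ne[OF that] by simp
  qed
  \<comment> \<open>The lower bound 1 makes the real part of the logarithm nonnegative, so the upper
    bound 7 controls its modulus through \<open>ln x \<le> x - 1\<close>.\<close>
  have q_le: "cmod (q w) \<le> 7" and q_ge: "1 \<le> cmod (q w)" if "cmod w \<le> 5" for w
  proof -
    have a: "cmod (1 + \<kappa> w) \<le> (7/4)" using norm_triangle_ineq[of 1 "\<kappa> w"] \<kappa>_le[OF that] by simp
    have b: "(1/4) \<le> cmod (1 - \<kappa> w)" using norm_triangle_ineq2[of 1 "\<kappa> w"] \<kappa>_le[OF that] by simp
    have "cmod (1 + \<kappa> w) / cmod (1 - \<kappa> w) \<le> (7/4) / (1/4)" using a b by (intro frac_le) auto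
    then show "cmod (q w) \<le> 7" by (simp add: q_def norm_divide)
    have "(cmod (1 - \<kappa> w))\<^sup>2 \<le> (cmod (1 + \<kappa> w))\<^sup>2"
      unfolding cmod_power2 using \<kappa>_Re[OF that] by (simp add: power2_eq_square algebra_simps)
    then have "cmod (1 - \<kappa> w) \<le> cmod (1 + \<kappa> w)" by (rule power2_le_imp_le) simp
    moreover have "0 < cmod (1 - \<kappa> w)" using b by linarith
    ultimately show "1 \<le> cmod (q w)" unfolding q_def norm_divide by (simp add: le_divide_eq_1_pos)
  qed
  define f where "f w = Ln (q w) / (2 * \<i>)" for w
  have "continuous_on (cball 0 5) f"
    unfolding f_def
  proof (intro continuous_intros)
    show "continuous_on (cball 0 5) q"
      unfolding q_def \<kappa>_def using ne k by (intro continuous_intros) (auto simp: \<kappa>_def)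
    show "q w \<notin> \<real>\<^sub>\<le>\<^sub>0" if "w \<in> cball 0 5" for w
      using q_Re[of w] that by (auto simp: complex_nonpos_Reals_iff)
  qed auto
  \<comment> \<open>Real part at most 6 and imaginary part at most 4 give modulus at most 10 for the
    logarithm; division by \<open>2 \<i>\<close> returns the radius 5.\<close>
  moreover have "f \<in> cball 0 5 \<rightarrow> cball 0 5"
  proof (rule Pi_I)
    fix w :: complex assume "w \<in> cball 0 5"
    then have w: "cmod w \<le> 5" by simp
    have q0: "q w \<noteq> 0" using q_ge[OF w] by auto
    have "cmod (Ln (q w)) \<le> \<bar>Re (Ln (q w))\<bar> + \<bar>Im (Ln (q w))\<bar>" by (rule cmod_le)
    moreover have "\<bar>Re (Ln (q w))\<bar> \<le> 6"
    proof -
      have "ln (cmod (q w)) \<le> cmod (q w) - 1" using q_ge[OF w] by (intro ln_le_minus_one) auto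
      then show ?thesis using q_le[OF w] q_ge[OF w] q0 by simp
    qed
    moreover have "\<bar>Im (Ln (q w))\<bar> \<le> 4"
      using mpi_less_Im_Ln[OF q0] Im_Ln_le_pi[OF q0] pi_less_4 by linarith
    ultimately show "f w \<in> cball 0 5" by (simp add: f_def norm_divide norm_mult)
  qed
  ultimately obtain w where w: "w \<in> cball 0 5" "f w = w"
    using brouwer[of "cball 0 5" f] by auto
  have "exp (2 * \<i> * w) = exp (Ln (q w))" using w(2) by (simp add: f_def field_simps)
  also have "\<dots> = q w" using q_ge[of w] w(1) by (intro exp_Ln) auto
  finally show ?thesis using w(1) by (intro that[of w]) (auto simp: q_def \<kappa>_def)
qed

text \<open>\<open>helmholtz_inv\<close> is total, being built from \<open>inv_into\<close>.
  Invertibility is therefore asserted on the ball and around the pole, so that holomorphy and pole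
  concern the true inverse.\<close>

theorem corollary1p6:
  shows "\<exists>(m0::nat) (C::real). 0 < m0 \<and> 0 < C \<and>
    (\<forall>(m::nat) (k::real). m0 \<le> m \<and> k = 2 * pi * real m * sqrt 2 \<longrightarrow>
       helmholtz_invertible k 0 \<and>
       (\<forall>y\<in>{y. op_norm k (helmholtz_inv k 0) * cmod y < 1/2}. helmholtz_invertible k y) \<and>
       op_holomorphic_on k (helmholtz_inv k)
         {y. op_norm k (helmholtz_inv k 0) * cmod y < 1/2} \<and>
       (\<exists>y0. op_norm k (helmholtz_inv k 0) * cmod y0 \<le> C \<and>
          (\<forall>\<^sub>F y in at y0. helmholtz_invertible k y) \<and>
          op_has_pole k (helmholtz_inv k) y0))"
proof (intro exI[of _ "16::nat"] exI[of _ "640::real"] conjI allI impI)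
  fix m :: nat and k :: real
  assume mk: "16 \<le> m \<and> k = 2 * pi * real m * sqrt 2"
  then have k_eq: "k = 2 * pi * real m * sqrt 2" by blast
  \<comment> \<open>\<open>m0 = 16\<close> is taken so that \<open>k\<close> exceeds 125, the
    threshold of \<open>resonance_fixpoint\<close>.\<close>
  have "2 * 3 * 16 * (7/5) \<le> 2 * pi * real m * sqrt 2"
  proof (intro mult_mono)
    show "(7/5) \<le> sqrt (2::real)" by (rule real_le_rsqrt) (auto simp: power2_eq_square)
    show "3 \<le> pi" using pi_gt3 by simp
  qed (use mk in auto)
  then have k125: "k \<ge> 125" by (simp add: k_eq)
  then have k: "k > 0" by simp
  note lin = linear_to_dual_helmholtz[OF k]
  have inv0: "has_bounded_inverse k (helmholtz k 0) (80 * k)"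
    using mk by (intro inverse_at_0[of m]) auto
  define N where "N = op_norm k (helmholtz_inv k 0)"
  have B0: "helmholtz_inv k 0 \<in> bounded_ops k"
    unfolding helmholtz_inv_def by (rule inverse_bounded_ops[OF lin inv0])
  have N_le: "N \<le> 80 * k"
    unfolding N_def helmholtz_inv_def using k by (intro op_norm_le norm_inverse_le[OF lin inv0]) auto
  have N0: "0 \<le> N" unfolding N_def using norm_le_op_norm[OF B0] by (rule op_norm_nonneg)
  \<comment> \<open>The ball of holomorphy is given by the exact operator norm, so
    \<open>80 * k\<close> is replaced by \<open>N\<close> here; \<open>80 * k\<close> returns only
    to bound the position of the pole.\<close>
  have invN: "has_bounded_inverse k (helmholtz k 0) N"
    unfolding has_bounded_inverse_def
  proof (intro conjI ballI)
    show "bij_betw (helmholtz k 0) H_space (H_dual k)" using inv0 by (simp add: has_bounded_inverse_def)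
    fix u assume u: "u \<in> H_space"
    have "helmholtz_inv k 0 (helmholtz k 0 u) = u"
      unfolding helmholtz_inv_def using u by (intro inverse_eqI[OF lin inv0]) auto
    then show "H_norm k u \<le> N * dual_norm k (helmholtz k 0 u)"
      using norm_le_op_norm[OF B0 linear_to_dual_H_dual[OF lin[of 0] u]] by (simp add: N_def)
  qed
  show "helmholtz_invertible k 0" by (rule helmholtz_invertibleI[OF k inv0])
  let ?S = "{y. N * cmod y < 1/2}"
  let ?A = "\<lambda>y u v. helmholtz k 0 u v + (y - 0) * mass u v"
  have A: "helmholtz k y u = ?A y u" if "u \<in> H_space" for y u
    unfolding diff_zero by (rule ext) (rule helmholtz_split[OF that])
  have invS: "has_bounded_inverse k (helmholtz k y) (N / (1 - cmod (y - 0) * N))" if "y \<in> ?S" for y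
  proof -
    have "cmod (y - 0) * N < 1" using that by (simp add: mult.commute)
    then have "has_bounded_inverse k (?A y) (N / (1 - cmod (y - 0) * N))"
      by (intro Neumann lin invN linear_to_dual_mass dual_norm_mass_le k N0)
    moreover have "has_bounded_inverse k (helmholtz k y) c \<longleftrightarrow> has_bounded_inverse k (?A y) c" for c
      by (rule has_bounded_inverse_cong) (rule A)
    ultimately show ?thesis by (simp only:)
  qed
  then have "\<forall>y\<in>?S. helmholtz_invertible k y" using helmholtz_invertibleI[OF k] by blast
  then show "\<forall>y\<in>{y. op_norm k (helmholtz_inv k 0) * cmod y < 1/2}. helmholtz_invertible k y"
    unfolding N_def .
  have T: "helmholtz_inv k y = inv_into H_space (?A y)" for y
    unfolding helmholtz_inv_def using A by (intro inv_into_cong) blast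
  have "op_holomorphic_on k (helmholtz_inv k) ?S"
  proof (rule op_holomorphic_onI)
    fix y assume y: "y \<in> ?S"
    show "helmholtz_inv k y \<in> bounded_ops k"
      unfolding helmholtz_inv_def by (rule inverse_bounded_ops[OF lin invS[OF y]])
    have "cmod (z - 0) * N \<le> 1/2" if "z \<in> ?S" for z using that by (simp add: mult.commute)
    from has_op_deriv_inverse[OF lin invN linear_to_dual_mass dual_norm_mass_le k N0 this y]
    show "\<exists>D. has_op_deriv k (helmholtz_inv k) D y ?S"
      unfolding T[abs_def] by blast
  qed
  then show "op_holomorphic_on k (helmholtz_inv k) {y. op_norm k (helmholtz_inv k 0) * cmod y < 1/2}"
    unfolding N_def .
  obtain w where w: "cmod w \<le> 5" and exp_w: "exp (2 * \<i> * w)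
      = (1 + (of_real (1 / sqrt 2) + w / of_real k)) / (1 - (of_real (1 / sqrt 2) + w / of_real k))"
    by (rule resonance_fixpoint[OF k125])
  define \<kappa> where "\<kappa> = complex_of_real (1 / sqrt 2) + w / of_real k"
  note s = inverse_sqrt2_bounds
  have wk: "cmod (w / of_real k) \<le> 5 / k" using w k by (simp add: norm_divide divide_right_mono)
  have "5 / k \<le> 5 / 125" using k125 by (intro frac_le) auto
  with wk have wk2: "cmod (w / of_real k) \<le> (1/25)" by simp
  have ns: "cmod (complex_of_real (1 / sqrt 2)) = 1 / sqrt 2" by (simp add: norm_divide)
  have n\<kappa>: "cmod \<kappa> \<le> (3/4)"
    unfolding \<kappa>_def using norm_triangle_ineq[of "complex_of_real (1 / sqrt 2)" "w / of_real k"] wk2 s ns by linarith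
  have \<kappa>0: "\<kappa> \<noteq> 0"
  proof
    assume "\<kappa> = 0"
    then have "complex_of_real (1 / sqrt 2) = - (w / of_real k)" by (simp add: \<kappa>_def add_eq_0_iff)
    then have "1 / sqrt 2 = cmod (w / of_real k)" using ns by (metis norm_minus_cancel)
    then show False using wk2 s by simp
  qed
  interpret layered_medium k \<kappa> by unfold_locales (rule k, rule \<kappa>0)
  have ne: "1 - \<kappa> \<noteq> 0" using n\<kappa> by auto
  have "K = of_real (2 * real m * pi) + w"
  proof -
    have "K = of_real k * (of_real (1 / sqrt 2) + w / of_real k)" unfolding K_def by (simp only: \<kappa>_def)
    also have "\<dots> = of_real (k * (1 / sqrt 2)) + w" using k by (simp add: distrib_left)
    also have "k * (1 / sqrt 2) = 2 * real m * pi" unfolding k_eq by simp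
    finally show ?thesis .
  qed
  then have "2 * \<i> * K = 2 * \<i> * w + of_real (2 * (2 * real m) * pi) * \<i>" by (simp add: algebra_simps)
  \<comment> \<open>The choice of \<open>k\<close> enters here: \<open>2 pi m\<close> contributes
    whole periods, and the resonance condition for \<open>K\<close> becomes the equation solved by
    \<open>w\<close>.\<close>
  then have "exp (2 * \<i> * K) = exp (2 * \<i> * w) * exp (of_real (2 * real (2 * m) * pi) * \<i>)"
    by (simp add: exp_add)
  also have "exp (of_real (2 * real (2 * m) * pi) * \<i>) = 1"
    by (rule exp_eq_1[THEN iffD2]) (auto intro!: exI[of _ "int (2 * m)"])
  finally have "exp (2 * \<i> * K) * (1 - \<kappa>) = 1 + \<kappa>"
    using exp_w ne unfolding \<kappa>_def[symmetric] by simp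
  then have D: "discriminant = 0" by (rule resonance_if_exp)
  have "(cmod \<kappa>)\<^sup>2 \<le> (3/4)\<^sup>2" using n\<kappa> by (intro power_mono) auto
  \<comment> \<open>\<open>1 - 9/16 = 7/16\<close> exceeds 2/5.\<close>
  then have "125 * (2/5) \<le> k * (1 - (cmod \<kappa>)\<^sup>2)" using k125 by (intro mult_mono) (auto simp: power2_eq_square)
  then have "1 < k * (1 - (cmod \<kappa>)\<^sup>2)" by simp
  from mass_mode_ne_0[OF D this] have \<beta>: "mass mode (\<lambda>x. cnj (mode x)) \<noteq> 0" .
  have "N * cmod (1/2 - \<kappa>\<^sup>2) \<le> 640"
  proof -
    \<comment> \<open>Difference of squares: one factor of \<open>1/2 - \<kappa>^2\<close> is
      \<open>w / k\<close> up to sign, the other has modulus at most \<open>71/100 + 3/4\<close>,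
      below 8/5. Hence the resonance has modulus at most \<open>8 / k\<close>.\<close>
    have "(1/2 :: complex) = (of_real (1 / sqrt 2))\<^sup>2" by (simp add: power_divide flip: of_real_power)
    then have "1/2 - \<kappa>\<^sup>2 = - ((w / of_real k) * (of_real (1 / sqrt 2) + \<kappa>))"
      by (simp add: \<kappa>_def power2_eq_square algebra_simps)
    then have "cmod (1/2 - \<kappa>\<^sup>2) = cmod (w / of_real k) * cmod (of_real (1 / sqrt 2) + \<kappa>)"
      by (simp only: norm_minus_cancel norm_mult)
    also have "\<dots> \<le> 5 / k * (8/5)"
      using norm_triangle_ineq[of "complex_of_real (1 / sqrt 2)" \<kappa>] n\<kappa> s ns k by (intro mult_mono wk) auto
    finally have "cmod (1/2 - \<kappa>\<^sup>2) \<le> 8 / k" by simp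
    then have "N * cmod (1/2 - \<kappa>\<^sup>2) \<le> 80 * k * (8 / k)" using N_le k by (intro mult_mono) auto
    then show ?thesis using k by simp
  qed
  then show "\<exists>y0. op_norm k (helmholtz_inv k 0) * cmod y0 \<le> 640 \<and>
      (\<forall>\<^sub>F y in at y0. helmholtz_invertible k y) \<and> op_has_pole k (helmholtz_inv k) y0"
    unfolding N_def using resonance_pole[OF D \<beta>] by blast
qed auto

end
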